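(* For all integers $n\geq 0$, there exists a regular local $\mathbb{R}$-algebra $A$ of dimension $n$ with the following properties: (i) all positive semidefinite elements of $A$ are sums of squares in $A$; (ii) the field $\mathrm{Frac}(A)$ is formally real.
   Context: An element $f$ of a ring $A$ is positive semidefinite if, for every prime ideal $\mathfrak{p}$ of $A$ and every field ordering of $\mathrm{Frac}(A/\mathfrak{p})$, the image of $f$ in $\mathrm{Frac}(A/\mathfrak{p})$ is nonnegative. A field is formally real if it admits a field ordering. Sums of squares are finite. *)

theory Defs
  imports
    "HOL-Algebra.Algebra"
    "HOL-Algebra.Algebraic_Closure_Type"
    "HOL-Library.Extended_Nat"
begin

text \<open>Chains of primes \<open>p 0 \<subset> \<dots> \<subset> p k\<close> have length \<open>k\<close>.  The supremum over the empty set is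
  \<open>0\<close>, so the zero ring gets dimension \<open>0\<close>; it is not a local ring.\<close>

definition krull_dim :: "('a, 'm) ring_scheme \<Rightarrow> enat" where
  "krull_dim R = Sup {enat k | k.
     \<exists>p :: nat \<Rightarrow> 'a set. (\<forall>i\<le>k. primeideal (p i) R) \<and> (\<forall>i<k. p i \<subset> p (Suc i))}"

definition local_ring :: "('a, 'm) ring_scheme \<Rightarrow> bool" where
  "local_ring R \<longleftrightarrow> cring R \<and> (\<exists>!M. maximalideal M R)"

definition regular_local_ring :: "('a, 'm) ring_scheme \<Rightarrow> bool" where
  "regular_local_ring R \<longleftrightarrow> local_ring R \<and> noetherian_ring R \<and>
     (\<exists>M S. maximalideal M R \<and> S \<subseteq> M \<and> finite S \<and> enat (card S) = krull_dim R \<and> M = Idl\<^bsub>R\<^esub> S)"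

text \<open>The fraction field of a domain, as equivalence classes of pairs (numerator, denominator).
  The unions in the operations range over representatives; for a domain all members of such a
  union are the same class.\<close>

definition frac_pairs :: "('a, 'm) ring_scheme \<Rightarrow> ('a \<times> 'a) set" where
  "frac_pairs R = carrier R \<times> (carrier R - {\<zero>\<^bsub>R\<^esub>})"

definition frac_rel :: "('a, 'm) ring_scheme \<Rightarrow> (('a \<times> 'a) \<times> ('a \<times> 'a)) set" where
  "frac_rel R = {((a, b), (c, d)). (a, b) \<in> frac_pairs R \<and> (c, d) \<in> frac_pairs R \<and>
     a \<otimes>\<^bsub>R\<^esub> d = c \<otimes>\<^bsub>R\<^esub> b}"

definition fraction :: "('a, 'm) ring_scheme \<Rightarrow> 'a \<Rightarrow> 'a \<Rightarrow> ('a \<times> 'a) set" where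
  "fraction R a b = frac_rel R `` {(a, b)}"

definition frac_field :: "('a, 'm) ring_scheme \<Rightarrow> ('a \<times> 'a) set ring" where
  "frac_field R = \<lparr>
     carrier = frac_pairs R // frac_rel R,
     monoid.mult = (\<lambda>U V. \<Union>(a, b)\<in>U. \<Union>(c, d)\<in>V. fraction R (a \<otimes>\<^bsub>R\<^esub> c) (b \<otimes>\<^bsub>R\<^esub> d)),
     one = fraction R \<one>\<^bsub>R\<^esub> \<one>\<^bsub>R\<^esub>,
     ring.zero = fraction R \<zero>\<^bsub>R\<^esub> \<one>\<^bsub>R\<^esub>,
     add = (\<lambda>U V. \<Union>(a, b)\<in>U. \<Union>(c, d)\<in>V.
       fraction R (a \<otimes>\<^bsub>R\<^esub> d \<oplus>\<^bsub>R\<^esub> c \<otimes>\<^bsub>R\<^esub> b) (b \<otimes>\<^bsub>R\<^esub> d))\<rparr>"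

definition to_frac :: "('a, 'm) ring_scheme \<Rightarrow> 'a \<Rightarrow> ('a \<times> 'a) set" where
  "to_frac R a = fraction R a \<one>\<^bsub>R\<^esub>"

text \<open>An ordering is a relation \<open>r\<close>, where \<open>(a, b) \<in> r\<close> stands for \<open>a \<le> b\<close>.\<close>

definition field_ordering :: "('a, 'm) ring_scheme \<Rightarrow> ('a \<times> 'a) set \<Rightarrow> bool" where
  "field_ordering K r \<longleftrightarrow> linear_order_on (carrier K) r \<and>
     (\<forall>a\<in>carrier K. \<forall>b\<in>carrier K. \<forall>c\<in>carrier K. (a, b) \<in> r \<longrightarrow> (a \<oplus>\<^bsub>K\<^esub> c, b \<oplus>\<^bsub>K\<^esub> c) \<in> r) \<and>
     (\<forall>a\<in>carrier K. \<forall>b\<in>carrier K.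
        (\<zero>\<^bsub>K\<^esub>, a) \<in> r \<longrightarrow> (\<zero>\<^bsub>K\<^esub>, b) \<in> r \<longrightarrow> (\<zero>\<^bsub>K\<^esub>, a \<otimes>\<^bsub>K\<^esub> b) \<in> r)"

definition formally_real :: "('a, 'm) ring_scheme \<Rightarrow> bool" where
  "formally_real K \<longleftrightarrow> field K \<and> (\<exists>r. field_ordering K r)"

definition positive_semidefinite :: "('a, 'm) ring_scheme \<Rightarrow> 'a \<Rightarrow> bool" where
  "positive_semidefinite A f \<longleftrightarrow> f \<in> carrier A \<and>
     (\<forall>p r. primeideal p A \<longrightarrow> field_ordering (frac_field (A Quot p)) r \<longrightarrow>
        (\<zero>\<^bsub>frac_field (A Quot p)\<^esub>, to_frac (A Quot p) (p +>\<^bsub>A\<^esub> f)) \<in> r)"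

definition sum_of_squares :: "('a, 'm) ring_scheme \<Rightarrow> 'a \<Rightarrow> bool" where
  "sum_of_squares A f \<longleftrightarrow> (\<exists>(k::nat) g. g \<in> {..<k} \<rightarrow> carrier A \<and>
     f = (\<Oplus>\<^bsub>A\<^esub>i\<in>{..<k}. g i \<otimes>\<^bsub>A\<^esub> g i))"

end

theory Submission
  imports Defs "HOL-Library.Poly_Mapping" "HOL-Computational_Algebra.Polynomial"
begin

text \<open>Why such rings exist.  It is enough to find a regular local ring \<open>A\<close> with formally real fraction field
none of whose nonzero primes is real, in the strong form that every nonzero element of \<open>A\<close> divides
some \<open>1 + s\<close> with \<open>s\<close> a sum of squares (\<open>divides_one_plus_sos\<close>).  In such a ring let \<open>f \<noteq> 0\<close> be
positive semidefinite.  By Artin's theorem (\<open>artin\<close>), applied at the zero ideal, \<open>f\<close> is a sum of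
squares in the fraction field, say \<open>d\<^sup>2 f = \<tau>\<close>.  As \<open>\<tau>\<close> divides some \<open>1 + s\<close>, this gives
\<open>f t = 1 + r\<close> with \<open>t\<close> and \<open>r\<close> sums of squares.  Either \<open>t\<close> is a unit and \<open>f = (1 + r) t / t\<^sup>2\<close>, or
\<open>w = 4 + t (1 - f)\<^sup>2\<close> is a unit, and then \<open>f w = (1 + f)\<^sup>2 + r (1 - f)\<^sup>2\<close> and \<open>f = (f w) w / w\<^sup>2\<close>
(\<open>psd_sos_local\<close>).

To construct \<open>A\<close>, one has to supply for every nonzero nonunit \<open>f\<close> a solution of \<open>f g = 1 + s\<^sup>2 + t\<^sup>2\<close>.
Over the complex numbers, with \<open>u = s + \<i> t\<close> and \<open>v = s - \<i> t\<close>, this equation is \<open>u v = f g - 1\<close>, and it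
is solved by \<open>v = (f g - 1) / u\<close> with \<open>u\<close> and \<open>g\<close> independent variables.  So let \<open>K\<close> be the field of
rational functions over the complex numbers in variables \<open>x\<^sub>j\<close> and, for every formal real expression \<open>e\<close>
in the variables, a pair \<open>u\<^sub>e\<close>, \<open>g\<^sub>e\<close>.  The conjugation of \<open>K\<close> is complex conjugation on constants,
fixes \<open>x\<^sub>j\<close> and \<open>g\<^sub>e\<close>, and sends \<open>u\<^sub>e\<close> to \<open>(f\<^sub>e g\<^sub>e - 1) / u\<^sub>e\<close>, where \<open>f\<^sub>e\<close> is the value of \<open>e\<close>
if this is a nonzero element of the maximal ideal of the local ring described next, and \<open>x\<^sub>0\<close> otherwise.
There is no circularity because \<open>e\<close> can only mention variables whose index is a smaller expression.
Let \<open>local_at n\<close> be the localization of the polynomial ring at the prime \<open>(x\<^sub>0, \<dots>, x\<^sub>n\<^sub>-\<^sub>1)\<close>: the local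
ring of affine \<open>n\<close>-space at the origin, over the big field \<open>coeff_field n\<close> generated by the remaining
variables.  The conjugation preserves it (\<open>conj_in_local_at\<close>), since modulo the maximal ideal it is the
automorphism \<open>u\<^sub>e \<mapsto> - 1 / u\<^sub>e\<close> of the coefficient field.  The ring \<open>A\<close> is the fixed ring, \<open>real_local n\<close>.

Taking real parts carries the good properties of the complex local ring over to \<open>A\<close>: it is Noetherian
(\<open>noeth_real_local\<close>) with maximal ideal generated by \<open>x\<^sub>0, \<dots>, x\<^sub>n\<^sub>-\<^sub>1\<close> (\<open>maximal_ideal_span\<close>).  Its
dimension is at least \<open>n\<close> because of the primes generated by initial segments of these variables
(\<open>vanishing_chain\<close>), and at most \<open>n\<close> because \<open>n + 1\<close> elements always satisfy a polynomial relation over the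
coefficient field, whereas a chain of \<open>n + 2\<close> primes provides \<open>n + 1\<close> elements without one
(\<open>no_long_prime_chain\<close>).  Every nonzero nonunit of \<open>A\<close> is the value of an expression
(\<open>fixed_is_val\<close>), hence divides some \<open>1 + s\<^sup>2 + t\<^sup>2\<close>.  Finally the field fixed by the conjugation is
generated over the reals by the algebraically independent elements \<open>x\<^sub>j\<close>, \<open>s\<^sub>e\<close>, \<open>t\<^sub>e\<close>, so it is
formally real (\<open>fixed_field_real\<close>).  The expressions are no more numerous than the real numbers, which
allows the real numbers themselves to carry the ring structure (\<open>real_copy\<close>).\<close>

section \<open>Subrings, ideals and the Hilbert basis theorem\<close>

definition sub_ring :: "'a::comm_ring_1 set \<Rightarrow> bool" where
  "sub_ring R \<longleftrightarrow> 1 \<in> R \<and> (\<forall>a\<in>R. \<forall>b\<in>R. a + b \<in> R \<and> a * b \<in> R \<and> - a \<in> R)"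

lemma sub_ringD:
  assumes "sub_ring R"
  shows "1 \<in> R" "0 \<in> R" "a \<in> R \<Longrightarrow> - a \<in> R" "a \<in> R \<Longrightarrow> b \<in> R \<Longrightarrow> a + b \<in> R"
    "a \<in> R \<Longrightarrow> b \<in> R \<Longrightarrow> a * b \<in> R" "a \<in> R \<Longrightarrow> b \<in> R \<Longrightarrow> a - b \<in> R"
    "a \<in> R \<Longrightarrow> a ^ k \<in> R"
proof -
  show 1: "1 \<in> R" and 2: "\<And>a. a \<in> R \<Longrightarrow> - a \<in> R" and 3: "\<And>a b. a \<in> R \<Longrightarrow> b \<in> R \<Longrightarrow> a + b \<in> R"
    and 4: "\<And>a b. a \<in> R \<Longrightarrow> b \<in> R \<Longrightarrow> a * b \<in> R"
    using assms by (auto simp: sub_ring_def)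
  show "0 \<in> R" using 3[OF 1 2[OF 1]] by simp
  show "a \<in> R \<Longrightarrow> b \<in> R \<Longrightarrow> a - b \<in> R" using 3[of a "- b"] 2[of b] by simp
  show "a \<in> R \<Longrightarrow> a ^ k \<in> R" by (induction k) (auto simp: 1 4)
qed

lemma sub_ring_sum:
  assumes "sub_ring R" "\<And>i. i \<in> I \<Longrightarrow> f i \<in> R"
  shows "sum f I \<in> R"
  using assms(2) by (induction I rule: infinite_finite_induct) (auto intro: sub_ringD[OF assms(1)])

lemma sub_ring_prod:
  assumes "sub_ring R" "\<And>i. i \<in> I \<Longrightarrow> f i \<in> R"
  shows "prod f I \<in> R"
  using assms(2) by (induction I rule: infinite_finite_induct) (auto intro: sub_ringD[OF assms(1)])

text \<open>For \<open>S \<subseteq> R\<close> this is the ideal of \<open>R\<close> generated by \<open>S\<close>.  With \<open>R\<close> a subfield it is the linear span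
of \<open>S\<close>, a use in which \<open>S\<close> need not lie in \<open>R\<close>.\<close>

inductive_set ideal_span :: "'a::comm_ring_1 set \<Rightarrow> 'a set \<Rightarrow> 'a set" for R S where
  zero: "0 \<in> ideal_span R S"
| step: "a \<in> R \<Longrightarrow> s \<in> S \<Longrightarrow> b \<in> ideal_span R S \<Longrightarrow> a * s + b \<in> ideal_span R S"

lemma ideal_span_single: "a \<in> R \<Longrightarrow> s \<in> S \<Longrightarrow> a * s \<in> ideal_span R S"
  using ideal_span.step[of a R s S 0] ideal_span.zero[of R S] by simp

lemma ideal_span_base: "sub_ring R \<Longrightarrow> s \<in> S \<Longrightarrow> s \<in> ideal_span R S"
  using ideal_span_single[of 1 R s S] sub_ringD(1) by force

lemma ideal_span_add: "a \<in> ideal_span R S \<Longrightarrow> b \<in> ideal_span R S \<Longrightarrow> a + b \<in> ideal_span R S"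
  by (induction rule: ideal_span.induct) (auto simp: add.assoc intro: ideal_span.step)

lemma ideal_span_mult:
  assumes "sub_ring R" "r \<in> R" "a \<in> ideal_span R S"
  shows "r * a \<in> ideal_span R S"
  using assms(3)
proof induction
  case (step a s b)
  then show ?case
    using ideal_span.step[OF sub_ringD(5)[OF assms(1,2) step(1)] step(2) step.IH]
    by (simp add: algebra_simps)
qed (simp add: ideal_span.zero)

lemma ideal_span_uminus:
  assumes "sub_ring R" "a \<in> ideal_span R S"
  shows "- a \<in> ideal_span R S"
  using ideal_span_mult[OF assms(1) sub_ringD(3)[OF assms(1) sub_ringD(1)[OF assms(1)]] assms(2)]
  by simp

lemma ideal_span_diff:
  assumes "sub_ring R" "a \<in> ideal_span R S" "b \<in> ideal_span R S"
  shows "a - b \<in> ideal_span R S"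
  using ideal_span_add[OF assms(2) ideal_span_uminus[OF assms(1,3)]] by simp

lemma ideal_span_subset:
  assumes "sub_ring R" "R' \<subseteq> R" "S \<subseteq> ideal_span R T"
  shows "ideal_span R' S \<subseteq> ideal_span R T"
proof
  fix a assume "a \<in> ideal_span R' S"
  then show "a \<in> ideal_span R T"
    using assms by induction (auto intro!: ideal_span.zero ideal_span_add ideal_span_mult)
qed

lemma ideal_span_mono: "S \<subseteq> T \<Longrightarrow> a \<in> ideal_span R S \<Longrightarrow> a \<in> ideal_span R T"
  by (rotate_tac, induction rule: ideal_span.induct) (auto intro: ideal_span.intros)

lemma ideal_span_in_ring:
  assumes "sub_ring R" "S \<subseteq> R" shows "ideal_span R S \<subseteq> R"
proof
  fix a assume "a \<in> ideal_span R S"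
  then show "a \<in> R"
    using assms(2) by induction (auto intro: sub_ringD[OF assms(1)])
qed

lemma ideal_span_finite_support:
  assumes "a \<in> ideal_span R S"
  shows "\<exists>F\<subseteq>S. finite F \<and> a \<in> ideal_span R F"
  using assms
proof induction
  case zero then show ?case by (auto intro!: exI[of _ "{}"] ideal_span.zero)
next
  case (step a s b)
  then obtain F where "F \<subseteq> S" "finite F" "b \<in> ideal_span R F" by auto
  then show ?case using step
    by (intro exI[of _ "insert s F"]) (auto intro!: ideal_span.step elim: ideal_span_mono[rotated])
qed

text \<open>The finite generating set is chosen inside the given set, and so inside every subring that contains it:
this is how the property descends to the real local ring.\<close>

definition noeth :: "'a::comm_ring_1 set \<Rightarrow> bool" where
  "noeth R \<longleftrightarrow> (\<forall>S\<subseteq>R. \<exists>F\<subseteq>S. finite F \<and> S \<subseteq> ideal_span R F)"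

lemma noeth_sequence:
  fixes f :: "nat \<Rightarrow> 'a::comm_ring_1"
  assumes "sub_ring R" "noeth R" "\<And>k. f k \<in> R"
  shows "\<exists>N. f N \<in> ideal_span R (f ` {..<N})"
proof -
  obtain F where F: "F \<subseteq> range f" "finite F" "range f \<subseteq> ideal_span R F"
    using assms(2,3) unfolding noeth_def by (metis image_subsetI)
  obtain K where K: "finite K" "F = f ` K" using F(1,2) by (meson finite_subset_image subset_UNIV)
  obtain N where "K \<subseteq> {..<N}" using K(1) finite_nat_iff_bounded by auto
  then show ?thesis using F(3) K(2)
    by (intro exI[of _ N]) (auto intro!: ideal_span_mono[of "f ` K" "f ` {..<N}"])
qed

text \<open>Otherwise one could keep choosing elements outside the span of the previous choices.  The side condition
\<open>P\<close> on each choice, for instance minimality of a degree, becomes available for the resulting sequence.\<close>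

lemma ideal_finitely_spanned_if_greedy:
  assumes R: "sub_ring R"
    and greedy: "\<And>f :: nat \<Rightarrow> 'a::comm_ring_1. (\<And>k. f k \<in> I \<and> P (f ` {..<k}) (f k)) \<Longrightarrow> \<exists>N. f N \<in> ideal_span R (f ` {..<N})"
    and choose: "\<And>F. finite F \<Longrightarrow> F \<subseteq> I \<Longrightarrow> \<not> I \<subseteq> ideal_span R F
        \<Longrightarrow> \<exists>a\<in>I. a \<notin> ideal_span R F \<and> P F a"
  shows "\<exists>F\<subseteq>I. finite F \<and> I \<subseteq> ideal_span R F"
proof (rule ccontr)
  assume neg: "\<not> ?thesis"
  define nx where "nx F = (SOME a. a \<in> I \<and> a \<notin> ideal_span R F \<and> P F a)" for F
  have nx: "nx F \<in> I \<and> nx F \<notin> ideal_span R F \<and> P F (nx F)" if "finite F" "F \<subseteq> I" for F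
    unfolding nx_def by (rule someI_ex) (use choose[OF that] neg that in blast)
  define G where "G = rec_nat {} (\<lambda>_ F. insert (nx F) F)"
  have G0: "G 0 = {}" and GS: "G (Suc k) = insert (nx (G k)) (G k)" for k by (auto simp: G_def)
  have fin: "finite (G k) \<and> G k \<subseteq> I" for k by (induction k) (auto simp: G0 GS nx)
  have G: "G k = (\<lambda>k. nx (G k)) ` {..<k}" for k
    by (induction k) (auto simp: G0 GS lessThan_Suc)
  have "\<exists>N. nx (G N) \<in> ideal_span R ((\<lambda>k. nx (G k)) ` {..<N})"
  proof (rule greedy)
    show "nx (G k) \<in> I \<and> P ((\<lambda>k. nx (G k)) ` {..<k}) (nx (G k))" for k
      using nx[of "G k"] fin[of k] G[of k] by metis
  qed
  then show False using nx fin G by metis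
qed

text \<open>A finite generating set of the ideal generated by \<open>S\<close> involves only finitely many elements of \<open>S\<close>.\<close>

lemma noethI_sets:
  assumes R: "sub_ring R" and "\<And>I. I \<subseteq> R \<Longrightarrow> ideal_span R I \<subseteq> I \<Longrightarrow> \<exists>F\<subseteq>I. finite F \<and> I \<subseteq> ideal_span R F"
  shows "noeth R"
  unfolding noeth_def
proof (intro allI impI)
  fix S assume S: "S \<subseteq> R"
  let ?I = "ideal_span R S"
  have "?I \<subseteq> R" "ideal_span R ?I \<subseteq> ?I"
    using ideal_span_in_ring[OF R S] ideal_span_subset[OF R] by auto
  from assms(2)[OF this] obtain F where F: "F \<subseteq> ?I" "finite F" "?I \<subseteq> ideal_span R F" by auto
  have "\<exists>H\<subseteq>S. finite H \<and> a \<in> ideal_span R H" if "a \<in> F" for a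
    using that F(1) ideal_span_finite_support by blast
  then obtain H where H: "\<And>a. a \<in> F \<Longrightarrow> H a \<subseteq> S \<and> finite (H a) \<and> a \<in> ideal_span R (H a)"
    by metis
  have "F \<subseteq> ideal_span R (\<Union>a\<in>F. H a)"
  proof
    fix a assume a: "a \<in> F"
    show "a \<in> ideal_span R (\<Union>a\<in>F. H a)"
      by (rule ideal_span_mono[of "H a"]) (use a H in auto)
  qed
  then have "ideal_span R F \<subseteq> ideal_span R (\<Union>a\<in>F. H a)" by (rule ideal_span_subset[OF R order_refl])
  moreover have "S \<subseteq> ?I" using ideal_span_base[OF R] by auto
  ultimately have "S \<subseteq> ideal_span R (\<Union>a\<in>F. H a)" using F(3) by blast
  moreover have "(\<Union>a\<in>F. H a) \<subseteq> S" "finite (\<Union>a\<in>F. H a)" using F(2) H by blast+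
  ultimately show "\<exists>F\<subseteq>S. finite F \<and> S \<subseteq> ideal_span R F" by blast
qed

definition coeffs_in :: "'a::comm_ring_1 set \<Rightarrow> 'a poly set" where
  "coeffs_in R = {p. \<forall>i. poly.coeff p i \<in> R}"

lemma sub_ring_coeffs_in: "sub_ring R \<Longrightarrow> sub_ring (coeffs_in R)"
  unfolding sub_ring_def[of "coeffs_in R"]
  by (auto simp: coeffs_in_def coeff_mult coeff_1 intro: sub_ringD sub_ring_sum)

text \<open>Multiplying the given polynomials by suitable monomials brings all of them to degree \<open>d\<close>, where the
combination of leading coefficients can be carried out.\<close>

lemma ideal_span_image_lead_coeff:
  assumes R: "sub_ring R" and "b \<in> ideal_span R (lead_coeff ` F)"
    and "\<And>f. f \<in> F \<Longrightarrow> f \<noteq> 0 \<and> Polynomial.degree f \<le> d"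
  shows "\<exists>q\<in>ideal_span (coeffs_in R) F. Polynomial.degree q \<le> d \<and> poly.coeff q d = b"
  using assms(2)
proof induction
  case zero
  then show ?case by (intro bexI[of _ 0]) (auto intro: ideal_span.zero)
next
  case (step a s b)
  then obtain q f where q: "q \<in> ideal_span (coeffs_in R) F" "Polynomial.degree q \<le> d" "poly.coeff q d = b"
    and f: "f \<in> F" "s = lead_coeff f" by auto
  have df: "Polynomial.degree f \<le> d" using assms(3) f by auto
  let ?m = "Polynomial.monom a (d - Polynomial.degree f)"
  have m: "?m \<in> coeffs_in R" using step(1) sub_ringD(2)[OF R] by (auto simp: coeffs_in_def)
  have "Polynomial.degree (?m * f) \<le> d"
    using degree_mult_le[of ?m f] degree_monom_le[of a "d - Polynomial.degree f"] df by linarith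
  moreover have "poly.coeff (?m * f) d = a * s"
    using df f by (simp add: coeff_monom_mult)
  ultimately show ?case
    using ideal_span.step[OF m f(1) q(1)] q(2,3)
    by (intro bexI[of _ "?m * f + q"]) (auto intro: degree_add_le)
qed

text \<open>In the greedy sequence every element has minimal degree outside the ideal of its predecessors.  The
leading coefficients cannot remain independent, and a dependence between them lowers the degree of some
element modulo its predecessors.\<close>

theorem hilbert_basis:
  fixes R :: "'a::comm_ring_1 set"
  assumes R: "sub_ring R" and "noeth R"
  shows "noeth (coeffs_in R)"
proof (rule noethI_sets[OF sub_ring_coeffs_in[OF R]])
  let ?RX = "coeffs_in R"
  note RX = sub_ring_coeffs_in[OF R]
  fix I assume I: "I \<subseteq> ?RX" "ideal_span ?RX I \<subseteq> I"
  show "\<exists>F\<subseteq>I. finite F \<and> I \<subseteq> ideal_span ?RX F"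
  proof (rule ideal_finitely_spanned_if_greedy[OF RX, where P = "\<lambda>F a. a \<notin> ideal_span ?RX F \<and>
      (\<forall>b\<in>I. b \<notin> ideal_span ?RX F \<longrightarrow> Polynomial.degree a \<le> Polynomial.degree b)"])
    fix F assume "\<not> I \<subseteq> ideal_span ?RX F"
    then show "\<exists>a\<in>I. a \<notin> ideal_span ?RX F \<and> (a \<notin> ideal_span ?RX F \<and>
      (\<forall>b\<in>I. b \<notin> ideal_span ?RX F \<longrightarrow> Polynomial.degree a \<le> Polynomial.degree b))"
      using ex_has_least_nat[of "\<lambda>a. a \<in> I \<and> a \<notin> ideal_span ?RX F" _ Polynomial.degree] by blast
  next
    fix f :: "nat \<Rightarrow> 'a poly"
    assume f: "\<And>k. f k \<in> I \<and> f k \<notin> ideal_span ?RX (f ` {..<k}) \<and>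
      (\<forall>b\<in>I. b \<notin> ideal_span ?RX (f ` {..<k}) \<longrightarrow> Polynomial.degree (f k) \<le> Polynomial.degree b)"
    have nz: "f k \<noteq> 0" for k using f[of k] ideal_span.zero by metis
    have deg: "Polynomial.degree (f i) \<le> Polynomial.degree (f k)" if "i \<le> k" for i k
    proof -
      have "f ` {..<i} \<subseteq> f ` {..<k}" using that by auto
      then show ?thesis using f[of i] f[of k] ideal_span_mono by blast
    qed
    have "lead_coeff (f k) \<in> R" for k using f[of k] I(1) by (auto simp: coeffs_in_def)
    then obtain N where N: "lead_coeff (f N) \<in> ideal_span R ((\<lambda>k. lead_coeff (f k)) ` {..<N})"
      using noeth_sequence[OF R assms(2), of "\<lambda>k. lead_coeff (f k)"] by auto
    let ?F = "f ` {..<N}" and ?d = "Polynomial.degree (f N)"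
    have "\<exists>q\<in>ideal_span ?RX ?F. Polynomial.degree q \<le> ?d \<and> poly.coeff q ?d = lead_coeff (f N)"
      by (rule ideal_span_image_lead_coeff[OF R]) (use N deg nz in \<open>auto simp: image_image\<close>)
    then obtain q where q: "q \<in> ideal_span ?RX ?F" "Polynomial.degree q \<le> ?d"
      "poly.coeff q ?d = lead_coeff (f N)" by auto
    have FI: "?F \<subseteq> ideal_span ?RX I" "?F \<subseteq> I" using f ideal_span_base[OF RX] by auto
    have "f N - q \<in> ideal_span ?RX I"
      using ideal_span_diff[OF RX ideal_span_base[OF RX]] f q(1) ideal_span_mono[OF FI(2)] by blast
    then have qI: "f N - q \<in> I" using I(2) by blast
    show "\<exists>N. f N \<in> ideal_span ?RX (f ` {..<N})"
    proof (cases "f N - q \<in> ideal_span ?RX ?F")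
      case True
      then have "f N - q + q \<in> ideal_span ?RX ?F" using q(1) ideal_span_add by blast
      then show ?thesis by auto
    next
      case False
      then have le: "?d \<le> Polynomial.degree (f N - q)" using f[of N] qI by blast
      have "Polynomial.degree (f N - q) \<le> ?d" using q(2) by (intro degree_diff_le) auto
      with le have "lead_coeff (f N - q) = 0" using q(3) by simp
      then have "f N - q = 0" by (simp only: leading_coeff_0_iff)
      then show ?thesis using q(1) by auto
    qed
  qed
qed

lemma ideal_span_image:
  assumes "h 0 = 0" "\<And>a b. h (a + b) = h a + h b" "\<And>a b. h (a * b) = h a * h b"
    and "a \<in> ideal_span R S"
  shows "h a \<in> ideal_span (h ` R) (h ` S)"
  using assms(4) by induction (auto simp: assms(1-3) intro: ideal_span.intros)

lemma noeth_image:
  assumes "h 0 = 0" "\<And>a b. h (a + b) = h a + h b" "\<And>a b. h (a * b) = h a * h b" "noeth R"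
  shows "noeth (h ` R)"
  unfolding noeth_def
proof (intro allI impI)
  fix S assume "S \<subseteq> h ` R"
  then obtain T where T: "T \<subseteq> R" "S = h ` T" by (meson subset_imageE)
  then obtain F where "F \<subseteq> T" "finite F" "T \<subseteq> ideal_span R F"
    using assms(4) unfolding noeth_def by auto
  then show "\<exists>F\<subseteq>S. finite F \<and> S \<subseteq> ideal_span (h ` R) F"
    using T ideal_span_image[OF assms(1-3)]
    by (intro exI[of _ "h ` F"]) (auto simp: subset_eq)
qed

lemma sub_ring_image:
  assumes "h 1 = 1" "\<And>a b. h (a + b) = h a + h b" "\<And>a b. h (a * b) = h a * h b" "sub_ring R"
  shows "sub_ring (h ` R)"
proof -
  have "h 0 + h 0 = h 0" using assms(2)[of 0 0] by simp
  then have 0: "h 0 = 0" by simp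
  have "h (- a) = - h a" for a using assms(2)[of a "- a"] 0 by (simp add: add_eq_0_iff)
  then show ?thesis using assms(4) unfolding sub_ring_def
    by (smt (verit, best) assms(1-3) image_iff)
qed

definition adjoin :: "'a::comm_ring_1 set \<Rightarrow> 'a \<Rightarrow> 'a set" where
  "adjoin R y = (\<lambda>p. poly p y) ` coeffs_in R"

lemma adjoin:
  assumes "sub_ring R"
  shows "sub_ring (adjoin R y)" "noeth R \<Longrightarrow> noeth (adjoin R y)" "R \<subseteq> adjoin R y" "y \<in> adjoin R y"
proof -
  show "sub_ring (adjoin R y)" unfolding adjoin_def
    by (rule sub_ring_image) (auto intro: sub_ring_coeffs_in assms)
  show "noeth R \<Longrightarrow> noeth (adjoin R y)" unfolding adjoin_def
    by (rule noeth_image) (auto intro: hilbert_basis assms)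
  show "R \<subseteq> adjoin R y" unfolding adjoin_def
    using sub_ringD[OF assms]
    by (auto simp: coeffs_in_def coeff_pCons intro!: image_eqI[of _ _ "[:_:]"] split: nat.split)
  show "y \<in> adjoin R y" unfolding adjoin_def
    using sub_ringD[OF assms]
    by (auto simp: coeffs_in_def coeff_pCons intro!: image_eqI[of _ _ "[:0, 1:]"] split: nat.split)
qed

lemma adjoin_subset:
  assumes "sub_ring T" "R \<subseteq> T" "y \<in> T"
  shows "adjoin R y \<subseteq> T"
  using assms by (auto simp: adjoin_def coeffs_in_def poly_altdef intro!: sub_ring_sum sub_ringD)

lemma noeth_field:
  assumes "sub_ring R" "\<And>a. a \<in> R \<Longrightarrow> a \<noteq> 0 \<Longrightarrow> inverse a \<in> R"
  shows "noeth (R :: 'a::field set)"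
  unfolding noeth_def
proof (intro allI impI)
  fix S assume S: "S \<subseteq> R"
  show "\<exists>F\<subseteq>S. finite F \<and> S \<subseteq> ideal_span R F"
  proof (cases "S \<subseteq> {0}")
    case True
    then show ?thesis by (intro exI[of _ "{}"]) (auto intro: ideal_span.zero)
  next
    case False
    then obtain s where s: "s \<in> S" "s \<noteq> 0" by auto
    have "a \<in> ideal_span R {s}" if "a \<in> S" for a
    proof -
      have "a * inverse s \<in> R" using that s S assms by (auto intro: sub_ringD)
      then show ?thesis using ideal_span_single[of "a * inverse s" R s "{s}"] s(2)
        by (simp add: mult.assoc)
    qed
    then show ?thesis using s by (intro exI[of _ "{s}"]) auto
  qed
qed

text \<open>Localizations are covered by this: the numerators of a generating set can be chosen from a finite set.\<close>

lemma noeth_fractions: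
  assumes R: "sub_ring R" "noeth R" and T: "sub_ring T" "R \<subseteq> T"
    and frac: "\<And>a. a \<in> T \<Longrightarrow> \<exists>b\<in>T. \<exists>c\<in>T. b * c = 1 \<and> b * a \<in> R"
  shows "noeth T"
  unfolding noeth_def
proof (intro allI impI)
  fix S assume S: "S \<subseteq> T"
  then have "\<exists>b. \<forall>a\<in>S. b a \<in> T \<and> b a * a \<in> R \<and> (\<exists>c\<in>T. b a * c = 1)"
    by (intro bchoice) (use frac in blast)
  then obtain b where b: "\<And>a. a \<in> S \<Longrightarrow> b a \<in> T \<and> b a * a \<in> R \<and> (\<exists>c\<in>T. b a * c = 1)" by auto
  have "(\<lambda>a. b a * a) ` S \<subseteq> R" using b by auto
  then obtain F where F: "F \<subseteq> (\<lambda>a. b a * a) ` S" "finite F" "(\<lambda>a. b a * a) ` S \<subseteq> ideal_span R F"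
    using R(2) unfolding noeth_def by meson
  then obtain H where H: "H \<subseteq> S" "finite H" "F = (\<lambda>a. b a * a) ` H" by (meson finite_subset_image)
  have FH: "F \<subseteq> ideal_span T H" using H b by (auto intro!: ideal_span_single)
  have "S \<subseteq> ideal_span T H"
  proof
    fix a assume a: "a \<in> S"
    then obtain c where c: "c \<in> T" "b a * c = 1" using b by blast
    have "b a * a \<in> ideal_span T H" using F(3) a ideal_span_subset[OF T(1,2) FH] by blast
    then have "c * (b a * a) \<in> ideal_span T H" by (rule ideal_span_mult[OF T(1) c(1)])
    moreover have "c * (b a * a) = a" using c(2) by (metis mult.assoc mult.commute mult_1)
    ultimately show "a \<in> ideal_span T H" by simp
  qed
  then show "\<exists>F\<subseteq>S. finite F \<and> S \<subseteq> ideal_span T F" using H by auto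
qed

section \<open>Sums of squares and orderings\<close>

definition sub_field :: "'a::field set \<Rightarrow> bool" where
  "sub_field K \<longleftrightarrow> sub_ring K \<and> (\<forall>a\<in>K. inverse a \<in> K)"

lemma sub_fieldD:
  assumes "sub_field E"
  shows "sub_ring E" "a \<in> E \<Longrightarrow> inverse a \<in> E" "a \<in> E \<Longrightarrow> b \<in> E \<Longrightarrow> a / b \<in> E"
  using assms sub_ringD(5)[of E a "inverse b"] by (auto simp: sub_field_def divide_inverse)

definition fractions :: "'a::field set \<Rightarrow> 'a set" where
  "fractions T = {a / b | a b. a \<in> T \<and> b \<in> T \<and> b \<noteq> 0}"

lemma fractionsI: "a \<in> T \<Longrightarrow> b \<in> T \<Longrightarrow> b \<noteq> 0 \<Longrightarrow> a / b \<in> fractions T"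
  by (auto simp: fractions_def)

lemma sub_field_fractions:
  assumes T: "sub_ring T"
  shows "sub_field (fractions T)"
proof -
  note T' = sub_ringD[OF T]
  have "u + v \<in> fractions T \<and> u * v \<in> fractions T" if uv: "u \<in> fractions T" "v \<in> fractions T" for u v
  proof -
    obtain a b c d where *: "a \<in> T" "b \<in> T" "b \<noteq> 0" "u = a / b" "c \<in> T" "d \<in> T" "d \<noteq> 0" "v = c / d"
      using uv by (auto simp: fractions_def)
    have "(a * d + c * b) / (b * d) \<in> fractions T" "(a * c) / (b * d) \<in> fractions T"
      using * by (auto intro!: fractionsI T')
    then show ?thesis using * by (simp add: add_frac_eq)
  qed
  moreover have "- u \<in> fractions T" if u: "u \<in> fractions T" for u
  proof -
    obtain a b where *: "a \<in> T" "b \<in> T" "b \<noteq> 0" "u = a / b" using u by (auto simp: fractions_def)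
    then have "(- a) / b \<in> fractions T" by (intro fractionsI T')
    then show ?thesis using * by simp
  qed
  moreover have "1 \<in> fractions T" using fractionsI[of 1 T 1] T'(1) by simp
  ultimately have R: "sub_ring (fractions T)" by (simp add: sub_ring_def)
  moreover have "inverse u \<in> fractions T" if u: "u \<in> fractions T" for u
  proof (cases "u = 0")
    case False
    obtain a b where *: "a \<in> T" "b \<in> T" "b \<noteq> 0" "u = a / b" using u by (auto simp: fractions_def)
    then have "b / a \<in> fractions T" using False by (intro fractionsI) auto
    then show ?thesis using * by simp
  qed (use sub_ringD(2)[OF R] in simp)
  ultimately show ?thesis by (simp add: sub_field_def)
qed

lemma fractions_base:
  assumes "sub_ring T" "a \<in> T"
  shows "a \<in> fractions T"
  using fractionsI[of a T 1] assms sub_ringD(1)[OF assms(1)] by simp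

inductive_set sos :: "'a::comm_ring_1 set \<Rightarrow> 'a set" for R where
  zero: "0 \<in> sos R"
| step: "a \<in> R \<Longrightarrow> b \<in> sos R \<Longrightarrow> a * a + b \<in> sos R"

lemma sos_square: "a \<in> R \<Longrightarrow> a * a \<in> sos R"
  using sos.step[OF _ sos.zero, of a R] by simp

lemma sos_mono: "R \<subseteq> T \<Longrightarrow> a \<in> sos R \<Longrightarrow> a \<in> sos T"
  by (rotate_tac, induction rule: sos.induct) (auto intro: sos.intros)

lemma sos_add: "a \<in> sos R \<Longrightarrow> b \<in> sos R \<Longrightarrow> a + b \<in> sos R"
  by (induction rule: sos.induct) (auto simp: add.assoc intro: sos.step)

lemma sos_square_mult:
  assumes "sub_ring R" "c \<in> R" "b \<in> sos R"
  shows "c * c * b \<in> sos R"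
  using assms(3)
proof induction
  case (step a b)
  then show ?case using sos.step[OF sub_ringD(5)[OF assms(1,2) step(1)] step.IH]
    by (simp add: algebra_simps)
qed (simp add: sos.zero)

lemma sos_mult:
  assumes "sub_ring R" "a \<in> sos R" "b \<in> sos R"
  shows "a * b \<in> sos R"
  using assms(2)
proof induction
  case (step c d)
  then show ?case
    using sos_add[OF sos_square_mult[OF assms(1) step(1) assms(3)] step.IH] by (simp add: algebra_simps)
qed (simp add: sos.zero)

lemma sos_one: "sub_ring R \<Longrightarrow> 1 \<in> sos R"
  using sos_square[of 1 R] sub_ringD(1) by force

lemma sos_subset: "sub_ring R \<Longrightarrow> sos R \<subseteq> R"
proof
  fix a assume "sub_ring R" "a \<in> sos R"
  then show "a \<in> R" by (induction rule: sos.induct[consumes 1, OF \<open>a \<in> sos R\<close>]) (auto intro: sub_ringD)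
qed

definition precone :: "'a::field set \<Rightarrow> 'a set \<Rightarrow> bool" where
  "precone K P \<longleftrightarrow> P \<subseteq> K \<and> sos K \<subseteq> P \<and> - 1 \<notin> P \<and> (\<forall>a\<in>P. \<forall>b\<in>P. a + b \<in> P \<and> a * b \<in> P)"

definition positive_cone :: "'a::field set \<Rightarrow> 'a set \<Rightarrow> bool" where
  "positive_cone K P \<longleftrightarrow> P \<subseteq> K \<and> (\<forall>a\<in>P. \<forall>b\<in>P. a + b \<in> P \<and> a * b \<in> P) \<and>
     (\<forall>a\<in>K. a \<in> P \<or> - a \<in> P) \<and> (\<forall>a. a \<in> P \<longrightarrow> - a \<in> P \<longrightarrow> a = 0)"

text \<open>If \<open>- 1 = a + b x\<close>, then \<open>- x = (1 + a) b / b\<^sup>2\<close> would belong to the cone.\<close>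

lemma precone_extend:
  assumes K: "sub_field K" and P: "precone K P" and x: "x \<in> K" "- x \<notin> P"
  shows "precone K {a + b * x | a b. a \<in> P \<and> b \<in> P}" (is "precone K ?Q")
proof -
  have R: "sub_ring K" and inv: "\<And>a. a \<in> K \<Longrightarrow> inverse a \<in> K" using K by (auto simp: sub_field_def)
  have PK: "P \<subseteq> K" "sos K \<subseteq> P" "- 1 \<notin> P" "\<And>a b. a \<in> P \<Longrightarrow> b \<in> P \<Longrightarrow> a + b \<in> P"
    "\<And>a b. a \<in> P \<Longrightarrow> b \<in> P \<Longrightarrow> a * b \<in> P"
    using P by (auto simp: precone_def)
  have 0: "0 \<in> P" using PK(2) sos.zero by blast
  have 1: "?Q \<subseteq> K" using PK(1) x by (auto intro!: sub_ringD[OF R])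
  have "P \<subseteq> ?Q" using 0 by force
  then have 2: "sos K \<subseteq> ?Q" using PK(2) by blast
  have 3: "- 1 \<notin> ?Q"
  proof
    assume "- 1 \<in> ?Q"
    then obtain a b where ab: "a \<in> P" "b \<in> P" "- 1 = a + b * x" by auto
    show False
    proof (cases "b = 0")
      case True
      then have "- 1 = a" using ab(3) by simp
      then show ?thesis using ab(1) PK(3) by simp
    next
      case False
      have ii: "1 \<in> P" "inverse b * inverse b \<in> P"
        using sos_one[OF R] sos_square[of "inverse b" K] inv[of b] PK(1,2) ab(2) by auto
      have *: "(1 + a) * (b * (inverse b * inverse b)) \<in> P"
        using PK(5)[OF PK(4)[OF ii(1) ab(1)] PK(5)[OF ab(2) ii(2)]] .
      have "- x = (1 + a) * (b * (inverse b * inverse b))"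
      proof -
        have "b * x = (a + b * x) - a" by simp
        also have "\<dots> = - 1 - a" by (subst ab(3)) (rule refl)
        finally have "1 + a = - x * b" by (simp only: mult_minus_left mult.commute[of x b]) simp
        then have e1: "(1 + a) * (b * (inverse b * inverse b)) = (- x * b) * (b * (inverse b * inverse b))"
          by (rule arg_cong)
        have e2: "(- x * b) * (b * (inverse b * inverse b)) = - x * (b * inverse b) * (b * inverse b)"
          by (simp only: mult.assoc mult.left_commute)
        have e3: "- x * (b * inverse b) * (b * inverse b) = - x" by (simp only: right_inverse[OF False] mult_1_right)
        show ?thesis by (rule trans[OF e1 trans[OF e2 e3], symmetric])
      qed
      then have "- x \<in> P" using * by (simp only:)
      with x(2) show ?thesis ..
    qed
  qed
  have 4: "u + v \<in> ?Q \<and> u * v \<in> ?Q" if uv: "u \<in> ?Q" "v \<in> ?Q" for u v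
  proof -
    obtain a b c d where *: "a \<in> P" "b \<in> P" "c \<in> P" "d \<in> P" "u = a + b * x" "v = c + d * x"
      using uv by auto
    have "u + v = (a + c) + (b + d) * x" unfolding *(5,6) by (simp add: distrib_right)
    moreover have "u * v = (a * c + b * d * (x * x)) + (a * d + b * c) * x"
      unfolding *(5,6) by (simp add: algebra_simps)
    moreover have xx: "x * x \<in> P" using sos_square[OF x(1)] PK(2) by blast
    have "a + c \<in> P" "b + d \<in> P" using *(1-4) PK(4) by simp_all
    moreover have "a * c + b * d * (x * x) \<in> P" "a * d + b * c \<in> P"
      by (rule PK(4)[OF PK(5)[OF *(1,3)] PK(5)[OF PK(5)[OF *(2,4)] xx]],
          rule PK(4)[OF PK(5)[OF *(1,4)] PK(5)[OF *(2,3)]])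
    ultimately show ?thesis by blast
  qed
  show ?thesis unfolding precone_def using 1 2 3 4 by blast
qed

text \<open>A maximal element among the cones without \<open>- 1\<close>, which exists by Zorn's lemma, is total because it
cannot be extended further.\<close>

lemma positive_cone_containing:
  assumes K: "sub_field K" and P: "precone K P"
  shows "\<exists>Q. P \<subseteq> Q \<and> positive_cone K Q"
proof -
  let ?A = "{Q. precone K Q \<and> P \<subseteq> Q}"
  have "\<exists>M\<in>?A. \<forall>Z\<in>?A. M \<subseteq> Z \<longrightarrow> Z = M"
  proof (rule subset_Zorn)
    fix C assume C: "subset.chain ?A C"
    show "\<exists>U\<in>?A. \<forall>Z\<in>C. Z \<subseteq> U"
    proof (cases "C = {}")
      case True then show ?thesis using P by auto
    next
      case False
      have CA: "C \<subseteq> ?A" and ch: "\<And>Z Y. Z \<in> C \<Longrightarrow> Y \<in> C \<Longrightarrow> Z \<subseteq> Y \<or> Y \<subseteq> Z"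
        using C unfolding subset_chain_def by auto
      have "a + b \<in> \<Union>C \<and> a * b \<in> \<Union>C" if ab: "a \<in> \<Union>C" "b \<in> \<Union>C" for a b
      proof -
        obtain Y1 Y where XY: "Y1 \<in> C" "a \<in> Y1" "Y \<in> C" "b \<in> Y" using ab by auto
        then obtain Z where "Z \<in> C" "a \<in> Z" "b \<in> Z" using ch by blast
        then show ?thesis using CA unfolding precone_def by blast
      qed
      moreover have "\<Union>C \<subseteq> K" "- 1 \<notin> \<Union>C" "sos K \<subseteq> \<Union>C" "P \<subseteq> \<Union>C"
        using CA False unfolding precone_def by blast+
      ultimately show ?thesis by (intro bexI[of _ "\<Union>C"]) (auto simp: precone_def)
    qed
  qed
  then obtain M where M: "precone K M" "P \<subseteq> M" and max: "\<And>Z. precone K Z \<Longrightarrow> M \<subseteq> Z \<Longrightarrow> Z = M"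
    by (smt (verit) mem_Collect_eq order_trans)
  have R: "sub_ring K" and inv: "\<And>a. a \<in> K \<Longrightarrow> inverse a \<in> K" using K by (auto simp: sub_field_def)
  have 01: "0 \<in> M" "1 \<in> M" and MK: "M \<subseteq> K"
    using M(1) sos.zero sos_one[OF R] by (auto simp: precone_def)
  have "x \<in> M" if x: "x \<in> K" "- x \<notin> M" for x
  proof -
    let ?Q = "{a + b * x | a b. a \<in> M \<and> b \<in> M}"
    have "M \<subseteq> ?Q" using 01 by force
    then have "?Q = M" by (rule max[OF precone_extend[OF K M(1) x]])
    moreover have "x \<in> ?Q" using 01 by force
    ultimately show ?thesis by simp
  qed
  moreover have "a = 0" if a: "a \<in> M" "- a \<in> M" for a
  proof (rule ccontr)
    assume nz: "a \<noteq> 0"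
    have "inverse a * inverse a \<in> M"
      using M(1) inv a MK sos_square[of "inverse a" K] by (auto simp: precone_def)
    moreover have "\<And>u v. u \<in> M \<Longrightarrow> v \<in> M \<Longrightarrow> u * v \<in> M" using M(1) by (simp add: precone_def)
    ultimately have "(a * - a) * (inverse a * inverse a) \<in> M" using a by blast
    moreover have "(a * - a) * (inverse a * inverse a) = - (a * inverse a) * (a * inverse a)"
      by (simp add: algebra_simps)
    ultimately show False using nz M(1) by (simp add: precone_def)
  qed
  ultimately have "positive_cone K M"
    using M(1) unfolding positive_cone_def precone_def by blast
  then show ?thesis using M(2) by blast
qed

text \<open>Artin's theorem.  If \<open>- 1\<close> were a sum of squares, then so would be \<open>f\<close>, a difference of two squares.
Hence the sums of squares form a cone, to which \<open>- f\<close> can be adjoined.\<close>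

theorem artin:
  assumes K: "sub_field K" and two: "(2 :: 'a::field) \<noteq> 0" and f: "f \<in> K" "f \<notin> sos K"
  shows "\<exists>P. positive_cone K P \<and> (f::'a) \<notin> P"
proof -
  have R: "sub_ring K" and inv: "\<And>a. a \<in> K \<Longrightarrow> inverse a \<in> K" using K by (auto simp: sub_field_def)
  have "- 1 \<notin> sos K"
  proof
    assume m1: "- 1 \<in> sos K"
    have "2 \<in> K" using sub_ringD(4)[OF R sub_ringD(1)[OF R] sub_ringD(1)[OF R]] by simp
    then obtain h where h: "h \<in> K" "2 * h = 1" using inv right_inverse[OF two] by blast
    define p q where "p = (f + 1) * h" and "q = (f - 1) * h"
    have "p \<in> K" "q \<in> K" unfolding p_def q_def
      by (intro sub_ringD(4-6)[OF R] h f(1) sub_ringD(1)[OF R])+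
    then have "p * p + (- 1) * (q * q) \<in> sos K" by (intro sos_add sos_mult[OF R] m1 sos_square)
    moreover have "p * p + (- 1) * (q * q) = (p + q) * (p - q)" by (simp add: algebra_simps)
    moreover have "p + q = (2 * h) * f" "p - q = 2 * h"
      unfolding p_def q_def mult_2 by (simp_all add: algebra_simps)
    moreover note h(2)
    ultimately show False using f(2) by simp
  qed
  then have "precone K (sos K)"
    using sos_subset[OF R] sos_add sos_mult[OF R] by (auto simp: precone_def)
  from precone_extend[OF K this, of "- f"] f
  have Q: "precone K {a + b * (- f) | a b. a \<in> sos K \<and> b \<in> sos K}" (is "precone K ?Q")
    using sub_ringD(3)[OF R] by auto
  then obtain P where P: "?Q \<subseteq> P" "positive_cone K P" using positive_cone_containing[OF K] by blast
  have "- f \<in> ?Q" using sos.zero[of K] sos_one[OF R] by force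
  then have "- f \<in> P" using P(1) by blast
  then have "f \<notin> P" using P(2) f(2) sos.zero[of K] unfolding positive_cone_def by blast
  then show ?thesis using P by blast
qed

text \<open>Here \<open>m\<close> is the maximal ideal.  The divisibility hypothesis, applied to \<open>d\<^sup>2 f\<close>, produces sums of
squares with \<open>f t = 1 + r\<close>, after which the identity \<open>4 f = (1 + f)\<^sup>2 - (1 - f)\<^sup>2\<close> and
\<open>- 1 = r - f t\<close> replace \<open>t\<close> by a unit if necessary.\<close>

lemma psd_sos_local:
  fixes A :: "'a::field set"
  assumes A: "sub_ring A" and two: "inverse (2::'a) \<in> A" "(2::'a) \<noteq> 0"
    and m: "\<And>a b. a \<in> m \<Longrightarrow> b \<in> m \<Longrightarrow> a - b \<in> m" "\<And>a b. a \<in> A \<Longrightarrow> b \<in> m \<Longrightarrow> a * b \<in> m" "1 \<notin> m" "0 \<in> m"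
    and loc: "\<And>a. a \<in> A \<Longrightarrow> a \<notin> m \<Longrightarrow> inverse a \<in> A"
    and real: "\<And>a. a \<in> A \<Longrightarrow> a \<noteq> 0 \<Longrightarrow> \<exists>h\<in>A. \<exists>s\<in>sos A. a * h = 1 + s"
    and d: "d \<in> A" "d \<noteq> 0" "d * d * f \<in> sos A" and f: "f \<in> A"
  shows "f \<in> sos A"
proof (cases "f = 0")
  case False
  note [intro] = sub_ringD[OF A]
  \<comment> \<open>The factor \<open>t\<close> is \<open>(d h)\<^sup>2 \<tau>\<close>, so that \<open>f t = (\<tau> h)\<^sup>2 = (1 + s)\<^sup>2\<close>.\<close>
  define tau where "tau = d * d * f"
  have tau: "tau \<in> sos A" "tau \<in> A" "tau \<noteq> 0" using d False f by (auto simp: tau_def)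
  obtain h s where hs: "h \<in> A" "s \<in> sos A" "tau * h = 1 + s" using real[OF tau(2,3)] by blast
  define t r where "t = (d * h) * (d * h) * tau" and "r = s + s + s * s"
  have t: "t \<in> sos A" "t \<in> A" unfolding t_def using d(1) hs(1) tau by (auto intro!: sos_square_mult[OF A])
  have r: "r \<in> sos A" unfolding r_def by (intro sos_add sos_mult[OF A] hs(2))
  have "f * t = (tau * h) * (tau * h)" by (simp add: t_def tau_def algebra_simps)
  also have "\<dots> = 1 + r" by (simp only: hs(3)) (simp add: r_def algebra_simps)
  finally have ft: "f * t = 1 + r" .
  show ?thesis
  proof (cases "t \<in> m")
    case False
    then have ti: "inverse t \<in> A" "t \<noteq> 0" using loc[OF t(2)] m(4) by auto
    have "inverse t * inverse t * ((1 + r) * t) \<in> sos A"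
      by (intro sos_square_mult[OF A ti(1)] sos_mult[OF A] sos_add sos_one[OF A] r t)
    also have "inverse t * inverse t * ((1 + r) * t) = f * (inverse t * t) * (inverse t * t)"
      by (simp add: ft[symmetric] algebra_simps)
    finally show ?thesis using ti(2) by simp
  next
    case True
    define w where "w = 4 + t * ((1 - f) * (1 - f))"
    have four: "(4::'a) = 1 + (1 + (1 + 1))" by simp
    have w: "w \<in> sos A" unfolding w_def four using t(1) f
      by (intro sos_add sos_mult[OF A] sos_square sos_one[OF A]) auto
    have "w \<notin> m"
    proof
      assume "w \<in> m"
      moreover have "t * ((1 - f) * (1 - f)) \<in> m"
        using m(2)[of "(1 - f) * (1 - f)" t] True f by (auto simp: mult.commute)
      ultimately have "4 \<in> m" using m(1)[of w "t * ((1 - f) * (1 - f))"] by (simp add: w_def)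
      then have "inverse 2 * inverse 2 * 4 \<in> m" by (intro m(2) sub_ringD(5)[OF A] two(1))
      moreover have "inverse 2 * inverse 2 * 4 = (inverse 2 * 2) * (inverse 2 * (2::'a))"
        by (simp only: mult.assoc mult.left_commute flip: numeral_Bit0_eq_double)
      moreover have "inverse 2 * 2 = (1::'a)" using two(2) by (rule left_inverse)
      ultimately show False using m(3) by simp
    qed
    then have wi: "inverse w \<in> A" "w \<noteq> 0" using loc w sos_subset[OF A] m(4) by auto
    have "f * w = (1 + f) * (1 + f) - (1 - f) * (1 - f) + (f * t) * ((1 - f) * (1 - f))"
      by (simp add: w_def algebra_simps)
    also have "\<dots> = (1 + f) * (1 + f) + (1 - f) * (1 - f) * r"
      unfolding ft by (simp add: algebra_simps)
    also have "\<dots> \<in> sos A"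
      using f r by (intro sos_add sos_square_mult[OF A] sos_square) auto
    finally have "f * w \<in> sos A" .
    from sos_square_mult[OF A wi(1) sos_mult[OF A this w]]
    have "inverse w * inverse w * ((f * w) * w) \<in> sos A" .
    also have "inverse w * inverse w * ((f * w) * w) = f * (inverse w * w) * (inverse w * w)"
      by (simp add: algebra_simps)
    finally show ?thesis by (simp only: left_inverse[OF wi(2)] mult_1_right)
  qed
qed (simp add: sos.zero)

section \<open>Polynomials in arbitrarily many variables and their fractions\<close>

definition ring_map :: "('a::comm_ring_1 \<Rightarrow> 'b::comm_ring_1) \<Rightarrow> bool" where
  "ring_map f \<longleftrightarrow> f 1 = 1 \<and> (\<forall>a b. f (a + b) = f a + f b) \<and> (\<forall>a b. f (a * b) = f a * f b)"

lemma ring_mapD: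
  assumes "ring_map f"
  shows "f 1 = 1" "f (a + b) = f a + f b" "f (a * b) = f a * f b" "f 0 = 0" "f (- a) = - f a"
    "f (a - b) = f a - f b"
proof -
  show 1: "f 1 = 1" and 2: "\<And>a b. f (a + b) = f a + f b" and "f (a * b) = f a * f b"
    using assms by (auto simp: ring_map_def)
  have "f 0 + f 0 = f 0" using 2[of 0 0] by simp
  then show 0: "f 0 = 0" by simp
  show 3: "f (- a) = - f a" for a using 2[of a "- a"] 0 by (simp add: add_eq_0_iff)
  show "f (a - b) = f a - f b" using 2[of a "- b"] 3 by simp
qed

lemma ring_map_comp: "ring_map f \<Longrightarrow> ring_map g \<Longrightarrow> ring_map (\<lambda>x. f (g x))"
  by (auto simp: ring_map_def)

lemma ring_map_inverse:
  assumes "ring_map (f :: 'a::field \<Rightarrow> 'b::field)"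
  shows "f (inverse a) = inverse (f a)" "f (a / b) = f a / f b" "f a = 0 \<longleftrightarrow> a = 0"
proof -
  have *: "f a * f (inverse a) = 1" if "a \<noteq> 0" for a
    using that by (simp add: ring_mapD[OF assms] flip: ring_mapD(3)[OF assms])
  show z: "f a = 0 \<longleftrightarrow> a = 0" using *[of a] ring_mapD(4)[OF assms] by (cases "a = 0") auto
  show i: "f (inverse a) = inverse (f a)" for a
    using *[of a] ring_mapD(4)[OF assms] by (cases "a = 0") (auto dest: inverse_unique)
  show "f (a / b) = f a / f b" by (simp add: divide_inverse ring_mapD[OF assms] i)
qed

lemma poly_ring_map:
  assumes "ring_map f"
  shows "poly (map_poly f q) (f x) = f (poly q x)"
  by (induction q) (auto simp: map_poly_pCons ring_mapD[OF assms])

text \<open>Polynomials over \<open>'k\<close> in the variables \<open>'v\<close> are finitely supported functions on the monomials, which in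
turn are finitely supported exponent functions.\<close>

definition Cnst :: "'k::comm_ring_1 \<Rightarrow> ('v \<Rightarrow>\<^sub>0 nat) \<Rightarrow>\<^sub>0 'k" where
  "Cnst c = Poly_Mapping.single 0 c"

definition Vr :: "'v \<Rightarrow> ('v \<Rightarrow>\<^sub>0 nat) \<Rightarrow>\<^sub>0 'k::comm_ring_1" where
  "Vr v = Poly_Mapping.single (Poly_Mapping.single v 1) 1"

definition mono_eval :: "('v \<Rightarrow> 'b::comm_ring_1) \<Rightarrow> ('v \<Rightarrow>\<^sub>0 nat) \<Rightarrow> 'b" where
  "mono_eval z m = (\<Prod>v\<in>Poly_Mapping.keys m. z v ^ Poly_Mapping.lookup m v)"

definition peval :: "('k::comm_ring_1 \<Rightarrow> 'b::comm_ring_1) \<Rightarrow> ('v \<Rightarrow> 'b) \<Rightarrow> (('v \<Rightarrow>\<^sub>0 nat) \<Rightarrow>\<^sub>0 'k) \<Rightarrow> 'b" where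
  "peval h z p = (\<Sum>m\<in>Poly_Mapping.keys p. h (Poly_Mapping.lookup p m) * mono_eval z m)"

lemma ring_map_Cnst: "ring_map Cnst"
  by (auto simp: ring_map_def Cnst_def single_add mult_single)

lemma mono_eval_superset:
  assumes "finite K" "Poly_Mapping.keys m \<subseteq> K"
  shows "mono_eval z m = (\<Prod>v\<in>K. z v ^ Poly_Mapping.lookup m v)"
  unfolding mono_eval_def using assms
  by (intro prod.mono_neutral_left) (auto simp: in_keys_iff)

lemma mono_eval_add: "mono_eval z (m + n) = mono_eval z m * mono_eval z n"
proof -
  let ?K = "Poly_Mapping.keys m \<union> Poly_Mapping.keys n"
  have "Poly_Mapping.keys (m + n) \<subseteq> ?K" by (rule keys_add)
  then show ?thesis
    by (simp add: mono_eval_superset[of ?K] lookup_add power_add prod.distrib)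
qed

lemma peval_superset:
  assumes "finite K" "Poly_Mapping.keys p \<subseteq> K" "h 0 = 0"
  shows "peval h z p = (\<Sum>m\<in>K. h (Poly_Mapping.lookup p m) * mono_eval z m)"
  unfolding peval_def using assms
  by (intro sum.mono_neutral_left) (auto simp: in_keys_iff)

lemma poly_mapping_single_induct:
  assumes "\<And>m c. Q (Poly_Mapping.single m c)" "\<And>p q. Q p \<Longrightarrow> Q q \<Longrightarrow> Q (p + q)"
  shows "Q (p :: 'a \<Rightarrow>\<^sub>0 'b::comm_monoid_add)"
proof -
  have "Q (\<Sum>m\<in>K. Poly_Mapping.single m (Poly_Mapping.lookup p m))" if "finite K" for K
    using that
  proof induction
    case empty then show ?case using assms(1)[of undefined 0] by simp
  qed (auto intro: assms)
  moreover have "(\<Sum>m\<in>Poly_Mapping.keys p. Poly_Mapping.single m (Poly_Mapping.lookup p m)) = p"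
    by (rule poly_mapping_eqI)
      (auto simp: lookup_sum lookup_single when_def in_keys_iff)
  ultimately show ?thesis using finite_keys by metis
qed

lemma peval_single: "h 0 = 0 \<Longrightarrow> peval h z (Poly_Mapping.single m c) = h c * mono_eval z m"
  by (subst peval_superset[of "{m}"]) auto

lemma peval_add:
  assumes "ring_map h"
  shows "peval h z (p + q) = peval h z p + peval h z q"
proof -
  let ?K = "Poly_Mapping.keys p \<union> Poly_Mapping.keys q"
  have "Poly_Mapping.keys (p + q) \<subseteq> ?K" by (rule keys_add)
  then show ?thesis
    by (simp add: peval_superset[of ?K] lookup_add sum.distrib ring_mapD[OF assms] distrib_right)
qed

lemma ring_map_peval:
  assumes h: "ring_map h"
  shows "ring_map (peval h z)"
proof -
  note h0 = ring_mapD(4)[OF h]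
  have s: "peval h z (Poly_Mapping.single m c * q) = peval h z (Poly_Mapping.single m c) * peval h z q"
    for m c q
    by (induction q rule: poly_mapping_single_induct)
      (auto simp: mult_single peval_single[of h, OF h0] mono_eval_add ring_mapD[OF h] algebra_simps
        peval_add[OF h])
  have "peval h z (p * q) = peval h z p * peval h z q" for p q
    by (induction p rule: poly_mapping_single_induct) (auto simp: s distrib_right peval_add[OF h])
  moreover have "peval h z 1 = 1"
    using peval_single[of h z 0 1, OF h0] ring_mapD(1)[OF h] by (simp add: mono_eval_def)
  ultimately show ?thesis using peval_add[OF h] by (auto simp: ring_map_def)
qed

lemma peval_Cnst: "ring_map h \<Longrightarrow> peval h z (Cnst c) = h c"
  by (simp add: Cnst_def peval_single ring_mapD mono_eval_def)

lemma peval_Vr: "ring_map h \<Longrightarrow> peval h z (Vr v) = z v"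
  by (simp add: Vr_def peval_single ring_mapD mono_eval_def)

lemma mono_eval_Vr: "mono_eval Vr m = (Poly_Mapping.single m 1 :: ('v \<Rightarrow>\<^sub>0 nat) \<Rightarrow>\<^sub>0 'k::comm_ring_1)"
proof -
  have pw: "Vr v ^ k = (Poly_Mapping.single (Poly_Mapping.single v k) 1 :: ('v \<Rightarrow>\<^sub>0 nat) \<Rightarrow>\<^sub>0 'k)" for v k
    by (induction k) (auto simp: Vr_def mult_single simp flip: single_add)
  have "(\<Prod>v\<in>K. Vr v ^ f v) = (Poly_Mapping.single (\<Sum>v\<in>K. Poly_Mapping.single v (f v)) 1 :: ('v \<Rightarrow>\<^sub>0 nat) \<Rightarrow>\<^sub>0 'k)"
    for K f
    by (induction K rule: infinite_finite_induct) (auto simp: pw mult_single)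
  moreover have "(\<Sum>v\<in>Poly_Mapping.keys m. Poly_Mapping.single v (Poly_Mapping.lookup m v)) = m"
    by (rule poly_mapping_eqI)
      (auto simp: lookup_sum lookup_single when_def in_keys_iff)
  ultimately show ?thesis by (simp add: mono_eval_def)
qed

lemma polynomial_induct [case_names Cnst Vr add mult]:
  fixes p :: "('v \<Rightarrow>\<^sub>0 nat) \<Rightarrow>\<^sub>0 'k::comm_ring_1"
  assumes "\<And>c. Q (Cnst c)" "\<And>v. Q (Vr v)" "\<And>p q. Q p \<Longrightarrow> Q q \<Longrightarrow> Q (p + q)"
    "\<And>p q. Q p \<Longrightarrow> Q q \<Longrightarrow> Q (p * q)"
  shows "Q p"
proof (induction p rule: poly_mapping_single_induct)
  case (1 m c)
  have 1: "Q 1" using assms(1)[of 1] ring_mapD(1)[OF ring_map_Cnst] by metis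
  then have pw: "Q (Vr v ^ k)" for v k by (induction k) (auto intro: assms)
  have "Q (\<Prod>v\<in>K. Vr v ^ f v)" for K f
    by (induction K rule: infinite_finite_induct) (auto intro: assms 1 pw)
  then have "Q (Poly_Mapping.single m 1)" unfolding mono_eval_Vr[symmetric] mono_eval_def .
  then have "Q (Cnst c * Poly_Mapping.single m 1)" by (intro assms)
  then show ?case by (simp add: Cnst_def mult_single)
qed (auto intro: assms)

lemma ring_map_unique:
  assumes "ring_map f" "ring_map g" "\<And>c. f (Cnst c) = g (Cnst c)" "\<And>v. f (Vr v) = g (Vr v)"
  shows "f p = g p"
  by (induction p rule: polynomial_induct) (auto simp: assms ring_mapD)

inductive_set polys_in :: "'v set \<Rightarrow> (('v \<Rightarrow>\<^sub>0 nat) \<Rightarrow>\<^sub>0 'k::comm_ring_1) set" for V where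
  Cnst: "Cnst c \<in> polys_in V"
| Vr: "v \<in> V \<Longrightarrow> Vr v \<in> polys_in V"
| add: "p \<in> polys_in V \<Longrightarrow> q \<in> polys_in V \<Longrightarrow> p + q \<in> polys_in V"
| mult: "p \<in> polys_in V \<Longrightarrow> q \<in> polys_in V \<Longrightarrow> p * q \<in> polys_in V"

lemma sub_ring_polys_in: "sub_ring (polys_in V)"
proof -
  have "Cnst (- 1) * p = - p" for p :: "('a \<Rightarrow>\<^sub>0 nat) \<Rightarrow>\<^sub>0 'b"
    by (simp add: ring_mapD[OF ring_map_Cnst])
  then have "- p \<in> polys_in V" if "p \<in> polys_in V" for p :: "('a \<Rightarrow>\<^sub>0 nat) \<Rightarrow>\<^sub>0 'b"
    using polys_in.mult[OF polys_in.Cnst[of "- 1"] that] by simp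
  then show ?thesis using polys_in.Cnst[of 1 V]
    by (auto simp: sub_ring_def ring_mapD[OF ring_map_Cnst] intro: polys_in.intros)
qed

lemma polys_in_mono: "V \<subseteq> W \<Longrightarrow> p \<in> polys_in V \<Longrightarrow> p \<in> polys_in W"
  by (rotate_tac, induction rule: polys_in.induct) (auto intro: polys_in.intros)

lemma polys_in_finite: "\<exists>V. finite V \<and> p \<in> polys_in V"
proof (induction p rule: polynomial_induct)
  case (Cnst c) then show ?case by (auto intro!: exI[of _ "{}"] polys_in.Cnst)
next
  case (Vr v) then show ?case by (auto intro!: exI[of _ "{v}"] polys_in.Vr)
next
  case (add p q)
  then obtain V W where "finite V" "p \<in> polys_in V" "finite W" "q \<in> polys_in W" by auto
  then show ?case
    by (intro exI[of _ "V \<union> W"]) (auto intro: polys_in.add polys_in_mono[OF Un_upper1] polys_in_mono[OF Un_upper2])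
next
  case (mult p q)
  then obtain V W where "finite V" "p \<in> polys_in V" "finite W" "q \<in> polys_in W" by auto
  then show ?case
    by (intro exI[of _ "V \<union> W"]) (auto intro: polys_in.mult polys_in_mono[OF Un_upper1] polys_in_mono[OF Un_upper2])
qed

lemma polys_in_insert: "polys_in (insert v V) \<subseteq> adjoin (polys_in V) (Vr v)"
proof
  note a = adjoin[OF sub_ring_polys_in[of V], of "Vr v"]
  fix p :: "('a \<Rightarrow>\<^sub>0 nat) \<Rightarrow>\<^sub>0 'b" assume "p \<in> polys_in (insert v V)"
  then show "p \<in> adjoin (polys_in V) (Vr v)"
    by induction (use a(3,4) in \<open>auto intro: sub_ringD[OF a(1)] polys_in.intros\<close>)
qed

text \<open>Induction on the number of variables.  The variable \<open>v\<close> to be split off may be chosen by the user of the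
rule; the property is inherited from the leading coefficient with respect to \<open>v\<close>.\<close>

lemma polynomial_variable_induct [consumes 3, case_names const step]:
  assumes "finite V" "p \<in> polys_in V" "p \<noteq> 0" and const: "\<And>c. c \<noteq> 0 \<Longrightarrow> Q (Cnst c)"
    and step: "\<And>V. finite V \<Longrightarrow> V \<noteq> {} \<Longrightarrow> \<exists>v\<in>V. \<forall>q. q \<noteq> 0 \<longrightarrow> q \<in> coeffs_in (polys_in (V - {v})) \<longrightarrow>
        Q (lead_coeff q) \<longrightarrow> Q (poly q (Vr v))"
  shows "Q (p :: ('v \<Rightarrow>\<^sub>0 nat) \<Rightarrow>\<^sub>0 'k::comm_ring_1)"
  using assms(1-3)
proof (induction "card V" arbitrary: V p)
  case 0
  then have "p \<in> polys_in {}" by auto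
  then have "\<exists>c. p = Cnst c"
    by induction (auto intro: ring_mapD[OF ring_map_Cnst, symmetric])
  then show ?case using 0(4) const ring_mapD(4)[OF ring_map_Cnst] by metis
next
  case (Suc k)
  then have "V \<noteq> {}" by auto
  from step[OF Suc(3) this] obtain v where v: "v \<in> V"
    and st: "\<And>q. q \<noteq> 0 \<Longrightarrow> q \<in> coeffs_in (polys_in (V - {v})) \<Longrightarrow> Q (lead_coeff q) \<Longrightarrow> Q (poly q (Vr v))"
    by blast
  have "p \<in> adjoin (polys_in (V - {v})) (Vr v)"
    using polys_in_insert[of v "V - {v}"] v Suc(4) by (auto simp: insert_absorb)
  then obtain q where q: "q \<in> coeffs_in (polys_in (V - {v}))" "p = poly q (Vr v)"
    by (auto simp: adjoin_def)
  have "q \<noteq> 0" using q(2) Suc(5) by auto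
  moreover have "Q (lead_coeff q)"
    by (rule Suc.hyps(1)[of "V - {v}"])
      (use Suc.hyps(2) v Suc(3) q(1) \<open>q \<noteq> 0\<close> in \<open>auto simp: coeffs_in_def\<close>)
  ultimately show ?case using st q by blast
qed

text \<open>Algebraic independence of the elements \<open>z v\<close>, for a triangular substitution.  An endomorphism that moves
\<open>z v\<close> through infinitely many values but fixes the constants and all \<open>z w\<close> of no larger rank shows that
\<open>z v\<close> is transcendental over the field generated by the latter: its images are roots of the same
polynomial.  Splitting off a variable of maximal rank then reduces the number of variables.\<close>

lemma substitution_injective:
  fixes h :: "'k::comm_ring_1 \<Rightarrow> 'b::field" and z :: "'v \<Rightarrow> 'b" and rank :: "'v \<Rightarrow> nat"
  assumes h: "ring_map h" "\<And>c. h c = 0 \<Longrightarrow> c = 0"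
    and move: "\<And>v. \<exists>T :: 'i \<Rightarrow> 'b \<Rightarrow> 'b. (\<forall>i. ring_map (T i) \<and> (\<forall>c. T i (h c) = h c) \<and>
        (\<forall>w. w \<noteq> v \<longrightarrow> rank w \<le> rank v \<longrightarrow> T i (z w) = z w)) \<and> infinite (range (\<lambda>i. T i (z v)))"
    and "p \<noteq> 0"
  shows "peval h z p \<noteq> 0"
proof -
  let ?e = "peval h z"
  note e = ring_map_peval[OF h(1), of z]
  obtain V where "finite V" "p \<in> polys_in V" using polys_in_finite by blast
  then show ?thesis using \<open>p \<noteq> 0\<close>
  proof (induction rule: polynomial_variable_induct)
    case (const c)
    then show ?case using h(2) by (auto simp: peval_Cnst[OF h(1)])
  next
    case (step V)
    have "Max (rank ` V) \<in> rank ` V" using step(1,2) by (intro Max_in) auto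
    then obtain v where v: "v \<in> V" "Max (rank ` V) = rank v" by auto
    have le: "rank w \<le> rank v" if "w \<in> V" for w
      using Max_ge[of "rank ` V" "rank w"] that step(1) v(2) by auto
    have "?e (poly q (Vr v)) \<noteq> 0" if q: "q \<noteq> 0" "q \<in> coeffs_in (polys_in (V - {v}))" "?e (lead_coeff q) \<noteq> 0" for q
    proof
      assume 0: "?e (poly q (Vr v)) = 0"
      let ?q = "map_poly ?e q"
      have "?q \<noteq> 0" using q(3) by (metis coeff_0 coeff_map_poly ring_mapD(4)[OF e])
      then have fin: "finite {x. poly ?q x = 0}" by (rule poly_roots_finite)
      obtain T :: "'i \<Rightarrow> 'b \<Rightarrow> 'b" where T: "\<And>i. ring_map (T i)" "\<And>i c. T i (h c) = h c"
        "\<And>i w. w \<noteq> v \<Longrightarrow> rank w \<le> rank v \<Longrightarrow> T i (z w) = z w" "infinite (range (\<lambda>i. T i (z v)))"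
        using move[of v] by blast
      have fixd: "T i (?e a) = ?e a" if "a \<in> polys_in (V - {v})" for i a
        using that by induction
          (auto simp: ring_mapD[OF e] ring_mapD[OF T(1)] peval_Cnst[OF h(1)] peval_Vr[OF h(1)] T(2) intro: T(3) le)
      have "poly ?q (T i (z v)) = 0" for i
      proof -
        have "map_poly (T i) ?q = ?q"
          by (rule poly_eqI) (use q(2) in \<open>auto simp: coeff_map_poly ring_mapD[OF e] ring_mapD[OF T(1)] fixd coeffs_in_def\<close>)
        then have "poly ?q (T i (z v)) = T i (poly ?q (z v))"
          using poly_ring_map[OF T(1), of i ?q "z v"] by simp
        also have "poly ?q (z v) = 0"
          using poly_ring_map[OF e, of q "Vr v"] 0 by (simp add: peval_Vr[OF h(1)])
        finally show ?thesis by (simp add: ring_mapD[OF T(1)])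
      qed
      then have "range (\<lambda>i. T i (z v)) \<subseteq> {x. poly ?q x = 0}" by auto
      then show False using fin T(4) finite_subset by blast
    qed
    then show ?case using v(1) by blast
  qed
qed

text \<open>Once the leading coefficient in one variable is nonzero at a point, that variable only has to avoid the
finitely many roots of a polynomial.\<close>

lemma nonvanishing_point:
  fixes p :: "('v \<Rightarrow>\<^sub>0 nat) \<Rightarrow>\<^sub>0 'k::{idom,ring_char_0}"
  assumes "p \<noteq> 0"
  shows "\<exists>z. peval (\<lambda>c. c) z p \<noteq> 0"
proof -
  have h: "ring_map (\<lambda>c::'k. c)" by (simp add: ring_map_def)
  obtain V where "finite V" "p \<in> polys_in V" using polys_in_finite by blast
  then show ?thesis using assms
  proof (induction rule: polynomial_variable_induct)
    case (const c)
    then show ?case by (auto simp: peval_Cnst[OF h])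
  next
    case (step V)
    then obtain v where v: "v \<in> V" by auto
    have "\<exists>z. peval (\<lambda>c. c) z (poly q (Vr v)) \<noteq> 0"
      if q: "q \<noteq> 0" "q \<in> coeffs_in (polys_in (V - {v}))" "peval (\<lambda>c. c) z (lead_coeff q) \<noteq> 0"
      for q :: "(('v \<Rightarrow>\<^sub>0 nat) \<Rightarrow>\<^sub>0 'k) poly" and z
    proof -
      let ?q = "map_poly (peval (\<lambda>c. c) z) q"
      have "?q \<noteq> 0" using q(3) by (metis coeff_0 coeff_map_poly ring_mapD(4)[OF ring_map_peval[OF h]])
      then have fin: "finite {x. poly ?q x = 0}" by (rule poly_roots_finite)
      then obtain t where t: "poly ?q t \<noteq> 0" using infinite_UNIV_char_0[where 'a='k] by fastforce
      let ?z = "z(v := t)"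
      have eq: "peval (\<lambda>c. c) ?z a = peval (\<lambda>c. c) z a" if "a \<in> polys_in (V - {v})" for a
        using that by induction
          (auto simp: ring_mapD[OF ring_map_peval[OF h]] peval_Cnst[OF h] peval_Vr[OF h])
      have "map_poly (peval (\<lambda>c. c) ?z) q = ?q"
        by (rule poly_eqI)
          (use q(2) in \<open>auto simp: coeff_map_poly ring_mapD[OF ring_map_peval[OF h]] eq coeffs_in_def\<close>)
      then have "peval (\<lambda>c. c) ?z (poly q (Vr v)) \<noteq> 0"
        using t poly_ring_map[OF ring_map_peval[OF h], of ?z q "Vr v"] by (simp add: peval_Vr[OF h])
      then show ?thesis by blast
    qed
    then show ?case using v by blast
  qed
qed

definition frc :: "'a::idom \<Rightarrow> 'a fract" where "frc a = Fract a 1"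

lemma ring_map_frc: "ring_map frc"
  by (auto simp: ring_map_def frc_def One_fract_def)

lemma frc_eq_0: "frc a = 0 \<longleftrightarrow> a = 0"
  by (simp add: frc_def Zero_fract_def eq_fract)

lemma frc_cases:
  obtains a b where "b \<noteq> 0" "w = frc a / frc b"
  by (cases w) (auto simp: frc_def)

text \<open>The extension of an injective ring homomorphism to the fraction field.\<close>

definition fext :: "('a::idom \<Rightarrow> 'b::field) \<Rightarrow> 'a fract \<Rightarrow> 'b" where
  "fext f w = (SOME y. \<exists>a b. b \<noteq> 0 \<and> w = frc a / frc b \<and> y = f a / f b)"

lemma fext_frac:
  assumes f: "ring_map f" "\<And>a. f a = 0 \<Longrightarrow> a = 0" and "b \<noteq> 0"
  shows "fext f (frc a / frc b) = f a / f b"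
proof -
  have "\<exists>c d. d \<noteq> 0 \<and> frc a / frc b = frc c / frc d \<and> fext f (frc a / frc b) = f c / f d"
    unfolding fext_def by (rule someI_ex) (use assms in blast)
  then obtain c d where cd: "d \<noteq> 0" "frc a / frc b = frc c / frc d" "fext f (frc a / frc b) = f c / f d" by blast
  have "frc (a * d) = frc (c * b)"
    using cd(1,2) assms(3) by (simp add: frac_eq_eq frc_eq_0 ring_mapD[OF ring_map_frc])
  then have "a * d = c * b" by (simp add: frc_def eq_fract)
  then have "f a * f d = f c * f b" by (metis ring_mapD(3)[OF f(1)])
  then show ?thesis using cd assms by (metis frac_eq_eq)
qed

lemma ring_map_fext:
  assumes f: "ring_map f" "\<And>a. f a = 0 \<Longrightarrow> a = 0"
  shows "ring_map (fext f)" "fext f (frc a) = f a"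
proof -
  show 1: "fext f (frc a) = f a" for a
    using fext_frac[OF f, of 1 a] by (simp add: ring_mapD[OF f(1)] ring_mapD[OF ring_map_frc])
  have "fext f (u + v) = fext f u + fext f v \<and> fext f (u * v) = fext f u * fext f v" for u v
  proof -
    obtain a b where ab: "b \<noteq> 0" "u = frc a / frc b" by (rule frc_cases)
    obtain c d where cd: "d \<noteq> 0" "v = frc c / frc d" by (rule frc_cases)
    have nz: "f b \<noteq> 0" "f d \<noteq> 0" "b * d \<noteq> 0" using ab cd f(2) by auto
    have "u + v = frc (a * d + c * b) / frc (b * d)" "u * v = frc (a * c) / frc (b * d)"
      using ab cd by (simp_all add: ring_mapD[OF ring_map_frc] add_frac_eq frc_eq_0)
    then show ?thesis
      using nz by (simp add: fext_frac[OF f] ab cd ring_mapD[OF f(1)] add_frac_eq)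
  qed
  moreover have "fext f 1 = 1" using 1[of 1] by (simp add: ring_mapD[OF f(1)] ring_mapD[OF ring_map_frc])
  ultimately show "ring_map (fext f)" by (simp add: ring_map_def)
qed

lemma ring_map_fract_unique:
  assumes "ring_map f" "ring_map g" "\<And>a. f (frc a) = g (frc a)"
  shows "f w = (g w :: 'b::field)"
proof -
  obtain a b where "w = frc a / frc b" by (rule frc_cases)
  then show ?thesis by (simp add: assms ring_map_inverse[OF assms(1)] ring_map_inverse[OF assms(2)])
qed

text \<open>The substitution \<open>v \<mapsto> v + c\<close>.  These automorphisms are the source of the endomorphisms that
\<open>substitution_injective\<close> asks for.\<close>

definition translate :: "'v \<Rightarrow> 'k::comm_ring_1 \<Rightarrow> (('v \<Rightarrow>\<^sub>0 nat) \<Rightarrow>\<^sub>0 'k) \<Rightarrow> ('v \<Rightarrow>\<^sub>0 nat) \<Rightarrow>\<^sub>0 'k" where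
  "translate v c = peval Cnst (\<lambda>w. if w = v then Vr v + Cnst c else Vr w)"

lemma ring_map_translate: "ring_map (translate v c)"
  unfolding translate_def by (rule ring_map_peval[OF ring_map_Cnst])

lemma translate_simps:
  "translate v c (Cnst a) = Cnst a" "translate v c (Vr v) = Vr v + Cnst c"
  "w \<noteq> v \<Longrightarrow> translate v c (Vr w) = Vr w"
  by (simp_all add: translate_def peval_Cnst peval_Vr ring_map_Cnst)

lemma translate_inverse: "translate v (- c) (translate v c p) = p"
proof (rule ring_map_unique[where g = "\<lambda>p. p"])
  show "translate v (- c) (translate v c (Vr w)) = Vr w" for w
    by (cases "w = v") (simp_all add: ring_mapD[OF ring_map_translate] translate_simps ring_mapD(5)[OF ring_map_Cnst])
  show "ring_map (\<lambda>p. translate v (- c) (translate v c p))"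
    by (rule ring_map_comp[OF ring_map_translate ring_map_translate])
qed (simp_all add: ring_map_def[of "\<lambda>p. p"] translate_simps)

definition ftranslate :: "'v::linorder \<Rightarrow> 'k::idom \<Rightarrow> (('v \<Rightarrow>\<^sub>0 nat) \<Rightarrow>\<^sub>0 'k) fract \<Rightarrow> (('v \<Rightarrow>\<^sub>0 nat) \<Rightarrow>\<^sub>0 'k) fract" where
  "ftranslate v c = fext (\<lambda>p. frc (translate v c p))"

lemma ftranslate:
  shows "ring_map (ftranslate v c)" "ftranslate v c (frc p) = frc (translate v c p)"
proof -
  have *: "ring_map (\<lambda>p. frc (translate v c p))"
    by (rule ring_map_comp[OF ring_map_frc ring_map_translate])
  have **: "p = 0" if "frc (translate v c p) = 0" for p
    using that translate_inverse[of v c p] by (simp add: frc_eq_0 ring_mapD[OF ring_map_translate])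
  show "ring_map (ftranslate v c)" "ftranslate v c (frc p) = frc (translate v c p)"
    unfolding ftranslate_def using ring_map_fext[OF * **] by auto
qed

section \<open>Chains of ideals and the growth of polynomial rings\<close>

lemma ideal_span_insert_decompose:
  assumes "sub_ring E" "w \<in> ideal_span E (insert b B)"
  shows "\<exists>e\<in>E. \<exists>r\<in>ideal_span E B. w = e * b + r"
  using assms(2)
proof induction
  case zero
  show ?case using sub_ringD(2)[OF assms(1)] ideal_span.zero by force
next
  case (step a s w)
  then obtain e r where er: "e \<in> E" "r \<in> ideal_span E B" "w = e * b + r" by auto
  show ?case
  proof (cases "s = b")
    case True
    then have "a * s + w = (a + e) * b + r" using er by (simp add: distrib_right)
    then show ?thesis using er step(1) sub_ringD(4)[OF assms(1)] by blast
  next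
    case False
    then have "a * s + r \<in> ideal_span E B" using step er by (auto intro: ideal_span.step)
    moreover have "a * s + w = e * b + (a * s + r)" using er by simp
    ultimately show ?thesis using er(1) by blast
  qed
qed

text \<open>Gaussian elimination: one of the vectors with a nonzero coefficient at \<open>b\<close> is used to remove \<open>b\<close> from
all others.\<close>

lemma linear_dependence:
  fixes w :: "'i \<Rightarrow> 'a::field"
  assumes E: "sub_field E" and "finite B" "finite I" "card B < card I"
    and "\<And>i. i \<in> I \<Longrightarrow> w i \<in> ideal_span E B"
  shows "\<exists>c. (\<forall>i\<in>I. c i \<in> E) \<and> (\<exists>i\<in>I. c i \<noteq> 0) \<and> (\<Sum>i\<in>I. c i * w i) = 0"
  using assms(2-5)
proof (induction B arbitrary: I w rule: finite_induct)
  case empty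
  have "v = 0" if "v \<in> ideal_span E {}" for v using that by induction auto
  then have "w i = 0" if "i \<in> I" for i using empty(3) that by blast
  moreover obtain i where "i \<in> I" using empty(2) by (metis card.empty ex_in_conv less_nat_zero_code)
  ultimately show ?case using sub_ringD(1)[OF sub_fieldD(1)[OF E]]
    by (intro exI[of _ "\<lambda>_. 1"]) auto
next
  case (insert b B)
  note R = sub_fieldD(1)[OF E]
  have "\<exists>e r. e \<in> E \<and> r \<in> ideal_span E B \<and> w i = e * b + r" if "i \<in> I" for i
    using ideal_span_insert_decompose[OF R insert.prems(3)[OF that]] by blast
  then obtain e r where er: "\<And>i. i \<in> I \<Longrightarrow> e i \<in> E \<and> r i \<in> ideal_span E B \<and> w i = e i * b + r i"
    by metis
  show ?case
  proof (cases "\<forall>i\<in>I. e i = 0")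
    case True
    then have "w i \<in> ideal_span E B" if "i \<in> I" for i using er[OF that] that by simp
    moreover have "card B < card I" using insert by simp
    ultimately show ?thesis using insert.IH[of I w] insert.prems(1) by blast
  next
    case False
    then obtain j where j: "j \<in> I" "e j \<noteq> 0" by blast
    let ?q = "\<lambda>i. e i / e j"
    let ?w = "\<lambda>i. w i - ?q i * w j" and ?I = "I - {j}"
    have q: "?q i \<in> E" if "i \<in> I" for i using er[OF that] er[OF j(1)] sub_fieldD(3)[OF E] by blast
    have "?w i \<in> ideal_span E B" if "i \<in> ?I" for i
    proof -
      have "?w i = r i - ?q i * r j + (e i - ?q i * e j) * b"
        using er[of i] er[of j] j that by (simp only: Diff_iff) (simp add: algebra_simps)
      also have "e i - ?q i * e j = 0" using j(2) by simp
      finally have "?w i = r i - ?q i * r j" by simp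
      moreover have "r i - ?q i * r j \<in> ideal_span E B"
        using er[of i] er[OF j(1)] that q[of i]
        by (intro ideal_span_diff[OF R] ideal_span_mult[OF R]) auto
      ultimately show ?thesis by (simp only:)
    qed
    moreover have "card B < card ?I" using insert j by simp
    ultimately obtain c where c: "\<forall>i\<in>?I. c i \<in> E" "\<exists>i\<in>?I. c i \<noteq> 0" "(\<Sum>i\<in>?I. c i * ?w i) = 0"
      using insert.IH[of ?I ?w] insert.prems(1) by blast
    define d where "d i = (if i = j then - (\<Sum>i\<in>?I. c i * ?q i) else c i)" for i
    have "d i \<in> E" if "i \<in> I" for i
    proof (cases "i = j")
      case True
      have "c i * ?q i \<in> E" if "i \<in> ?I" for i
        using that c(1) q by (intro sub_ringD(5)[OF R]) auto
      then have "- (\<Sum>i\<in>?I. c i * ?q i) \<in> E" by (intro sub_ringD(3)[OF R] sub_ring_sum[OF R])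
      then show ?thesis using True by (simp add: d_def)
    qed (use that c(1) in \<open>auto simp: d_def\<close>)
    moreover have "\<exists>i\<in>I. d i \<noteq> 0" using c(2) by (auto simp: d_def)
    moreover have "(\<Sum>i\<in>I. d i * w i) = (\<Sum>i\<in>?I. c i * ?w i)"
    proof -
      have "(\<Sum>i\<in>I. d i * w i) = d j * w j + (\<Sum>i\<in>?I. d i * w i)"
        using insert.prems(1) j(1) by (rule sum.remove)
      also have "(\<Sum>i\<in>?I. d i * w i) = (\<Sum>i\<in>?I. c i * w i)" by (rule sum.cong) (auto simp: d_def)
      finally show ?thesis
        by (simp add: d_def sum_distrib_right sum_subtractf right_diff_distrib mult.assoc)
    qed
    ultimately show ?thesis using c(3) by (intro exI[of _ d]) auto
  qed
qed

lemma sum_PiE_insert: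
  assumes "k \<notin> S" "finite S" "finite T"
  shows "(\<Sum>\<alpha>\<in>PiE (insert k S) (\<lambda>_. T). f \<alpha>) = (\<Sum>t\<in>T. \<Sum>\<beta>\<in>PiE S (\<lambda>_. T). f (\<beta>(k := t)))"
proof -
  have "(\<Sum>\<alpha>\<in>PiE (insert k S) (\<lambda>_. T). f \<alpha>) = (\<Sum>(t, \<beta>)\<in>T \<times> PiE S (\<lambda>_. T). f (\<beta>(k := t)))"
    unfolding PiE_insert_eq
    by (subst sum.reindex[OF inj_combinator[OF assms(1)]]) (simp add: case_prod_unfold)
  also have "\<dots> = (\<Sum>t\<in>T. \<Sum>\<beta>\<in>PiE S (\<lambda>_. T). f (\<beta>(k := t)))"
    by (rule sum.cartesian_product[symmetric])
  finally show ?thesis .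
qed

text \<open>Let \<open>y i\<close> be in \<open>Q (i + 1)\<close> and a nonzerodivisor modulo \<open>Q i\<close>.  Order a relation by powers of \<open>y k\<close>.
Modulo \<open>Q k\<close> the lowest power can be cancelled, and modulo \<open>Q (k + 1)\<close> all higher powers vanish, so the
lowest coefficient is a relation between the remaining elements modulo \<open>Q (k + 1)\<close>.  In the end a nonzero
constant of the field \<open>E\<close> would lie in the proper ideal \<open>Q N\<close>.\<close>

lemma monomials_independent_along_chain:
  fixes y :: "nat \<Rightarrow> 'a::field" and Q :: "nat \<Rightarrow> 'a set"
  assumes R: "sub_ring R" and E: "sub_field E" "E \<subseteq> R"
    and Qid: "\<And>i a b. i \<le> N \<Longrightarrow> a \<in> Q i \<Longrightarrow> b \<in> Q i \<Longrightarrow> a - b \<in> Q i"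
      "\<And>i a b. i \<le> N \<Longrightarrow> a \<in> R \<Longrightarrow> b \<in> Q i \<Longrightarrow> a * b \<in> Q i"
    and chain: "\<And>i. i < N \<Longrightarrow> Q i \<subseteq> Q (Suc i)" and proper: "1 \<notin> Q N"
    and y: "\<And>i. i < N \<Longrightarrow> y i \<in> R" "\<And>i. i < N \<Longrightarrow> y i \<in> Q (Suc i)"
    and nzd: "\<And>i a. i < N \<Longrightarrow> a \<in> R \<Longrightarrow> y i * a \<in> Q i \<Longrightarrow> a \<in> Q i"
    and "k \<le> N" and "\<And>\<alpha>. \<alpha> \<in> PiE {k..<N} (\<lambda>_. {..<M}) \<Longrightarrow> c \<alpha> \<in> E"
    and "(\<Sum>\<alpha>\<in>PiE {k..<N} (\<lambda>_. {..<M}). c \<alpha> * (\<Prod>i\<in>{k..<N}. y i ^ \<alpha> i)) \<in> Q k"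
    and "\<alpha> \<in> PiE {k..<N} (\<lambda>_. {..<M::nat})"
  shows "c \<alpha> = 0"
  using assms(11-)
proof (induction k arbitrary: c \<alpha> rule: inc_induct)
  case base
  have "c \<alpha> \<in> Q N" "c \<alpha> \<in> E" using base by auto
  then show ?case
    using proper Qid(2)[of N "inverse (c \<alpha>)" "c \<alpha>"] sub_fieldD(2)[OF E(1)] E(2) by (cases "c \<alpha> = 0") auto
next
  case (step k)
  have kN: "k < N" using step by simp
  let ?S = "{Suc k..<N}"
  let ?P = "PiE ?S (\<lambda>_. {..<M})"
  have ins: "{k..<N} = insert k ?S" using kN by auto
  define W where "W t = (\<Sum>\<beta>\<in>?P. c (\<beta>(k := t)) * (\<Prod>i\<in>?S. y i ^ \<beta> i))" for t
  have upd: "\<beta>(k := t) \<in> PiE {k..<N} (\<lambda>_. {..<M})" if "\<beta> \<in> ?P" "t < M" for \<beta> t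
    unfolding ins using that by (intro PiE_fun_upd) auto
  have WR: "W t \<in> R" if "t < M" for t
    unfolding W_def
  proof (rule sub_ring_sum[OF R])
    fix \<beta> assume "\<beta> \<in> ?P"
    then have "c (\<beta>(k := t)) \<in> R" using step.prems(1)[OF upd[OF _ that]] E(2) by blast
    moreover have "(\<Prod>i\<in>?S. y i ^ \<beta> i) \<in> R"
      by (rule sub_ring_prod[OF R]) (simp add: sub_ringD(7)[OF R] y(1))
    ultimately show "c (\<beta>(k := t)) * (\<Prod>i\<in>?S. y i ^ \<beta> i) \<in> R" by (rule sub_ringD(5)[OF R])
  qed
  have "(\<Sum>\<alpha>\<in>PiE {k..<N} (\<lambda>_. {..<M}). c \<alpha> * (\<Prod>i\<in>{k..<N}. y i ^ \<alpha> i)) = (\<Sum>t<M. y k ^ t * W t)"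
  proof -
    have "(\<Prod>i\<in>?S. y i ^ (\<beta>(k := t)) i) = (\<Prod>i\<in>?S. y i ^ \<beta> i)" for \<beta> t
      by (rule prod.cong) auto
    then show ?thesis unfolding ins W_def
      by (subst sum_PiE_insert[of k ?S "{..<M}"]) (auto simp: sum_distrib_left mult_ac)
  qed
  with step.prems(2) have sumQ: "(\<Sum>t<M. y k ^ t * W t) \<in> Q k" by simp
  have all0: "\<forall>\<beta>\<in>?P. c (\<beta>(k := t)) = 0" if "t < M" for t
    using that
  proof (induction t rule: less_induct)
    case (less t)
    have W0: "W s = 0" if "s < t" for s
    proof -
      have "\<forall>\<beta>\<in>?P. c (\<beta>(k := s)) = 0" using less that by (meson less_trans)
      then show ?thesis unfolding W_def by (intro sum.neutral) (simp del: fun_upd_apply)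
    qed
    define S where "S = (\<Sum>s\<in>{t..<M}. y k ^ (s - t) * W s)"
    have SR: "S \<in> R" unfolding S_def using WR y(1)[OF kN]
      by (auto intro!: sub_ring_sum[OF R] sub_ringD(5,7)[OF R])
    have "(\<Sum>s<M. y k ^ s * W s) = (\<Sum>s\<in>{t..<M}. y k ^ s * W s)"
      using W0 less(2) by (intro sum.mono_neutral_right) auto
    also have "\<dots> = y k ^ t * S" unfolding S_def sum_distrib_left
      by (rule sum.cong) (auto simp flip: power_add mult.assoc)
    finally have "y k ^ t * S \<in> Q k" using sumQ by simp
    moreover have "y k ^ j * S \<in> Q k \<Longrightarrow> S \<in> Q k" for j
    proof (induction j)
      case (Suc j)
      then show ?case
        using nzd[OF kN, of "y k ^ j * S"] SR y(1)[OF kN] by (simp add: mult.assoc sub_ringD[OF R])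
    qed simp
    ultimately have "S \<in> Q k" by blast
    then have SQ: "S \<in> Q (Suc k)" using chain[OF kN] by blast
    define T where "T = (\<Sum>s\<in>{Suc t..<M}. y k ^ (s - Suc t) * W s)"
    have TR: "T \<in> R" unfolding T_def using WR y(1)[OF kN]
      by (auto intro!: sub_ring_sum[OF R] sub_ringD(5,7)[OF R])
    have ivl: "{t..<M} = insert t {Suc t..<M}" using less(2) by auto
    have "(\<Sum>s\<in>{Suc t..<M}. y k ^ (s - t) * W s) = T * y k"
      unfolding T_def sum_distrib_right
    proof (rule sum.cong)
      fix s assume "s \<in> {Suc t..<M}"
      then have "s - t = Suc (s - Suc t)" by auto
      then show "y k ^ (s - t) * W s = y k ^ (s - Suc t) * W s * y k" by (simp add: mult_ac)
    qed simp
    then have "S = W t + T * y k" unfolding S_def ivl by simp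
    then have "W t = S - T * y k" by simp
    then have "W t \<in> Q (Suc k)" using SQ TR y(2)[OF kN] Qid[of "Suc k"] kN by auto
    then have IHprem: "(\<Sum>\<beta>\<in>?P. c (\<beta>(k := t)) * (\<Prod>i\<in>?S. y i ^ \<beta> i)) \<in> Q (Suc k)"
      unfolding W_def .
    show ?case
    proof
      fix \<beta> assume \<beta>: "\<beta> \<in> ?P"
      show "c (\<beta>(k := t)) = 0"
        by (rule step.IH[where c = "\<lambda>\<beta>. c (\<beta>(k := t))" and \<alpha> = \<beta>, OF _ IHprem \<beta>])
          (rule step.prems(1)[OF upd[OF _ less(2)]])
    qed
  qed
  have "\<alpha> \<in> (\<lambda>(t, \<beta>). \<beta>(k := t)) ` ({..<M} \<times> ?P)"
    using step.prems(3) unfolding ins PiE_insert_eq by simp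
  then show ?case using all0 by auto
qed

text \<open>The polynomials in \<open>x 0, \<dots>, x (n - 1)\<close> over \<open>E\<close> of degree at most \<open>d\<close> in each variable.\<close>

definition box_span :: "'a::field set \<Rightarrow> nat \<Rightarrow> (nat \<Rightarrow> 'a) \<Rightarrow> nat \<Rightarrow> 'a set" where
  "box_span E n x d = ideal_span E ((\<lambda>\<beta>. \<Prod>i<n. x i ^ \<beta> i) ` PiE {..<n} (\<lambda>_. {..d}))"

lemma box_span_mono:
  assumes "d \<le> e" "a \<in> box_span E n x d"
  shows "a \<in> box_span E n x e"
proof -
  have "PiE {..<n} (\<lambda>_. {..d}) \<subseteq> PiE {..<n} (\<lambda>_. {..e})" using assms(1) by (intro PiE_mono) auto
  then show ?thesis using assms(2) unfolding box_span_def by (rule ideal_span_mono[OF image_mono])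
qed

lemma box_span_mult:
  assumes E: "sub_ring E" and "a \<in> box_span E n x d" "b \<in> box_span E n x e"
  shows "a * b \<in> box_span E n x (d + e)"
  using assms(2) unfolding box_span_def
proof induction
  case zero show ?case by (simp add: ideal_span.zero)
next
  case (step r s a)
  then obtain \<beta> where \<beta>: "\<beta> \<in> PiE {..<n} (\<lambda>_. {..d})" "s = (\<Prod>i<n. x i ^ \<beta> i)" by auto
  have "s * b \<in> box_span E n x (d + e)"
    using assms(3) unfolding box_span_def[of E n x e]
  proof induction
    case zero show ?case by (simp add: box_span_def ideal_span.zero)
  next
    case (step r' s' b)
    then obtain \<gamma> where \<gamma>: "\<gamma> \<in> PiE {..<n} (\<lambda>_. {..e})" "s' = (\<Prod>i<n. x i ^ \<gamma> i)" by auto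
    let ?d = "restrict (\<lambda>i. \<beta> i + \<gamma> i) {..<n}"
    have "?d \<in> PiE {..<n} (\<lambda>_. {..d + e})" using \<beta>(1) \<gamma>(1) by (auto simp: PiE_iff add_mono)
    moreover have "s * s' = (\<Prod>i<n. x i ^ ?d i)"
      unfolding \<beta> \<gamma> prod.distrib[symmetric] by (rule prod.cong) (auto simp: power_add)
    ultimately have "s * s' \<in> (\<lambda>\<beta>. \<Prod>i<n. x i ^ \<beta> i) ` PiE {..<n} (\<lambda>_. {..d + e})" by blast
    then have "r' * (s * s') + s * b \<in> box_span E n x (d + e)"
      using step.hyps(1) step.IH unfolding box_span_def by (intro ideal_span.step)
    then show ?case by (simp add: algebra_simps)
  qed
  then have "r * (s * b) + a * b \<in> ideal_span E ((\<lambda>\<beta>. \<Prod>i<n. x i ^ \<beta> i) ` PiE {..<n} (\<lambda>_. {..d + e}))"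
    unfolding box_span_def by (intro ideal_span_add[OF ideal_span_mult[OF E step.hyps(1)] step.IH])
  then show ?case by (simp add: algebra_simps)
qed

lemma box_span_one:
  assumes "sub_ring E"
  shows "1 \<in> box_span E n x 0"
proof -
  have "1 \<in> (\<lambda>\<beta>. \<Prod>i<n. x i ^ \<beta> i) ` PiE {..<n} (\<lambda>_. {..0})"
    by (rule image_eqI[where x = "restrict (\<lambda>_. 0) {..<n}"]) auto
  then show ?thesis unfolding box_span_def by (rule ideal_span_base[OF assms])
qed

lemma box_span_power:
  assumes E: "sub_ring E" and "a \<in> box_span E n x d"
  shows "a ^ k \<in> box_span E n x (k * d)"
  by (induction k) (auto simp: box_span_one[OF E] intro: box_span_mult[OF E assms(2)])

lemma box_span_prod:
  assumes E: "sub_ring E" and "\<And>i. i \<in> I \<Longrightarrow> f i \<in> box_span E n x (g i)"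
  shows "prod f I \<in> box_span E n x (sum g I)"
  using assms(2) by (induction I rule: infinite_finite_induct) (auto simp: box_span_one[OF E] intro: box_span_mult[OF E])

text \<open>Bring \<open>n + 1\<close> elements to a common denominator \<open>q\<close>.  Their monomials with all exponents below \<open>M\<close>,
multiplied by a fixed power of \<open>q\<close>, number \<open>M ^ (n + 1)\<close> and lie in a space whose dimension grows like
\<open>M ^ n\<close>.  For large \<open>M\<close> they are dependent, which contradicts their independence along the chain.\<close>

lemma no_long_chain:
  fixes y :: "nat \<Rightarrow> 'a::field" and Q :: "nat \<Rightarrow> 'a set" and x :: "nat \<Rightarrow> 'a"
  assumes R: "sub_ring R" and E: "sub_field E" "E \<subseteq> R"
    and frac: "\<And>a. a \<in> R \<Longrightarrow> \<exists>b d. b \<noteq> 0 \<and> b \<in> box_span E n x d \<and> a * b \<in> box_span E n x d"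
    and N: "N = Suc n"
    and Qid: "\<And>i a b. i \<le> N \<Longrightarrow> a \<in> Q i \<Longrightarrow> b \<in> Q i \<Longrightarrow> a - b \<in> Q i"
      "\<And>i a b. i \<le> N \<Longrightarrow> a \<in> R \<Longrightarrow> b \<in> Q i \<Longrightarrow> a * b \<in> Q i"
    and zero: "0 \<in> Q 0"
    and chain: "\<And>i. i < N \<Longrightarrow> Q i \<subseteq> Q (Suc i)" and proper: "1 \<notin> Q N"
    and y: "\<And>i. i < N \<Longrightarrow> y i \<in> R" "\<And>i. i < N \<Longrightarrow> y i \<in> Q (Suc i)"
    and nzd: "\<And>i a. i < N \<Longrightarrow> a \<in> R \<Longrightarrow> y i * a \<in> Q i \<Longrightarrow> a \<in> Q i"
  shows False
proof -
  note Er = sub_fieldD(1)[OF E(1)]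
  have "\<forall>i\<in>{..<N}. \<exists>b d. b \<noteq> 0 \<and> b \<in> box_span E n x d \<and> y i * b \<in> box_span E n x d"
    using frac y(1) by auto
  then obtain b d where bd: "\<And>i. i < N \<Longrightarrow> b i \<noteq> 0 \<and> b i \<in> box_span E n x (d i) \<and> y i * b i \<in> box_span E n x (d i)"
    by (metis lessThan_iff)
  define q D where "q = (\<Prod>i<N. b i)" and "D = (\<Sum>i<N. d i)"
  have q: "q \<noteq> 0" "q \<in> box_span E n x D"
    unfolding q_def D_def using bd by (auto intro!: box_span_prod[OF Er])
  have yq: "y j * q \<in> box_span E n x D" if j: "j < N" for j
  proof -
    have "y j * q = (\<Prod>i<N. if i = j then y i * b i else b i)"
      unfolding q_def using j by (subst (1 2) prod.remove[of _ j]) (auto intro!: prod.cong)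
    also have "\<dots> \<in> box_span E n x D" unfolding D_def
      by (rule box_span_prod[OF Er]) (use bd in auto)
    finally show ?thesis .
  qed
  \<comment> \<open>This \<open>M\<close> satisfies \<open>(N M D + 1)\<^sup>n \<le> M\<^sup>n (N D + 1)\<^sup>n < M\<^sup>n\<^sup>+\<^sup>1\<close>.\<close>
  define M where "M = (N * D + 1) ^ n + 1"
  define L where "L = N * M"
  let ?I = "PiE {..<N} (\<lambda>_. {..<M})"
  define w where "w \<alpha> = q ^ L * (\<Prod>i<N. y i ^ \<alpha> i)" for \<alpha>
  let ?B = "(\<lambda>\<beta>. \<Prod>i<n. x i ^ \<beta> i) ` PiE {..<n} (\<lambda>_. {..L * D})"
  have w: "w \<alpha> \<in> ideal_span E ?B" if \<alpha>: "\<alpha> \<in> ?I" for \<alpha>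
  proof -
    have "(\<Sum>i<N. \<alpha> i) \<le> (\<Sum>i<N. M)" using \<alpha> by (intro sum_mono) (auto simp: PiE_iff less_imp_le)
    then have le: "(\<Sum>i<N. \<alpha> i) \<le> L" by (simp add: L_def)
    have "w \<alpha> = q ^ (L - (\<Sum>i<N. \<alpha> i)) * (q ^ (\<Sum>i<N. \<alpha> i) * (\<Prod>i<N. y i ^ \<alpha> i))"
      unfolding w_def using le by (simp flip: mult.assoc power_add)
    also have "q ^ (\<Sum>i<N. \<alpha> i) * (\<Prod>i<N. y i ^ \<alpha> i) = (\<Prod>i<N. (y i * q) ^ \<alpha> i)"
      by (simp add: power_sum power_mult_distrib prod.distrib mult.commute)
    finally have w_eq: "w \<alpha> = q ^ (L - (\<Sum>i<N. \<alpha> i)) * (\<Prod>i<N. (y i * q) ^ \<alpha> i)" .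
    have "w \<alpha> \<in> box_span E n x ((L - (\<Sum>i<N. \<alpha> i)) * D + (\<Sum>i<N. \<alpha> i * D))"
      unfolding w_eq using q(2) yq
      by (intro box_span_mult[OF Er] box_span_prod[OF Er] box_span_power[OF Er]) auto
    also have "(L - (\<Sum>i<N. \<alpha> i)) * D + (\<Sum>i<N. \<alpha> i * D) = L * D"
      using le by (simp flip: sum_distrib_right add_mult_distrib)
    finally show ?thesis by (simp add: box_span_def)
  qed
  have "card ?B \<le> card (PiE {..<n} (\<lambda>_. {..L * D}))" by (intro card_image_le finite_PiE) auto
  also have "\<dots> = (L * D + 1) ^ n" by (simp add: card_PiE)
  also have "\<dots> \<le> (M * (N * D + 1)) ^ n"
    by (intro power_mono) (auto simp: L_def M_def algebra_simps)
  also have "\<dots> = M ^ n * (N * D + 1) ^ n" by (rule power_mult_distrib)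
  also have "\<dots> < M ^ n * M" by (intro mult_strict_left_mono) (auto simp: M_def)
  also have "\<dots> = card ?I" by (simp add: card_PiE N)
  finally have "card ?B < card ?I" .
  moreover have "finite ?B" "finite ?I" by (auto intro!: finite_imageI finite_PiE)
  ultimately obtain c where c: "\<And>\<alpha>. \<alpha> \<in> ?I \<Longrightarrow> c \<alpha> \<in> E" "\<exists>\<alpha>\<in>?I. c \<alpha> \<noteq> 0" "(\<Sum>\<alpha>\<in>?I. c \<alpha> * w \<alpha>) = 0"
    using linear_dependence[OF E(1), of ?B ?I w] w by blast
  have "(\<Sum>\<alpha>\<in>?I. c \<alpha> * w \<alpha>) = q ^ L * (\<Sum>\<alpha>\<in>?I. c \<alpha> * (\<Prod>i<N. y i ^ \<alpha> i))"
    unfolding w_def sum_distrib_left by (rule sum.cong) (auto simp: mult_ac)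
  then have 0: "(\<Sum>\<alpha>\<in>?I. c \<alpha> * (\<Prod>i<N. y i ^ \<alpha> i)) = 0" using c(3) q(1) by simp
  have ivl: "{..<N} = {0..<N}" by auto
  have "c \<alpha> = 0" if "\<alpha> \<in> ?I" for \<alpha>
  proof (rule monomials_independent_along_chain[OF R E Qid chain proper y nzd, where k = 0 and M = M and c = c and \<alpha> = \<alpha>])
    show "(\<Sum>\<alpha>\<in>PiE {0..<N} (\<lambda>_. {..<M}). c \<alpha> * (\<Prod>i\<in>{0..<N}. y i ^ \<alpha> i)) \<in> Q 0"
      using 0 zero unfolding ivl by simp
    show "\<alpha> \<in> PiE {0..<N} (\<lambda>_. {..<M})" using that unfolding ivl .
    show "c \<alpha> \<in> E" if "\<alpha> \<in> PiE {0..<N} (\<lambda>_. {..<M})" for \<alpha>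
      using c(1) that unfolding ivl .
  qed auto
  then show False using c(2) by blast
qed

section \<open>The complex local ring\<close>

text \<open>Expressions denote elements of the field fixed by the conjugation, and every such element is denoted by
one.  The variables \<open>Uv e\<close> and \<open>Gv e\<close> are the solution \<open>u\<close>, \<open>g\<close> of \<open>f g = 1 + s\<^sup>2 + t\<^sup>2\<close>, \<open>u = s + \<i> t\<close>, for
the element \<open>f\<close> denoted by \<open>e\<close> (or the substitute for it in \<open>factor\<close>).  Indexing by syntax makes the dependence of
variables on each other well founded.\<close>

datatype expr = Const real | RePart var | ImPart var | Plus expr expr | Times expr expr | Recip expr
  and var = Xv nat | Uv expr | Gv expr

text \<open>An injection of the plane into the line, from which an injective numbering of expressions by real numbers
is built.  It provides the linear order on variables that makes the polynomials an integral domain,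
and later the carrier of the final ring.\<close>

definition real_pair :: "real \<times> real \<Rightarrow> real" where
  "real_pair = (SOME f. inj f)"

lemma inj_real_pair: "inj real_pair"
proof -
  have "|UNIV \<times> UNIV :: (real \<times> real) set| =o |UNIV :: real set|"
    by (rule card_of_Times_same_infinite) (rule infinite_UNIV_char_0)
  then obtain f :: "real \<times> real \<Rightarrow> real" where "bij_betw f (UNIV \<times> UNIV) UNIV"
    using card_of_ordIso by blast
  then have "\<exists>f :: real \<times> real \<Rightarrow> real. inj f" by (auto simp: bij_betw_def)
  then show ?thesis unfolding real_pair_def by (rule someI_ex)
qed

lemma real_pair_eq: "real_pair p = real_pair q \<longleftrightarrow> p = q"
  using inj_real_pair by (auto dest: injD)

primrec expr_code :: "expr \<Rightarrow> real" and var_code :: "var \<Rightarrow> real" where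
  "expr_code (Const r) = real_pair (0, r)"
| "expr_code (RePart v) = real_pair (1, var_code v)"
| "expr_code (ImPart v) = real_pair (2, var_code v)"
| "expr_code (Plus a b) = real_pair (3, real_pair (expr_code a, expr_code b))"
| "expr_code (Times a b) = real_pair (4, real_pair (expr_code a, expr_code b))"
| "expr_code (Recip a) = real_pair (5, expr_code a)"
| "var_code (Xv j) = real_pair (6, real j)"
| "var_code (Uv e) = real_pair (7, expr_code e)"
| "var_code (Gv e) = real_pair (8, expr_code e)"

lemma code_inject:
  "expr_code e = expr_code e' \<longrightarrow> e = e'" "var_code v = var_code v' \<longrightarrow> v = v'"
proof (induction e and v arbitrary: e' and v')
  case (Const r) then show ?case by (cases e') (auto simp: real_pair_eq)
next
  case (RePart v) then show ?case by (cases e') (auto simp: real_pair_eq)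
next
  case (ImPart v) then show ?case by (cases e') (auto simp: real_pair_eq)
next
  case (Plus a b) then show ?case by (cases e') (auto simp: real_pair_eq)
next
  case (Times a b) then show ?case by (cases e') (auto simp: real_pair_eq)
next
  case (Recip a) then show ?case by (cases e') (auto simp: real_pair_eq)
next
  case (Xv j) then show ?case by (cases v') (auto simp: real_pair_eq)
next
  case (Uv e) then show ?case by (cases v') (auto simp: real_pair_eq)
next
  case (Gv e) then show ?case by (cases v') (auto simp: real_pair_eq)
qed

instantiation var :: linorder
begin
definition "v \<le> w \<longleftrightarrow> var_code v \<le> var_code w"
definition "v < w \<longleftrightarrow> var_code v < var_code w"
instance
  by standard (auto simp: less_eq_var_def less_var_def code_inject(2))
end

type_synonym cpoly = "(var \<Rightarrow>\<^sub>0 nat) \<Rightarrow>\<^sub>0 complex"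
type_synonym K = "cpoly fract"

definition cst :: "complex \<Rightarrow> K" where "cst c = frc (Cnst c)"
definition vr :: "var \<Rightarrow> K" where "vr v = frc (Vr v)"

lemma ring_map_cst: "ring_map cst"
  unfolding cst_def by (rule ring_map_comp[OF ring_map_frc ring_map_Cnst])

lemmas cst_simps = ring_mapD[OF ring_map_cst] ring_map_inverse[OF ring_map_cst]
lemmas frc_simps = ring_mapD[OF ring_map_frc]

lemma ring_map_of_real: "ring_map (complex_of_real)" and ring_map_cnj: "ring_map cnj"
  by (auto simp: ring_map_def)

lemma two_neq_0: "(2 :: K) \<noteq> 0"
proof -
  have two: "(2 :: K) = cst 2" using cst_simps(2)[of 1 1] by (simp add: cst_simps(1))
  show ?thesis unfolding two by (simp add: cst_simps)
qed

lemma Vr_neq_0: "Vr v \<noteq> (0 :: cpoly)"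
proof
  assume "Vr v = (0 :: cpoly)"
  then have "translate v 1 (Vr v) - Vr v = (0 :: cpoly)"
    by (simp add: ring_mapD[OF ring_map_translate])
  then show False by (simp add: translate_simps ring_mapD[OF ring_map_Cnst])
qed

lemma vr_neq_0: "vr v \<noteq> 0"
  by (simp add: vr_def frc_eq_0 Vr_neq_0)

lemma ftranslate_simps:
  "ftranslate v c (cst a) = cst a" "ftranslate v c (vr v) = vr v + cst c"
  "w \<noteq> v \<Longrightarrow> ftranslate v c (vr w) = vr w"
  by (simp_all add: cst_def vr_def ftranslate translate_simps frc_simps)

lemmas ftr = ring_mapD[OF ftranslate(1)] ring_map_inverse[OF ftranslate(1)]

text \<open>Setting \<open>x\<^sub>0, \<dots>, x\<^sub>J\<^sub>-\<^sub>1\<close> to zero.\<close>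

definition kill :: "nat \<Rightarrow> cpoly \<Rightarrow> cpoly" where
  "kill J = peval Cnst (\<lambda>v. case v of Xv j \<Rightarrow> if j < J then 0 else Vr v | _ \<Rightarrow> Vr v)"

lemma ring_map_kill: "ring_map (kill J)"
  unfolding kill_def by (rule ring_map_peval[OF ring_map_Cnst])

lemmas kill_ring = ring_mapD[OF ring_map_kill]

lemma kill_simps:
  "kill J (Cnst c) = Cnst c" "kill J (Vr (Xv j)) = (if j < J then 0 else Vr (Xv j))"
  "kill J (Vr (Uv e)) = Vr (Uv e)" "kill J (Vr (Gv e)) = Vr (Gv e)"
  by (simp_all add: kill_def peval_Cnst peval_Vr ring_map_Cnst)

lemma kill_kill: "kill I (kill J p) = kill (max I J) p"
proof (rule ring_map_unique[OF ring_map_comp[OF ring_map_kill ring_map_kill] ring_map_kill])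
  show "kill I (kill J (Vr v)) = kill (max I J) (Vr v)" for v
    by (cases v) (auto simp: kill_simps kill_ring)
qed (simp add: kill_simps)

lemma kill_0: "kill 0 p = p"
proof (rule ring_map_unique[OF ring_map_kill, where g = "\<lambda>p. p"])
  show "kill 0 (Vr v) = Vr v" for v by (cases v) (auto simp: kill_simps)
qed (auto simp: kill_simps ring_map_def)

lemma diff_kill_in_span: "p - kill J p \<in> ideal_span UNIV ((\<lambda>j. Vr (Xv j)) ` {..<J})"
proof -
  have U: "sub_ring (UNIV :: cpoly set)" by (simp add: sub_ring_def)
  note z = ideal_span.zero[of UNIV "(\<lambda>j. Vr (Xv j) :: cpoly) ` {..<J}"]
  show ?thesis
  proof (induction p rule: polynomial_induct)
    case (Cnst c) then show ?case using z by (simp add: kill_simps)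
  next
    case (Vr v) then show ?case
      using z by (cases v) (auto simp: kill_simps intro!: ideal_span_base[OF U])
  next
    case (add p q)
    then show ?case using ideal_span_add[OF add] by (simp add: kill_ring algebra_simps)
  next
    case (mult p q)
    have "p * q - kill J (p * q) = q * (p - kill J p) + kill J p * (q - kill J q)"
      by (simp add: kill_ring algebra_simps)
    then show ?case using mult by (auto intro!: ideal_span_add ideal_span_mult[OF U])
  qed
qed

context
  fixes n :: nat
begin

text \<open>The prime ideal \<open>(x\<^sub>0, \<dots>, x\<^sub>J\<^sub>-\<^sub>1)\<close> of the local ring, for \<open>J \<le> n\<close>; for \<open>J = n\<close> it is the maximal ideal.\<close>

definition vanishing :: "nat \<Rightarrow> K set" where
  "vanishing J = {w. \<exists>a b. kill n b \<noteq> 0 \<and> kill J a = 0 \<and> w = frc a / frc b}"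

definition local_at :: "K set" where
  "local_at = {w. \<exists>a b. kill n b \<noteq> 0 \<and> w = frc a / frc b}"

lemma kill_nonzero: "J \<le> n \<Longrightarrow> kill n b \<noteq> 0 \<Longrightarrow> kill J b \<noteq> 0"
  using kill_kill[of n J b] kill_ring(4)[of n] by (auto simp: max_def)

lemma vanishing_iff:
  assumes "J \<le> n" "kill n b \<noteq> 0"
  shows "frc a / frc b \<in> vanishing J \<longleftrightarrow> kill J a = 0"
proof
  assume "frc a / frc b \<in> vanishing J"
  then obtain c d where cd: "kill n d \<noteq> 0" "kill J c = 0" "frc a / frc b = frc c / frc d"
    by (auto simp: vanishing_def)
  have "b \<noteq> 0" "d \<noteq> 0" using assms(2) cd(1) kill_ring(4) by auto
  then have "frc (a * d) = frc (c * b)" using cd(3) by (simp add: frac_eq_eq frc_eq_0 frc_simps)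
  then have "a * d = c * b" by (simp add: frc_def eq_fract)
  then have "kill J a * kill J d = 0" using cd(2) by (metis kill_ring(3) mult_zero_left)
  then show "kill J a = 0" using kill_nonzero[OF assms(1) cd(1)] by simp
qed (use assms in \<open>auto simp: vanishing_def\<close>)

lemma local_atE:
  assumes "w \<in> local_at"
  obtains a b where "kill n b \<noteq> 0" "b \<noteq> 0" "w = frc a / frc b"
  using assms kill_ring(4)[of n] by (auto simp: local_at_def)

lemma frc_in_local_at: "frc p \<in> local_at"
  unfolding local_at_def
  by (intro CollectI exI[of _ p] exI[of _ 1]) (simp add: kill_ring frc_simps)

lemma inverse_frc_in_local_at: "kill n b \<noteq> 0 \<Longrightarrow> inverse (frc b) \<in> local_at"
  unfolding local_at_def
  by (intro CollectI exI[of _ 1] exI[of _ b]) (simp add: frc_simps divide_inverse)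

lemma sub_ring_local_at: "sub_ring local_at"
proof -
  have "u + v \<in> local_at \<and> u * v \<in> local_at" if uv: "u \<in> local_at" "v \<in> local_at" for u v
  proof -
    obtain a b where ab: "kill n b \<noteq> 0" "b \<noteq> 0" "u = frc a / frc b" using uv(1) by (rule local_atE)
    obtain c d where cd: "kill n d \<noteq> 0" "d \<noteq> 0" "v = frc c / frc d" using uv(2) by (rule local_atE)
    have "u + v = frc (a * d + c * b) / frc (b * d)" "u * v = frc (a * c) / frc (b * d)"
      using ab cd by (simp_all add: frc_simps add_frac_eq frc_eq_0)
    moreover have "kill n (b * d) \<noteq> 0" using ab cd by (simp add: kill_ring)
    ultimately show ?thesis unfolding local_at_def by blast
  qed
  moreover have "- u \<in> local_at" if u: "u \<in> local_at" for u
  proof -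
    obtain a b where ab: "kill n b \<noteq> 0" "b \<noteq> 0" "u = frc a / frc b" using u by (rule local_atE)
    then have "- u = frc (- a) / frc b" by (simp add: frc_simps)
    then show ?thesis using ab(1) unfolding local_at_def by blast
  qed
  moreover have "1 \<in> local_at" using frc_in_local_at[of 1] by (simp add: frc_simps)
  ultimately show ?thesis by (simp add: sub_ring_def)
qed

lemma vanishing_ideal:
  assumes "J \<le> n"
  shows "vanishing J \<subseteq> local_at" "0 \<in> vanishing J" "u \<in> vanishing J \<Longrightarrow> v \<in> vanishing J \<Longrightarrow> u + v \<in> vanishing J"
    "w \<in> local_at \<Longrightarrow> u \<in> vanishing J \<Longrightarrow> w * u \<in> vanishing J" "1 \<notin> vanishing J"
    "u \<in> vanishing J \<Longrightarrow> v \<in> vanishing J \<Longrightarrow> u - v \<in> vanishing J"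
proof -
  show "vanishing J \<subseteq> local_at" by (auto simp: vanishing_def local_at_def)
  show "0 \<in> vanishing J" using vanishing_iff[OF assms, of 1 0] by (simp add: kill_ring frc_simps)
  show "1 \<notin> vanishing J" using vanishing_iff[OF assms, of 1 1] by (simp add: kill_ring frc_simps)
  show mult: "w * u \<in> vanishing J" if wu: "w \<in> local_at" "u \<in> vanishing J" for u w
  proof -
    obtain a b where ab: "kill n b \<noteq> 0" "w = frc a / frc b" using wu(1) by (rule local_atE)
    obtain c d where cd: "kill n d \<noteq> 0" "kill J c = 0" "u = frc c / frc d" using wu(2) by (auto simp: vanishing_def)
    have "w * u = frc (a * c) / frc (b * d)" using ab cd by (simp add: frc_simps)
    then show ?thesis using ab cd by (simp add: vanishing_iff[OF assms] kill_ring)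
  qed
  show add: "u + v \<in> vanishing J" if uv: "u \<in> vanishing J" "v \<in> vanishing J" for u v
  proof -
    obtain a b where ab: "kill n b \<noteq> 0" "kill J a = 0" "u = frc a / frc b" using uv(1) by (auto simp: vanishing_def)
    obtain c d where cd: "kill n d \<noteq> 0" "kill J c = 0" "v = frc c / frc d" using uv(2) by (auto simp: vanishing_def)
    have "b \<noteq> 0" "d \<noteq> 0" using ab cd kill_ring(4) by auto
    then have "u + v = frc (a * d + c * b) / frc (b * d)"
      using ab cd by (simp add: frc_simps add_frac_eq frc_eq_0)
    then show ?thesis using ab cd by (simp add: vanishing_iff[OF assms] kill_ring)
  qed
  show "u - v \<in> vanishing J" if "u \<in> vanishing J" "v \<in> vanishing J"
    using add[OF that(1) mult[of "- 1" v]] that(2) sub_ringD(1,3)[OF sub_ring_local_at] by auto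
qed

lemma vanishing_prime:
  assumes "J \<le> n" "u \<in> local_at" "v \<in> local_at" "u * v \<in> vanishing J"
  shows "u \<in> vanishing J \<or> v \<in> vanishing J"
proof -
  obtain a b where ab: "kill n b \<noteq> 0" "u = frc a / frc b" using assms(2) by (rule local_atE)
  obtain c d where cd: "kill n d \<noteq> 0" "v = frc c / frc d" using assms(3) by (rule local_atE)
  have "frc (a * c) / frc (b * d) \<in> vanishing J" using assms(4) ab cd by (simp add: frc_simps)
  then have "kill J (a * c) = 0" using vanishing_iff[OF assms(1), of "b * d"] ab cd by (simp add: kill_ring)
  then show ?thesis using ab cd vanishing_iff[OF assms(1)] by (auto simp: kill_ring)
qed

lemma local_at_unit:
  assumes "w \<in> local_at" "w \<notin> vanishing n"
  shows "inverse w \<in> local_at"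
proof -
  obtain a b where ab: "kill n b \<noteq> 0" "w = frc a / frc b" using assms(1) by (rule local_atE)
  then have "kill n a \<noteq> 0" using assms(2) vanishing_iff[of n b a] by auto
  then show ?thesis using ab by (auto simp: local_at_def)
qed

lemma vanishing_subset_span: "vanishing n \<subseteq> ideal_span local_at ((\<lambda>j. vr (Xv j)) ` {..<n})"
proof
  fix w assume "w \<in> vanishing n"
  then obtain a b where ab: "kill n b \<noteq> 0" "kill n a = 0" "w = frc a / frc b" by (auto simp: vanishing_def)
  have "a \<in> ideal_span UNIV ((\<lambda>j. Vr (Xv j)) ` {..<n})" using diff_kill_in_span[of a n] ab by simp
  then have "frc a \<in> ideal_span (range frc) (frc ` (\<lambda>j. Vr (Xv j)) ` {..<n})"
    by (intro ideal_span_image) (auto simp: frc_simps)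
  moreover have "frc ` (\<lambda>j. Vr (Xv j)) ` {..<n} = (\<lambda>j. vr (Xv j)) ` {..<n}"
    by (simp add: image_image vr_def)
  moreover have "range frc \<subseteq> local_at" using frc_in_local_at by auto
  moreover have "(\<lambda>j. vr (Xv j)) ` {..<n} \<subseteq> ideal_span local_at ((\<lambda>j. vr (Xv j)) ` {..<n})"
    by (rule subsetI) (rule ideal_span_base[OF sub_ring_local_at])
  ultimately have fa: "frc a \<in> ideal_span local_at ((\<lambda>j. vr (Xv j)) ` {..<n})"
    by (auto intro: subsetD[OF ideal_span_subset[OF sub_ring_local_at]])
  show "w \<in> ideal_span local_at ((\<lambda>j. vr (Xv j)) ` {..<n})"
    using ideal_span_mult[OF sub_ring_local_at inverse_frc_in_local_at[OF ab(1)] fa]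
    by (simp add: ab(3) divide_inverse mult.commute)
qed

lemma vr_X_in_vanishing: "j < n \<Longrightarrow> vr (Xv j) \<in> vanishing n"
  using vanishing_iff[of n 1 "Vr (Xv j)"] by (simp add: vr_def kill_ring kill_simps frc_simps)

definition coeff_field :: "K set" where
  "coeff_field = fractions (frc ` {p. kill n p = p})"

lemma coeff_fieldE:
  assumes "w \<in> coeff_field"
  obtains a b where "kill n a = a" "kill n b = b" "b \<noteq> 0" "w = frc a / frc b"
  using assms by (auto simp: coeff_field_def fractions_def frc_eq_0)

lemma coeff_field:
  shows "sub_field coeff_field" "coeff_field \<subseteq> local_at"
    "w \<in> coeff_field \<Longrightarrow> w \<in> vanishing n \<Longrightarrow> w = 0"
    "kill n p = p \<Longrightarrow> frc p \<in> coeff_field"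
proof -
  have "sub_ring {p. kill n p = p}" by (auto simp: sub_ring_def kill_ring)
  then have R: "sub_ring (frc ` {p. kill n p = p})" by (intro sub_ring_image) (auto simp: frc_simps)
  show "sub_field coeff_field" unfolding coeff_field_def by (rule sub_field_fractions[OF R])
  show "kill n p = p \<Longrightarrow> frc p \<in> coeff_field"
    unfolding coeff_field_def by (rule fractions_base[OF R]) simp
  show "coeff_field \<subseteq> local_at"
  proof
    fix w assume "w \<in> coeff_field"
    then show "w \<in> local_at"
    proof (rule coeff_fieldE)
      fix a b assume "kill n b = b" "b \<noteq> 0" "w = frc a / frc b"
      then show "w \<in> local_at" unfolding local_at_def by (intro CollectI exI[of _ a] exI[of _ b]) simp
    qed
  qed
  show "w = 0" if w: "w \<in> coeff_field" "w \<in> vanishing n"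
    using w(1)
  proof (rule coeff_fieldE)
    fix a b assume ab: "kill n a = a" "kill n b = b" "b \<noteq> 0" "w = frc a / frc b"
    then show "w = 0" using w(2) vanishing_iff[of n b a] by (simp add: frc_simps)
  qed
qed

lemma coeff_field_vars:
  "cst c \<in> coeff_field" "n \<le> j \<Longrightarrow> vr (Xv j) \<in> coeff_field" "vr (Uv e) \<in> coeff_field" "vr (Gv e) \<in> coeff_field"
  unfolding cst_def vr_def by (auto intro!: coeff_field(4) simp: kill_simps)

text \<open>The polynomial ring over the coefficient field is obtained by adjoining \<open>n\<close> elements, and the local ring
consists of fractions of its elements.\<close>

lemma noeth_local_at: "noeth local_at"
proof -
  define T where "T = rec_nat coeff_field (\<lambda>k S. adjoin S (vr (Xv k)))"
  have T0: "T 0 = coeff_field" and TS: "T (Suc k) = adjoin (T k) (vr (Xv k))" for k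
    by (simp_all add: T_def)
  note sf = sub_fieldD[OF coeff_field(1)]
  have T: "sub_ring (T k) \<and> noeth (T k) \<and> T k \<subseteq> local_at \<and> coeff_field \<subseteq> T k \<and> (\<forall>j<k. vr (Xv j) \<in> T k)" for k
  proof (induction k)
    case 0
    then show ?case using sf(1,2) coeff_field(2) by (simp add: T0 noeth_field)
  next
    case (Suc k)
    have "T (Suc k) \<subseteq> local_at"
      unfolding TS using Suc by (intro adjoin_subset[OF sub_ring_local_at]) (auto simp: vr_def frc_in_local_at)
    then show ?case
      using Suc adjoin[of "T k" "vr (Xv k)"] unfolding TS less_Suc_eq by blast
  qed
  note R = T[of n, THEN conjunct1]
  have frc_T: "frc p \<in> T n" for p
  proof (induction p rule: polynomial_induct)
    case (Cnst c) then show ?case using T[of n] coeff_field_vars(1)[of c] by (auto simp: cst_def)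
  next
    case (Vr v)
    have "vr v \<in> T n"
    proof (cases v)
      case (Xv j) then show ?thesis using T[of n] coeff_field_vars(2)[of j] by (cases "j < n") auto
    qed (use T[of n] coeff_field_vars in auto)
    then show ?case by (simp add: vr_def)
  qed (auto simp: frc_simps intro: sub_ringD[OF R])
  show ?thesis
  proof (rule noeth_fractions[of "T n"])
    fix w assume "w \<in> local_at"
    then obtain a b where ab: "kill n b \<noteq> 0" "b \<noteq> 0" "w = frc a / frc b" by (rule local_atE)
    then show "\<exists>b\<in>local_at. \<exists>c\<in>local_at. b * c = 1 \<and> b * w \<in> T n"
      using frc_T frc_in_local_at inverse_frc_in_local_at[of b] by (intro bexI[of _ "frc b"] bexI[of _ "inverse (frc b)"]) (auto simp: frc_eq_0)
  qed (simp_all add: T sub_ring_local_at)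
qed

lemma frc_in_box_span: "\<exists>d. frc p \<in> box_span coeff_field n (\<lambda>j. vr (Xv j)) d"
proof -
  note R = sub_fieldD(1)[OF coeff_field(1)]
  let ?B = "box_span coeff_field n (\<lambda>j. vr (Xv j))"
  have E: "w \<in> ?B 0" if "w \<in> coeff_field" for w
  proof -
    have "w * 1 \<in> ?B 0"
      unfolding box_span_def by (rule ideal_span_mult[OF R that box_span_one[OF R, unfolded box_span_def]])
    then show ?thesis by simp
  qed
  show ?thesis
  proof (induction p rule: polynomial_induct)
    case (Cnst c) then show ?case using E[OF coeff_field_vars(1)] unfolding cst_def by blast
  next
    case (Vr v)
    have "\<exists>d. vr v \<in> ?B d"
    proof (cases "\<exists>j<n. v = Xv j")
      case True
      then obtain j where j: "j < n" "v = Xv j" by auto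
      let ?\<beta> = "restrict (\<lambda>i. if i = j then 1 else 0 :: nat) {..<n}"
      have "vr v = (\<Prod>i<n. vr (Xv i) ^ ?\<beta> i)"
        using j by (simp add: if_distrib[of "power _"] prod.delta cong: if_cong)
      moreover have "?\<beta> \<in> PiE {..<n} (\<lambda>_. {..1})" by auto
      ultimately show ?thesis unfolding box_span_def
        by (intro exI[of _ 1] ideal_span_base[OF R]) blast
    next
      case False
      then have "vr v \<in> coeff_field" using coeff_field_vars by (cases v) (auto simp: not_less)
      then show ?thesis using E by blast
    qed
    then show ?case by (simp add: vr_def)
  next
    case (add p q)
    then obtain d e where "frc p \<in> ?B d" "frc q \<in> ?B e" by auto
    then have "frc p \<in> ?B (max d e)" "frc q \<in> ?B (max d e)" by (auto intro: box_span_mono[rotated])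
    then show ?case by (auto simp: frc_simps box_span_def intro!: exI[of _ "max d e"] ideal_span_add)
  next
    case (mult p q)
    then show ?case by (auto simp: frc_simps intro: box_span_mult[OF R])
  qed
qed

lemma local_at_box_fractions:
  assumes "w \<in> local_at"
  shows "\<exists>b d. b \<noteq> 0 \<and> b \<in> box_span coeff_field n (\<lambda>j. vr (Xv j)) d \<and>
    w * b \<in> box_span coeff_field n (\<lambda>j. vr (Xv j)) d"
proof -
  obtain a b where ab: "b \<noteq> 0" "w = frc a / frc b" using assms by (rule local_atE)
  obtain d e where "frc a \<in> box_span coeff_field n (\<lambda>j. vr (Xv j)) d" "frc b \<in> box_span coeff_field n (\<lambda>j. vr (Xv j)) e"
    using frc_in_box_span by blast
  then have "frc a \<in> box_span coeff_field n (\<lambda>j. vr (Xv j)) (max d e)" "frc b \<in> box_span coeff_field n (\<lambda>j. vr (Xv j)) (max d e)"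
    by (auto intro: box_span_mono[rotated])
  then show ?thesis using ab by (intro exI[of _ "frc b"] exI[of _ "max d e"]) (auto simp: frc_eq_0)
qed

end

section \<open>The conjugation\<close>

text \<open>Only nonzero elements of the maximal ideal need to divide some \<open>1 + s\<^sup>2 + t\<^sup>2\<close>.  For all other expressions
\<open>x\<^sub>0\<close> is a harmless value.  For \<open>n > 0\<close> it lies in the maximal ideal, which keeps the residue of the
conjugation uniform in \<open>e\<close>; and it is not zero, since \<open>0 = 1 + s\<^sup>2 + t\<^sup>2\<close> has no real solution.\<close>

definition factor :: "nat \<Rightarrow> K \<Rightarrow> K" where
  "factor n w = (if w \<in> vanishing n n \<and> w \<noteq> 0 then w else vr (Xv 0))"

primrec val :: "nat \<Rightarrow> expr \<Rightarrow> K" and conj_var :: "nat \<Rightarrow> var \<Rightarrow> K" where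
  "val n (Const r) = cst (complex_of_real r)"
| "val n (RePart v) = (vr v + conj_var n v) / cst 2"
| "val n (ImPart v) = (vr v - conj_var n v) / cst (2 * \<i>)"
| "val n (Plus a b) = val n a + val n b"
| "val n (Times a b) = val n a * val n b"
| "val n (Recip a) = inverse (val n a)"
| "conj_var n (Xv j) = vr (Xv j)"
| "conj_var n (Uv e) = (factor n (val n e) * vr (Gv e) - 1) / vr (Uv e)"
| "conj_var n (Gv e) = vr (Gv e)"

lemma factor_neq_0: "factor n w \<noteq> 0"
  by (simp add: factor_def vr_neq_0)

text \<open>The size of an expression bounds the size of the indices that occur in it: the value of an expression does
not depend on the variables indexed by expressions that are at least as large.\<close>

lemma translate_fixes_val:
  assumes "v = Uv e0 \<or> v = Gv e0"
  shows "size e \<le> size e0 \<longrightarrow> ftranslate v c (val n e) = val n e"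
    "size w \<le> size e0 \<longrightarrow> ftranslate v c (conj_var n w) = conj_var n w \<and> ftranslate v c (vr w) = vr w"
proof (induction e and w)
  case (Uv e)
  have "Uv e \<noteq> v" "Gv e \<noteq> v" "Xv 0 \<noteq> v" if "size (Uv e) \<le> size e0" using assms that by auto
  moreover have "ftranslate v c (vr (Xv 0)) = vr (Xv 0)" using assms by (intro ftranslate_simps) auto
  ultimately show ?case using Uv by (auto simp: ftr ftranslate_simps factor_def)
next
  case (Gv e)
  have "Gv e \<noteq> v" if "size (Gv e) \<le> size e0" using assms that by auto
  then show ?case by (auto simp: ftranslate_simps)
next
  case (Xv j)
  have "Xv j \<noteq> v" using assms by auto
  then show ?case by (auto simp: ftranslate_simps)
qed (auto simp: ftr ftranslate_simps)

lemma translate_fixes_factor: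
  assumes "v = Uv e0 \<or> v = Gv e0" "size e \<le> size e0"
  shows "ftranslate v c (factor n (val n e)) = factor n (val n e)"
proof -
  have "Xv 0 \<noteq> v" using assms by auto
  then show ?thesis using translate_fixes_val(1)[OF assms(1)] assms(2) by (auto simp: factor_def ftranslate_simps)
qed

lemma factor_times_var_neq_1: "factor n (val n e) * vr (Gv e) \<noteq> 1"
proof
  assume 1: "factor n (val n e) * vr (Gv e) = 1"
  have "ftranslate (Gv e) 1 (factor n (val n e) * vr (Gv e)) = factor n (val n e) * (vr (Gv e) + 1)"
    by (simp add: ftr ftranslate_simps translate_fixes_factor cst_simps)
  then have "factor n (val n e) = 0" unfolding 1 by (simp add: ftr distrib_left 1)
  then show False by (simp add: factor_neq_0)
qed

lemma inj_cst: "cst a = cst b \<longleftrightarrow> a = b"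
  using cst_simps(6)[of a b] cst_simps(9)[of "a - b"] by auto

text \<open>The case of \<open>substitution_injective\<close> in which the moving endomorphisms are the translations of the
variables.\<close>

lemma independent_by_translation:
  fixes h :: "'k::comm_ring_1 \<Rightarrow> K" and rank :: "var \<Rightarrow> nat"
  assumes h: "ring_map h" "\<And>c. h c = 0 \<Longrightarrow> c = 0" "\<And>c. \<exists>a. h c = cst a"
    and fixd: "\<And>v w i. w \<noteq> v \<Longrightarrow> rank w \<le> rank v \<Longrightarrow> ftranslate v i (z w) = z w"
    and moved: "\<And>v. inj (\<lambda>i. ftranslate v i (z v))"
    and "p \<noteq> 0"
  shows "peval h z p \<noteq> 0"
proof (rule substitution_injective[OF h(1,2), where rank = rank])
  fix v
  have "infinite (range (\<lambda>i. ftranslate v i (z v)))"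
    using moved[of v] infinite_UNIV_char_0[where 'a = complex] by (simp add: finite_image_iff)
  moreover have "ftranslate v i (h c) = h c" for i c using h(3)[of c] ftranslate_simps(1) by auto
  ultimately show "\<exists>T :: complex \<Rightarrow> K \<Rightarrow> K. (\<forall>i. ring_map (T i) \<and> (\<forall>c. T i (h c) = h c) \<and>
      (\<forall>w. w \<noteq> v \<longrightarrow> rank w \<le> rank v \<longrightarrow> T i (z w) = z w)) \<and> infinite (range (\<lambda>i. T i (z v)))"
    using ftranslate(1) fixd by (intro exI[of _ "ftranslate v"]) blast
qed (use \<open>p \<noteq> 0\<close> in simp_all)

definition conj_poly :: "nat \<Rightarrow> cpoly \<Rightarrow> K" where
  "conj_poly n = peval (\<lambda>c. cst (cnj c)) (conj_var n)"

lemma ring_map_cst_cnj: "ring_map (\<lambda>c. cst (cnj c))"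
  by (rule ring_map_comp[OF ring_map_cst ring_map_cnj])

lemma ring_map_conj_poly: "ring_map (conj_poly n)"
  unfolding conj_poly_def by (rule ring_map_peval[OF ring_map_cst_cnj])

text \<open>With \<open>Uv e\<close> ranked by the size of \<open>e\<close> the substitution is triangular: translating \<open>u\<^sub>e\<close> moves
\<open>(f\<^sub>e g\<^sub>e - 1) / u\<^sub>e\<close> but fixes \<open>f\<^sub>e\<close> and the images of all variables of smaller or equal rank.\<close>

lemma conj_poly_injective: "conj_poly n p = 0 \<Longrightarrow> p = 0"
proof (rule ccontr)
  define rank where "rank v = (case v of Uv e \<Rightarrow> Suc (size e) | _ \<Rightarrow> 0)" for v
  assume "conj_poly n p = 0" and "p \<noteq> 0"
  moreover have "peval (\<lambda>c. cst (cnj c)) (conj_var n) p \<noteq> 0"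
  proof (rule independent_by_translation[where rank = rank])
    show "ftranslate v i (conj_var n w) = conj_var n w" if w: "w \<noteq> v" "rank w \<le> rank v" for v w i
    proof (cases w)
      case (Uv e)
      then obtain e0 where e0: "v = Uv e0" "size e \<le> size e0" using w(2) by (cases v) (auto simp: rank_def)
      then have "Gv e \<noteq> v" "Uv e \<noteq> v" using w(1) Uv by auto
      then show ?thesis using translate_fixes_factor[of v e0 e] e0
        by (simp add: Uv ftr ftranslate_simps)
    qed (use w in \<open>auto simp: ftranslate_simps\<close>)
    show "inj (\<lambda>i. ftranslate v i (conj_var n v))" for v
    proof (rule injI)
      fix i j assume eq: "ftranslate v i (conj_var n v) = ftranslate v j (conj_var n v)"
      show "i = j"
      proof (cases v)
        case (Uv e)
        let ?f = "factor n (val n e) * vr (Gv e) - 1"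
        have nz: "?f \<noteq> 0" using factor_times_var_neq_1 by simp
        have T: "ftranslate v i (conj_var n v) = ?f / (vr v + cst i)" for i
          using Uv translate_fixes_factor[of v e e] by (simp add: ftr ftranslate_simps)
        have "vr v + cst i = ftranslate v i (vr v)" for i by (simp add: ftranslate_simps)
        then have "vr v + cst i \<noteq> 0" for i using ftr(9)[of v i "vr v"] vr_neq_0[of v] by simp
        then have "vr v + cst i = vr v + cst j" using eq nz unfolding T by (simp add: frac_eq_eq)
        then show ?thesis by (simp add: inj_cst)
      qed (use eq in \<open>auto simp: ftranslate_simps inj_cst\<close>)
    qed
  qed (use \<open>p \<noteq> 0\<close> in \<open>auto simp: ring_map_cst_cnj cst_simps\<close>)
  ultimately show False by (simp add: conj_poly_def)
qed

definition conj :: "nat \<Rightarrow> K \<Rightarrow> K" where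
  "conj n = fext (conj_poly n)"

lemma ring_map_conj: "ring_map (conj n)"
  unfolding conj_def by (rule ring_map_fext(1)[OF ring_map_conj_poly conj_poly_injective])

lemma conj_frc: "conj n (frc p) = conj_poly n p"
  unfolding conj_def by (rule ring_map_fext(2)[OF ring_map_conj_poly conj_poly_injective])

lemmas conj_ring = ring_mapD[OF ring_map_conj] ring_map_inverse[OF ring_map_conj]

lemma conj_simps: "conj n (cst c) = cst (cnj c)" "conj n (vr v) = conj_var n v"
  by (simp_all add: cst_def vr_def conj_frc conj_poly_def peval_Cnst peval_Vr ring_map_cst_cnj[unfolded cst_def])

lemma conj_val: "conj n (val n e) = val n e" "conj n (conj_var n v) = vr v"
proof (induction e and v)
  case (RePart v)
  then show ?case by (simp add: conj_ring conj_simps add.commute)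
next
  case (ImPart v)
  have "cst (cnj (2 * \<i>)) = - cst (2 * \<i>)" by (simp flip: cst_simps(5))
  then show ?case using ImPart
    by (simp add: conj_ring conj_simps del: complex_cnj_mult)
      (metis minus_diff_eq minus_divide_left minus_divide_right)
next
  case (Uv e)
  have f: "conj n (factor n (val n e)) = factor n (val n e)"
    using Uv by (simp add: factor_def conj_simps)
  have "factor n (val n e) * vr (Gv e) - 1 \<noteq> 0" using factor_times_var_neq_1 by simp
  then show ?case by (simp add: conj_ring conj_simps f)
qed (simp_all add: conj_ring conj_simps)

lemma conj_conj: "conj n (conj n w) = w"
proof (rule ring_map_fract_unique[where g = "\<lambda>w. w"])
  show "ring_map (\<lambda>w. conj n (conj n w))" by (rule ring_map_comp[OF ring_map_conj ring_map_conj])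
  show "conj n (conj n (frc p)) = frc p" for p
  proof (rule ring_map_unique[where f = "\<lambda>p. conj n (conj n (frc p))" and g = frc])
    show "ring_map (\<lambda>p. conj n (conj n (frc p)))"
      by (rule ring_map_comp[OF ring_map_conj ring_map_comp[OF ring_map_conj ring_map_frc]])
    show "conj n (conj n (frc (Cnst c))) = frc (Cnst c)" for c
      using conj_simps(1) by (simp flip: cst_def)
    show "conj n (conj n (frc (Vr v))) = frc (Vr v)" for v
      using conj_simps(2) conj_val(2) by (simp flip: vr_def)
  qed (rule ring_map_frc)
qed (simp add: ring_map_def)

lemma cst_of_real_fixed: "conj n (cst (complex_of_real r)) = cst (complex_of_real r)"
  by (simp add: conj_simps)

text \<open>The elements \<open>a + \<i> b\<close> with \<open>a\<close> and \<open>b\<close> values of expressions form a field, since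
\<open>1 / (a + \<i> b) = (a - \<i> b) / (a\<^sup>2 + b\<^sup>2)\<close>, and this field contains the constants and the variables.  The
denominator is not zero because \<open>a - \<i> b\<close> is the conjugate of \<open>a + \<i> b\<close>.\<close>

lemma decompose: "\<exists>d e. w = val n d + cst \<i> * val n e"
proof -
  let ?C = "{val n d + cst \<i> * val n e | d e. True}"
  have ii: "cst \<i> * cst \<i> = - 1" by (simp add: cst_simps flip: cst_simps(3))
  have neg: "- val n e = val n (Times (Const (- 1)) e)" for e by (simp add: cst_simps)
  have diff: "val n d - val n e = val n (Plus d (Times (Const (- 1)) e))" for d e by (simp add: cst_simps)
  have mult: "u * v \<in> ?C" and add: "u + v \<in> ?C" if uv: "u \<in> ?C" "v \<in> ?C" for u v
  proof -
    obtain a b c d where *: "u = val n a + cst \<i> * val n b" "v = val n c + cst \<i> * val n d"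
      using uv by blast
    have "u * v = val n a * val n c + (cst \<i> * cst \<i>) * (val n b * val n d)
        + cst \<i> * (val n a * val n d + val n b * val n c)"
      unfolding * by (simp add: algebra_simps)
    also have "\<dots> = val n (Plus (Times a c) (Times (Const (- 1)) (Times b d)))
        + cst \<i> * val n (Plus (Times a d) (Times b c))"
      unfolding ii by (simp add: cst_simps)
    finally show "u * v \<in> ?C" by blast
    have "u + v = val n (Plus a c) + cst \<i> * val n (Plus b d)"
      unfolding * by (simp add: algebra_simps)
    then show "u + v \<in> ?C" by blast
  qed
  have frc: "frc p \<in> ?C" for p
  proof (induction p rule: polynomial_induct)
    case (Cnst c)
    have "cst c = val n (Const (Re c)) + cst \<i> * val n (Const (Im c))"
      using complex_eq[of c] by (simp flip: cst_simps(2,3))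
    then show ?case unfolding cst_def by blast
  next
    case (Vr v)
    have "cst 2 \<noteq> 0" "cst \<i> \<noteq> 0" by (simp_all add: cst_simps)
    moreover have "cst (2 * \<i>) = cst 2 * cst \<i>" by (simp add: cst_simps)
    moreover have "cst 2 = 2" using cst_simps(2)[of 1 1] by (simp add: cst_simps(1))
    moreover have "cst \<i> * (u / (2 * cst \<i>)) = u / 2" for u using calculation(2) by simp
    ultimately have "val n (RePart v) + cst \<i> * val n (ImPart v) = ((vr v + conj_var n v) + (vr v - conj_var n v)) / 2"
      by (simp only: val.simps add_divide_distrib)
    also have "\<dots> = (2 * vr v) / 2" unfolding mult_2 by simp
    also have "\<dots> = vr v" by (rule nonzero_mult_div_cancel_left[OF two_neq_0])
    finally have "vr v = val n (RePart v) + cst \<i> * val n (ImPart v)" by (rule sym)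
    then show ?case unfolding vr_def by blast
  qed (use add mult in \<open>simp_all add: frc_simps del: mem_Collect_eq\<close>)
  have inv: "inverse u \<in> ?C" if u: "u \<in> ?C" for u
  proof (cases "u = 0")
    case True
    have "0 = val n (Const 0) + cst \<i> * val n (Const 0)" by (simp add: cst_simps)
    then show ?thesis using True by (metis (mono_tags, lifting) inverse_zero mem_Collect_eq)
  next
    case False
    obtain a b where ab: "u = val n a + cst \<i> * val n b" using u by blast
    have cu: "conj n u = val n a - cst \<i> * val n b"
      by (simp add: ab conj_ring conj_simps conj_val cst_simps)
    let ?r = "Recip (Plus (Times a a) (Times b b))"
    have uu: "u * conj n u = val n (Plus (Times a a) (Times b b))"
    proof -
      have "u * conj n u = val n a * val n a - (cst \<i> * cst \<i>) * (val n b * val n b)"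
        unfolding cu by (simp add: ab algebra_simps)
      then show ?thesis by (simp add: ii)
    qed
    have "inverse u = conj n u * val n ?r"
      using False conj_ring(9)[of n u] unfolding val.simps(6) uu[symmetric] by simp
    also have "\<dots> = val n (Times a ?r) + cst \<i> * val n (Times (Const (- 1)) (Times b ?r))"
      unfolding cu by (simp add: cst_simps algebra_simps)
    finally show ?thesis by blast
  qed
  obtain a b where "w = frc a / frc b" by (rule frc_cases)
  then have "w \<in> ?C" using mult[OF frc inv[OF frc]] by (simp add: divide_inverse del: mem_Collect_eq)
  then show ?thesis by blast
qed

lemma fixed_is_val:
  assumes "conj n w = w"
  shows "\<exists>e. w = val n e"
proof -
  obtain d e where w: "w = val n d + cst \<i> * val n e" using decompose by blast
  have "conj n w = val n d - cst \<i> * val n e"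
    by (simp add: w conj_ring conj_simps conj_val cst_simps)
  then have "2 * (cst \<i> * val n e) = 0" using assms unfolding w by simp
  then have "cst \<i> * val n e = 0" using two_neq_0 by simp
  then show ?thesis using w by auto
qed

lemma conj_var_in_local_at:
  assumes "0 < n \<or> factor n (val n e) \<in> vanishing n n"
  shows "factor n (val n e) \<in> vanishing n n" "conj_var n (Uv e) \<in> local_at n"
proof -
  show f: "factor n (val n e) \<in> vanishing n n" using assms vr_X_in_vanishing[of 0 n] by (auto simp: factor_def)
  have "inverse (vr (Uv e)) \<in> local_at n"
    unfolding vr_def by (rule inverse_frc_in_local_at) (simp add: kill_simps Vr_neq_0)
  then show "conj_var n (Uv e) \<in> local_at n"
    using f vanishing_ideal(1)[of n n] frc_in_local_at[of "Vr (Gv e)" n]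
    by (auto simp: divide_inverse vr_def intro!: sub_ringD[OF sub_ring_local_at])
qed

text \<open>What the conjugation induces on the coefficient field: \<open>f\<^sub>e\<close> vanishes modulo the maximal ideal, so
\<open>(f\<^sub>e g\<^sub>e - 1) / u\<^sub>e\<close> becomes \<open>- 1 / u\<^sub>e\<close>.\<close>

definition res_conj :: "cpoly \<Rightarrow> K" where
  "res_conj = peval (\<lambda>c. cst (cnj c)) (\<lambda>v. case v of Uv e \<Rightarrow> - inverse (vr v) | _ \<Rightarrow> vr v)"

lemma res_conj_simps:
  "res_conj (Cnst c) = cst (cnj c)" "res_conj (Vr (Xv j)) = vr (Xv j)"
  "res_conj (Vr (Uv e)) = - inverse (vr (Uv e))" "res_conj (Vr (Gv e)) = vr (Gv e)"
  by (simp_all add: res_conj_def peval_Cnst peval_Vr ring_map_cst_cnj)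

lemma ring_map_res_conj: "ring_map (res_conj)"
  unfolding res_conj_def by (rule ring_map_peval[OF ring_map_cst_cnj])

lemmas res_conj_ring = ring_mapD[OF ring_map_res_conj]

lemma res_conj_injective: "p \<noteq> 0 \<Longrightarrow> res_conj p \<noteq> 0"
  unfolding res_conj_def
proof (rule independent_by_translation[where rank = "\<lambda>_. 0"])
  let ?z = "\<lambda>v. case v of Uv e \<Rightarrow> - inverse (vr v) | _ \<Rightarrow> vr v"
  show "ftranslate v i (?z w) = ?z w" if "w \<noteq> v" for v w i
    using that by (cases w) (auto simp: ftr ftranslate_simps)
  show "inj (\<lambda>i. ftranslate v i (?z v))" for v
    by (rule injI, cases v) (auto simp: ftr ftranslate_simps inj_cst)
qed (auto simp: ring_map_cst_cnj cst_simps)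

lemma res_conj_in_coeff_field: "res_conj (kill n p) \<in> coeff_field n"
proof -
  note R = sub_fieldD[OF coeff_field(1)[of n]]
  show ?thesis
  proof (induction p rule: polynomial_induct)
    case (Vr v)
    show ?case
      by (cases v) (auto simp: kill_simps res_conj_simps res_conj_ring coeff_field_vars
          intro!: R(2) sub_ringD[OF R(1)])
  qed (auto simp: kill_simps res_conj_simps kill_ring res_conj_ring coeff_field_vars intro: sub_ringD[OF R(1)])
qed

text \<open>On the variable \<open>u\<^sub>e\<close> the difference is \<open>f\<^sub>e g\<^sub>e / u\<^sub>e\<close>, a multiple of \<open>f\<^sub>e\<close>; on the other generators it vanishes
or is one of \<open>x\<^sub>0, \<dots>, x\<^sub>n\<^sub>-\<^sub>1\<close>.\<close>

lemma conj_poly_residue: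
  assumes "0 < n"
  shows "conj_poly n p \<in> local_at n" "conj_poly n p - res_conj (kill n p) \<in> vanishing n n"
proof -
  note O = sub_ringD[OF sub_ring_local_at[of n]] and m = vanishing_ideal[of n n, OF order_refl]
  have "conj_poly n p \<in> local_at n \<and> conj_poly n p - res_conj (kill n p) \<in> vanishing n n"
  proof (induction p rule: polynomial_induct)
    case (Cnst c)
    have "conj_poly n (Cnst c) = cst (cnj c)"
      by (simp add: conj_poly_def peval_Cnst ring_map_cst_cnj)
    then show ?case using frc_in_local_at[of "Cnst (cnj c)" n] m(2)
      by (simp add: kill_simps res_conj_simps cst_def)
  next
    case (Vr v)
    have eq: "conj_poly n (Vr v) = conj_var n v" by (simp add: conj_poly_def peval_Vr ring_map_cst_cnj)
    show ?case
    proof (cases v)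
      case (Xv j)
      then show ?thesis unfolding eq using vr_X_in_vanishing[of j n] m(2) frc_in_local_at[of "Vr v" n]
        by (simp add: kill_simps res_conj_simps res_conj_ring vr_def)
    next
      case (Gv e)
      then show ?thesis unfolding eq using m(2) frc_in_local_at[of "Vr v" n]
        by (simp add: kill_simps res_conj_simps vr_def)
    next
      case (Uv e)
      have c: "factor n (val n e) \<in> vanishing n n" "conj_var n (Uv e) \<in> local_at n" using conj_var_in_local_at assms by auto
      have "conj_var n (Uv e) - - inverse (vr (Uv e)) = (vr (Gv e) * inverse (vr (Uv e))) * factor n (val n e)"
        by (simp add: divide_inverse algebra_simps)
      also have "\<dots> \<in> vanishing n n"
        using c(1) frc_in_local_at[of "Vr (Gv e)" n] inverse_frc_in_local_at[of n "Vr (Uv e)"]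
        by (intro m(4) O(5)) (auto simp: vr_def kill_simps Vr_neq_0)
      finally show ?thesis unfolding eq using c(2) Uv by (simp add: kill_simps res_conj_simps)
    qed
  next
    case (add p q)
    have "conj_poly n (p + q) - res_conj (kill n (p + q))
        = (conj_poly n p - res_conj (kill n p)) + (conj_poly n q - res_conj (kill n q))"
      by (simp add: ring_mapD[OF ring_map_conj_poly] kill_ring res_conj_ring)
    then have "conj_poly n (p + q) - res_conj (kill n (p + q)) \<in> vanishing n n" using add m(3) by metis
    then show ?case using add O(4) by (simp add: ring_mapD[OF ring_map_conj_poly])
  next
    case (mult p q)
    have "conj_poly n (p * q) - res_conj (kill n (p * q))
        = conj_poly n q * (conj_poly n p - res_conj (kill n p))
          + res_conj (kill n p) * (conj_poly n q - res_conj (kill n q))"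
      by (simp add: ring_mapD[OF ring_map_conj_poly] kill_ring res_conj_ring algebra_simps)
    moreover have "res_conj (kill n p) \<in> local_at n"
      using res_conj_in_coeff_field coeff_field(2) by blast
    ultimately have "conj_poly n (p * q) - res_conj (kill n (p * q)) \<in> vanishing n n" using mult m(3,4) by metis
    then show ?case using mult O(5) by (simp add: ring_mapD[OF ring_map_conj_poly])
  qed
  then show "conj_poly n p \<in> local_at n" "conj_poly n p - res_conj (kill n p) \<in> vanishing n n" by auto
qed

text \<open>A denominator has a nonzero residue in the coefficient field.  The residue of its conjugate is the image
of that residue under an injective map, so the conjugate is again invertible in the local ring.\<close>

lemma conj_in_local_at:
  assumes "w \<in> local_at n"
  shows "conj n w \<in> local_at n"
\<comment> \<open>For \<open>n = 0\<close> the element \<open>x\<^sub>0\<close> is a unit and the residue computation fails, but the local ring is the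
  whole field.\<close>
proof (cases "n = 0")
  case True
  have "w' \<in> local_at 0" for w'
  proof -
    obtain a b where "b \<noteq> 0" "w' = frc a / frc b" by (rule frc_cases)
    then show ?thesis by (auto simp: local_at_def kill_0)
  qed
  then show ?thesis using True by simp
next
  case False
  note O = sub_ringD[OF sub_ring_local_at[of n]] and m = vanishing_ideal[of n n, OF order_refl]
  obtain a b where ab: "kill n b \<noteq> 0" "w = frc a / frc b" using assms by (rule local_atE)
  have "conj_poly n b \<notin> vanishing n n"
  proof
    assume "conj_poly n b \<in> vanishing n n"
    from m(6)[OF this conj_poly_residue(2)[of n b]] False
    have "res_conj (kill n b) \<in> vanishing n n" by simp
    then have "res_conj (kill n b) = 0" using coeff_field(3) res_conj_in_coeff_field by blast
    then show False using res_conj_injective[OF ab(1)] by simp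
  qed
  then have "inverse (conj_poly n b) \<in> local_at n"
    using conj_poly_residue(1) False by (intro local_at_unit) auto
  then show ?thesis using conj_poly_residue(1)[of n a] False O(5)
    by (simp add: ab(2) conj_ring conj_frc divide_inverse)
qed

section \<open>The real local ring\<close>

definition real_local :: "nat \<Rightarrow> K set" where
  "real_local n = {w \<in> local_at n. conj n w = w}"

lemma sub_ring_real_local: "sub_ring (real_local n)"
  using sub_ringD[OF sub_ring_local_at[of n]]
  by (auto simp: sub_ring_def real_local_def conj_ring)

text \<open>The real part.  It is linear over the fixed ring and maps the complex local ring onto the real one, so
relations with complex coefficients between real elements can be made real.\<close>

definition re_part :: "nat \<Rightarrow> K \<Rightarrow> K" where
  "re_part n w = cst (1 / 2) * (w + conj n w)"

lemma cst_half: "cst (1 / 2) * (w + w) = w"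
proof -
  have "cst (1 / 2) * (w + w) = (cst (1 / 2) + cst (1 / 2)) * w" by (simp add: algebra_simps)
  also have "cst (1 / 2) + cst (1 / 2) = 1" by (simp flip: cst_simps(1,2))
  finally show ?thesis by simp
qed

lemma cst_in_local_at: "cst c \<in> local_at n"
  unfolding cst_def by (rule frc_in_local_at)

lemma re_part_simps:
  "re_part n (u + v) = re_part n u + re_part n v" "conj n s = s \<Longrightarrow> re_part n (u * s) = re_part n u * s"
  "conj n s = s \<Longrightarrow> re_part n s = s" "conj n (re_part n w) = re_part n w"
proof -
  show "conj n s = s \<Longrightarrow> re_part n s = s" unfolding re_part_def by (simp only: cst_half)
qed (simp_all add: re_part_def conj_ring conj_simps conj_conj algebra_simps)

lemma re_part_in_real_local: "w \<in> local_at n \<Longrightarrow> re_part n w \<in> real_local n"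
  unfolding real_local_def
  by (auto simp: re_part_simps re_part_def[of n w] cst_in_local_at conj_in_local_at intro!: sub_ringD[OF sub_ring_local_at])
    (metis re_part_def re_part_simps(4))

lemma re_part_span:
  assumes "F \<subseteq> real_local n" "w \<in> ideal_span (local_at n) F"
  shows "re_part n w \<in> ideal_span (real_local n) F"
  using assms(2)
proof induction
  case zero
  show ?case by (simp add: re_part_def conj_ring ideal_span.zero)
next
  case (step a s b)
  have "conj n s = s" using step(2) assms(1) by (auto simp: real_local_def)
  then show ?case using step re_part_in_real_local[OF step(1)]
    by (auto simp: re_part_simps intro: ideal_span.step)
qed

lemma noeth_real_local: "noeth (real_local n)"
  unfolding noeth_def
proof (intro allI impI)
  fix S assume S: "S \<subseteq> real_local n"
  then have "S \<subseteq> local_at n" by (auto simp: real_local_def)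
  then obtain F where F: "F \<subseteq> S" "finite F" "S \<subseteq> ideal_span (local_at n) F"
    using noeth_local_at unfolding noeth_def by meson
  have "S \<subseteq> ideal_span (real_local n) F"
  proof
    fix s assume s: "s \<in> S"
    then have "re_part n s = s" using S by (intro re_part_simps) (auto simp: real_local_def)
    then show "s \<in> ideal_span (real_local n) F" using re_part_span[of F n s] F S s by auto
  qed
  then show "\<exists>F\<subseteq>S. finite F \<and> S \<subseteq> ideal_span (real_local n) F" using F by blast
qed

lemma vr_X_in_real_local: "vr (Xv j) \<in> real_local n"
  by (simp add: real_local_def conj_simps) (simp add: vr_def frc_in_local_at)

lemma maximal_ideal_span:
  "vanishing n n \<inter> real_local n = ideal_span (real_local n) ((\<lambda>j. vr (Xv j)) ` {..<n})"
proof
  let ?G = "(\<lambda>j. vr (Xv j)) ` {..<n}"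
  have G: "?G \<subseteq> vanishing n n \<inter> real_local n" using vr_X_in_vanishing vr_X_in_real_local by auto
  show "vanishing n n \<inter> real_local n \<subseteq> ideal_span (real_local n) ?G"
  proof
    fix w assume w: "w \<in> vanishing n n \<inter> real_local n"
    then have "re_part n w = w" by (intro re_part_simps) (auto simp: real_local_def)
    moreover have "w \<in> ideal_span (local_at n) ?G" using vanishing_subset_span w by blast
    ultimately show "w \<in> ideal_span (real_local n) ?G" using re_part_span[of ?G n w] G by auto
  qed
  show "ideal_span (real_local n) ?G \<subseteq> vanishing n n \<inter> real_local n"
  proof
    fix w assume "w \<in> ideal_span (real_local n) ?G"
    then show "w \<in> vanishing n n \<inter> real_local n"
    proof induction
      case zero then show ?case using vanishing_ideal(2)[of n n] sub_ringD(2)[OF sub_ring_real_local] by auto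
    next
      case (step a s b)
      then have "s \<in> vanishing n n \<inter> real_local n" using G by blast
      then show ?case using step vanishing_ideal(3,4)[of n n] sub_ringD(4,5)[OF sub_ring_real_local[of n]]
        by (auto simp: real_local_def)
    qed
  qed
qed

lemma inj_vr: "vr v = vr w \<Longrightarrow> v = w"
proof (rule ccontr)
  assume "vr v = vr w" "v \<noteq> w"
  then have "ftranslate w 1 (vr v) = vr v" "ftranslate w 1 (vr v) = vr v + cst 1"
    by (metis ftranslate_simps(3), metis ftranslate_simps(2))
  then show False by (simp add: cst_simps)
qed

lemma vanishing_chain:
  assumes "J < n"
  shows "vanishing n J \<inter> real_local n \<subset> vanishing n (Suc J) \<inter> real_local n"
proof
  show "vanishing n J \<inter> real_local n \<subseteq> vanishing n (Suc J) \<inter> real_local n"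
  proof
    fix w assume w: "w \<in> vanishing n J \<inter> real_local n"
    then obtain a b where ab: "kill n b \<noteq> 0" "kill J a = 0" "w = frc a / frc b" by (auto simp: vanishing_def)
    have "kill (Suc J) a = 0" using kill_kill[of "Suc J" J a] ab(2) by (simp add: kill_ring max_def)
    then show "w \<in> vanishing n (Suc J) \<inter> real_local n" using ab w by (auto simp: vanishing_def)
  qed
  have x: "vr (Xv J) = frc (Vr (Xv J)) / frc 1" by (simp add: vr_def frc_simps)
  have "vr (Xv J) \<in> vanishing n (Suc J)" "vr (Xv J) \<notin> vanishing n J"
    using assms unfolding x by (simp_all add: vanishing_iff kill_ring kill_simps Vr_neq_0)
  then show "vanishing n J \<inter> real_local n \<noteq> vanishing n (Suc J) \<inter> real_local n"
    using vr_X_in_real_local[of J n] by blast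
qed

text \<open>The argument of \<open>no_long_chain\<close> needs relations with coefficients in the complex local ring.  Therefore each prime
of the real ring is replaced by the ideal \<open>Q i\<close> of the complex one that consists of all \<open>w\<close> such that the
real part of every multiple of \<open>w\<close> is in the prime.  A real element outside the prime remains a
nonzerodivisor modulo \<open>Q i\<close>.\<close>

lemma no_long_prime_chain:
  assumes p: "\<And>i. i \<le> Suc n \<Longrightarrow> p i \<subseteq> real_local n" "\<And>i. i \<le> Suc n \<Longrightarrow> 0 \<in> p i"
      "\<And>i a b. i \<le> Suc n \<Longrightarrow> a \<in> p i \<Longrightarrow> b \<in> p i \<Longrightarrow> a - b \<in> p i"
      "\<And>i a b. i \<le> Suc n \<Longrightarrow> a \<in> real_local n \<Longrightarrow> b \<in> p i \<Longrightarrow> a * b \<in> p i"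
      "\<And>i. i \<le> Suc n \<Longrightarrow> 1 \<notin> p i"
      "\<And>i a b. i \<le> Suc n \<Longrightarrow> a \<in> real_local n \<Longrightarrow> b \<in> real_local n \<Longrightarrow> a * b \<in> p i \<Longrightarrow> a \<in> p i \<or> b \<in> p i"
    and chain: "\<And>i. i < Suc n \<Longrightarrow> p i \<subset> p (Suc i)"
  shows False
proof -
  note O = sub_ringD[OF sub_ring_local_at[of n]]
  \<comment> \<open>\<open>Q i\<close> is the extension of \<open>p i\<close> to the complex ring.\<close>
  define Q where "Q i = {w \<in> local_at n. \<forall>c\<in>local_at n. re_part n (c * w) \<in> p i}" for i
  have "\<forall>i\<in>{..<Suc n}. \<exists>y. y \<in> p (Suc i) \<and> y \<notin> p i" using chain by blast
  then obtain y where y: "\<And>i. i < Suc n \<Longrightarrow> y i \<in> p (Suc i) \<and> y i \<notin> p i" by (metis lessThan_iff)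
  have yA: "y i \<in> real_local n" if "i < Suc n" for i using y[OF that] p(1)[of "Suc i"] that by auto
  have re_part_diff: "re_part n (a - b) = re_part n a - re_part n b" for a b
    by (simp add: re_part_def conj_ring algebra_simps)
  show False
  proof (rule no_long_chain[where R = "local_at n" and E = "coeff_field n" and n = n and x = "\<lambda>j. vr (Xv j)"
        and Q = Q and y = y and N = "Suc n"])
    show "a - b \<in> Q i" if "i \<le> Suc n" "a \<in> Q i" "b \<in> Q i" for i a b
      using that p(3) O(6) by (auto simp: Q_def right_diff_distrib re_part_diff)
    show "a * b \<in> Q i" if "i \<le> Suc n" "a \<in> local_at n" "b \<in> Q i" for i a b
      using that O(5) by (auto simp: Q_def simp flip: mult.assoc)
    show "0 \<in> Q 0" using p(2)[of 0] O(2) by (auto simp: Q_def re_part_def conj_ring)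
    show "Q i \<subseteq> Q (Suc i)" if "i < Suc n" for i using chain[OF that] by (auto simp: Q_def)
    show "1 \<notin> Q (Suc n)"
    proof
      assume "1 \<in> Q (Suc n)"
      then have "re_part n (1 * 1) \<in> p (Suc n)" using O(1) by (auto simp: Q_def)
      then show False using p(5)[of "Suc n"] re_part_simps(3)[of n 1] by (simp add: conj_ring)
    qed
    show "y i \<in> local_at n" if "i < Suc n" for i using yA[OF that] by (simp add: real_local_def)
    show "y i \<in> Q (Suc i)" if i: "i < Suc n" for i
    proof -
      have "re_part n (c * y i) \<in> p (Suc i)" if "c \<in> local_at n" for c
        using yA[OF i] y[OF i] p(4)[of "Suc i" "re_part n c" "y i"] re_part_in_real_local[OF that] i
        by (simp add: real_local_def re_part_simps)
      then show ?thesis using yA[OF i] by (simp add: Q_def real_local_def)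
    qed
    show "a \<in> Q i" if i: "i < Suc n" and a: "a \<in> local_at n" "y i * a \<in> Q i" for i a
    proof -
      have "re_part n (c * a) \<in> p i" if c: "c \<in> local_at n" for c
      proof -
        have "re_part n (c * (y i * a)) \<in> p i" using a(2) c by (auto simp: Q_def)
        moreover have "re_part n (c * (y i * a)) = re_part n (c * a) * y i"
          using re_part_simps(2)[of n "y i" "c * a"] yA[OF i] by (simp add: real_local_def mult_ac)
        ultimately show ?thesis
          using p(6)[of i "re_part n (c * a)" "y i"] y[OF i] yA[OF i] re_part_in_real_local[of "c * a" n] O(5)[OF c a(1)] i
          by auto
      qed
      then show ?thesis using a(1) by (simp add: Q_def)
    qed
  qed (use coeff_field local_at_box_fractions sub_ring_local_at in auto)
qed

lemma parts_as_multiples: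
  "val n (RePart v) = cst (1 / 2) * (vr v + conj_var n v)"
  "val n (ImPart v) = cst (1 / (2 * \<i>)) * (vr v - conj_var n v)"
  by (simp_all only: val.simps cst_simps(8) cst_simps(1) times_divide_eq_left mult_1_left)

lemma norm_of_parts:
  "val n (RePart v) * val n (RePart v) + val n (ImPart v) * val n (ImPart v) = vr v * conj_var n v"
proof -
  let ?u = "vr v" and ?v = "conj_var n v"
  have four: "cst 4 = 4"
    using cst_simps(2)[of 1 1] cst_simps(2)[of 2 2] by (simp add: cst_simps(1))
  have "cst 2 * cst 2 = cst 4" "cst (2 * \<i>) * cst (2 * \<i>) = - cst 4"
    by (simp_all flip: cst_simps(3,5))
  then have "val n (RePart v) * val n (RePart v) = (?u + ?v) * (?u + ?v) / cst 4"
    "val n (ImPart v) * val n (ImPart v) = - ((?u - ?v) * (?u - ?v)) / cst 4"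
    by (simp_all only: val.simps times_divide_times_eq) (simp only: divide_minus_right minus_divide_left)
  then have "val n (RePart v) * val n (RePart v) + val n (ImPart v) * val n (ImPart v)
      = ((?u + ?v) * (?u + ?v) - (?u - ?v) * (?u - ?v)) / cst 4"
    by (simp only: add_divide_distrib[symmetric] diff_conv_add_uminus)
  also have "(?u + ?v) * (?u + ?v) - (?u - ?v) * (?u - ?v) = 4 * (?u * ?v)"
    by (simp add: algebra_simps)
  also have "4 * (?u * ?v) / cst 4 = ?u * ?v"
    unfolding four[symmetric] by (rule nonzero_mult_div_cancel_left) (simp add: cst_simps)
  finally show ?thesis .
qed

text \<open>For \<open>y\<close> in the maximal ideal, denoted by \<open>e\<close>, one has \<open>y g\<^sub>e - 1 = u\<^sub>e v\<^sub>e = s\<^sup>2 + t\<^sup>2\<close> by construction, where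
\<open>v\<^sub>e\<close> is the conjugate of \<open>u\<^sub>e\<close> and \<open>s\<close>, \<open>t\<close> are the real and imaginary parts of \<open>u\<^sub>e\<close>.\<close>

lemma divides_one_plus_sos:
  assumes y: "y \<in> real_local n" "y \<noteq> 0"
  shows "\<exists>h\<in>real_local n. \<exists>s\<in>sos (real_local n). y * h = 1 + s"
proof (cases "y \<in> vanishing n n")
  case False
  have "inverse y \<in> real_local n"
    using y False local_at_unit[of y n] by (auto simp: real_local_def conj_ring)
  then show ?thesis using y by (intro bexI[of _ "inverse y"] bexI[of _ 0]) (auto intro: sos.zero)
next
  case True
  have "conj n y = y" using y(1) by (simp add: real_local_def)
  then obtain e where e: "y = val n e" using fixed_is_val by blast
  have f: "factor n (val n e) = y" using True y(2) e by (simp add: factor_def)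
  let ?u = "vr (Uv e)" and ?v = "conj_var n (Uv e)" and ?s = "val n (RePart (Uv e))" and ?t = "val n (ImPart (Uv e))"
  have uv: "?u \<in> local_at n" "?v \<in> local_at n"
    using conj_var_in_local_at(2)[of n e] True f by (auto simp: vr_def frc_in_local_at)
  have "?s \<in> local_at n" "?t \<in> local_at n"
    unfolding parts_as_multiples
    using uv cst_in_local_at by (auto intro!: sub_ringD[OF sub_ring_local_at] simp del: conj_var.simps)
  then have st: "?s \<in> real_local n" "?t \<in> real_local n"
    by (simp_all add: real_local_def conj_val del: val.simps)
  have g: "vr (Gv e) \<in> real_local n" by (simp add: real_local_def conj_simps) (simp add: vr_def frc_in_local_at)
  have "?s * ?s + ?t * ?t = ?u * ?v" by (rule norm_of_parts)
  also have "\<dots> = y * vr (Gv e) - 1" using vr_neq_0[of "Uv e"] f by simp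
  finally have "y * vr (Gv e) = 1 + (?s * ?s + ?t * ?t)" by (simp del: val.simps)
  then show ?thesis using g st
    by (intro bexI[of _ "vr (Gv e)"] bexI[of _ "?s * ?s + ?t * ?t"]) (auto intro!: sos_add sos_square simp del: val.simps)
qed

type_synonym rpoly = "(var \<Rightarrow>\<^sub>0 nat) \<Rightarrow>\<^sub>0 real"

text \<open>Real polynomials evaluated at \<open>x\<^sub>j\<close> and at the real and imaginary parts of \<open>u\<^sub>e\<close>; the variables \<open>Uv e\<close>
and \<open>Gv e\<close> serve as names for the two parts.\<close>

definition parts_eval :: "nat \<Rightarrow> rpoly \<Rightarrow> K" where
  "parts_eval n = peval (\<lambda>r. cst (complex_of_real r))
     (\<lambda>v. case v of Xv j \<Rightarrow> vr v | Uv e \<Rightarrow> val n (RePart (Uv e)) | Gv e \<Rightarrow> val n (ImPart (Uv e)))"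

lemma ring_map_cst_real: "ring_map (\<lambda>r. cst (complex_of_real r))"
  by (rule ring_map_comp[OF ring_map_cst ring_map_of_real])

lemma ring_map_parts_eval: "ring_map (parts_eval n)"
  unfolding parts_eval_def by (rule ring_map_peval[OF ring_map_cst_real])

lemmas parts_eval_ring = ring_mapD[OF ring_map_parts_eval]

lemma parts_eval_simps: "parts_eval n (Cnst r) = cst (complex_of_real r)" "parts_eval n (Vr (Xv j)) = vr (Xv j)"
  "parts_eval n (Vr (Uv e)) = val n (RePart (Uv e))" "parts_eval n (Vr (Gv e)) = val n (ImPart (Uv e))"
  by (simp_all add: parts_eval_def peval_Cnst peval_Vr ring_map_cst_real)

text \<open>Complex polynomials evaluated at \<open>x\<^sub>j\<close>, \<open>u\<^sub>e\<close> and the conjugate of \<open>u\<^sub>e\<close>, for which \<open>Gv e\<close> is the name.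
This substitution is triangular, whereas the one by real and imaginary parts only becomes triangular after
the linear change of variables in \<open>parts_eval_injective\<close>.\<close>

definition pair_eval :: "nat \<Rightarrow> cpoly \<Rightarrow> K" where
  "pair_eval n = peval cst (\<lambda>v. case v of Gv e \<Rightarrow> conj_var n (Uv e) | _ \<Rightarrow> vr v)"

lemma ring_map_pair_eval: "ring_map (pair_eval n)"
  unfolding pair_eval_def by (rule ring_map_peval[OF ring_map_cst])

lemma pair_eval_simps: "pair_eval n (Cnst c) = cst c" "pair_eval n (Vr (Xv j)) = vr (Xv j)"
  "pair_eval n (Vr (Uv e)) = vr (Uv e)" "pair_eval n (Vr (Gv e)) = conj_var n (Uv e)"
  by (simp_all add: pair_eval_def peval_Cnst peval_Vr ring_map_cst)

lemma pair_eval_injective: "p \<noteq> 0 \<Longrightarrow> pair_eval n p \<noteq> 0"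
  unfolding pair_eval_def
proof (rule independent_by_translation[where rank = "\<lambda>v. case v of Gv e \<Rightarrow> Suc (size e) | _ \<Rightarrow> 0"])
  let ?z = "\<lambda>v. case v of Gv e \<Rightarrow> conj_var n (Uv e) | _ \<Rightarrow> vr v"
  let ?r = "\<lambda>v. case v of Gv e \<Rightarrow> Suc (size e) | _ \<Rightarrow> (0::nat)"
  show "ftranslate v i (?z w) = ?z w" if w: "w \<noteq> v" "?r w \<le> ?r v" for v w i
  proof (cases w)
    case (Gv e)
    then obtain e0 where e0: "v = Gv e0" "size e \<le> size e0" using w(2) by (cases v) auto
    then show ?thesis using translate_fixes_factor[of v e0 e] w(1) Gv
      by (simp add: ftr ftranslate_simps)
  qed (use w in \<open>auto simp: ftranslate_simps\<close>)
  show "inj (\<lambda>i. ftranslate v i (?z v))" for v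
  proof (rule injI)
    fix i j assume eq: "ftranslate v i (?z v) = ftranslate v j (?z v)"
    show "i = j"
    proof (cases v)
      case (Gv e)
      then show ?thesis using eq translate_fixes_factor[of v e e]
        by (simp add: ftr ftranslate_simps vr_neq_0 factor_neq_0 inj_cst)
    qed (use eq in \<open>auto simp: ftranslate_simps inj_cst\<close>)
  qed
qed (auto simp: ring_map_cst cst_simps)

lemma real_polynomials_embed:
  "p \<noteq> 0 \<Longrightarrow> peval (\<lambda>r. cst (complex_of_real r)) vr p \<noteq> 0"
  by (rule independent_by_translation[where rank = "\<lambda>_. 0"])
    (auto simp: ring_map_cst_real cst_simps ftranslate_simps inj_cst intro!: injI)

lemma parts_eval_injective:
  assumes "p \<noteq> 0"
  shows "parts_eval n p \<noteq> 0"
proof -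
  \<comment> \<open>\<open>L\<close> is the substitution \<open>s = (u + v) / 2\<close>, \<open>t = (u - v) / (2 \<i>)\<close>, with \<open>Gv e\<close> standing for \<open>v\<close>; \<open>M\<close> undoes
    it.\<close>
  define L :: "rpoly \<Rightarrow> cpoly" where "L = peval (\<lambda>r. Cnst (complex_of_real r))
    (\<lambda>v. case v of Xv j \<Rightarrow> Vr v | Uv e \<Rightarrow> Cnst (1 / 2) * (Vr (Uv e) + Vr (Gv e))
       | Gv e \<Rightarrow> Cnst (1 / (2 * \<i>)) * (Vr (Uv e) - Vr (Gv e)))"
  define M :: "cpoly \<Rightarrow> K" where "M = peval cst
    (\<lambda>v. case v of Xv j \<Rightarrow> vr v | Uv e \<Rightarrow> vr (Uv e) + cst \<i> * vr (Gv e) | Gv e \<Rightarrow> vr (Uv e) - cst \<i> * vr (Gv e))"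
  have h: "ring_map (\<lambda>r. Cnst (complex_of_real r) :: cpoly)"
    by (rule ring_map_comp[OF ring_map_Cnst ring_map_of_real])
  have L: "ring_map L" unfolding L_def by (rule ring_map_peval[OF h])
  have M: "ring_map M" unfolding M_def by (rule ring_map_peval[OF ring_map_cst])
  have L_simps: "L (Cnst r) = Cnst (complex_of_real r)" "L (Vr (Xv j)) = Vr (Xv j)"
    "L (Vr (Uv e)) = Cnst (1 / 2) * (Vr (Uv e) + Vr (Gv e))"
    "L (Vr (Gv e)) = Cnst (1 / (2 * \<i>)) * (Vr (Uv e) - Vr (Gv e))" for r j e
    by (simp_all add: L_def peval_Cnst peval_Vr h)
  have M_simps: "M (Cnst c) = cst c" "M (Vr (Xv j)) = vr (Xv j)"
    "M (Vr (Uv e)) = vr (Uv e) + cst \<i> * vr (Gv e)" "M (Vr (Gv e)) = vr (Uv e) - cst \<i> * vr (Gv e)" for c j e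
    by (simp_all add: M_def peval_Cnst peval_Vr ring_map_cst)
  have "parts_eval n p = pair_eval n (L p)" for p
  proof (rule ring_map_unique[OF ring_map_parts_eval ring_map_comp[OF ring_map_pair_eval L]])
    show "parts_eval n (Vr v) = pair_eval n (L (Vr v))" for v
      by (cases v) (simp_all only: parts_eval_simps L_simps pair_eval_simps ring_mapD[OF ring_map_pair_eval] parts_as_multiples)
  qed (simp add: parts_eval_simps L_simps pair_eval_simps)
  moreover have "M (L p) = peval (\<lambda>r. cst (complex_of_real r)) vr p" for p
  proof (rule ring_map_unique[OF ring_map_comp[OF M L] ring_map_peval[OF ring_map_cst_real]])
    have half: "cst (1 / 2) * (w + w) = w" for w by (rule cst_half)
    have "cst (1 / (2 * \<i>)) * (cst \<i> * w + cst \<i> * w) = w" for w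
    proof -
      have "cst (1 / (2 * \<i>)) * cst \<i> = cst (1 / 2)" by (simp flip: cst_simps(3))
      then show ?thesis using half[of w] by (metis distrib_left mult.assoc)
    qed
    then show "M (L (Vr v)) = peval (\<lambda>r. cst (complex_of_real r)) vr (Vr v)" for v
      using half[of "vr v"]
      by (cases v) (simp_all add: L_simps M_simps ring_mapD[OF M] peval_Vr ring_map_cst_real)
  qed (simp add: L_simps M_simps peval_Cnst ring_map_cst_real)
  ultimately show ?thesis
    using real_polynomials_embed[OF assms] pair_eval_injective[of "L p" n] ring_mapD(4)[OF M] by metis
qed

definition parts_eval_field :: "nat \<Rightarrow> K set" where
  "parts_eval_field n = fractions (range (parts_eval n))"

lemma sub_ring_range_parts_eval: "sub_ring (range (parts_eval n))"
  by (rule sub_ring_image) (auto simp: parts_eval_ring sub_ring_def)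

lemma sub_field_parts_eval_field: "sub_field (parts_eval_field n)"
  unfolding parts_eval_field_def by (rule sub_field_fractions[OF sub_ring_range_parts_eval])

lemma parts_eval_in_parts_eval_field: "parts_eval n p \<in> parts_eval_field n"
  unfolding parts_eval_field_def by (rule fractions_base[OF sub_ring_range_parts_eval]) simp

context
  fixes n :: nat
begin

private lemmas F = sub_fieldD[OF sub_field_parts_eval_field[of n]]
private lemmas R = sub_ringD[OF sub_fieldD(1)[OF sub_field_parts_eval_field[of n]]]

private lemma twice: "2 * w / cst 2 = w"
proof -
  have "2 * w / cst 2 = cst (1 / 2) * (w + w)"
    by (simp only: mult_2 cst_simps(8) cst_simps(1) times_divide_eq_left mult_1_left)
  then show ?thesis by (simp only: cst_half)
qed

text \<open>Only \<open>g\<^sub>e\<close> is not given directly in terms of real and imaginary parts, but \<open>g\<^sub>e = (1 + s\<^sup>2 + t\<^sup>2) / f\<^sub>e\<close>,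
and \<open>f\<^sub>e\<close> is covered by induction.\<close>

lemma val_in_parts_eval_field:
  "val n e \<in> parts_eval_field n" "val n (RePart v) \<in> parts_eval_field n \<and> val n (ImPart v) \<in> parts_eval_field n"
proof (induction e and v)
  case (Const r) then show ?case using parts_eval_in_parts_eval_field[of n "Cnst r"] by (simp add: parts_eval_simps)
  next
    case (Xv j) then show ?case using parts_eval_in_parts_eval_field[of n "Vr (Xv j)"] R(2) by (simp add: parts_eval_simps twice)
  next
    case (Uv e)
    then show ?case using parts_eval_in_parts_eval_field[of n "Vr (Uv e)"] parts_eval_in_parts_eval_field[of n "Vr (Gv e)"]
      by (simp add: parts_eval_simps del: val.simps)
  next
    case (Gv e)
    let ?s = "val n (RePart (Uv e))" and ?t = "val n (ImPart (Uv e))"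
    have st: "?s \<in> parts_eval_field n" "?t \<in> parts_eval_field n"
      using parts_eval_in_parts_eval_field[of n "Vr (Uv e)"] parts_eval_in_parts_eval_field[of n "Vr (Gv e)"] by (simp_all add: parts_eval_simps del: val.simps)
    have f: "factor n (val n e) \<in> parts_eval_field n"
      using Gv parts_eval_in_parts_eval_field[of n "Vr (Xv 0)"] by (auto simp: factor_def parts_eval_simps)
    have eq: "?s * ?s + ?t * ?t = factor n (val n e) * vr (Gv e) - 1"
      unfolding norm_of_parts by (simp add: vr_neq_0)
    have "(1 + (?s * ?s + ?t * ?t)) / factor n (val n e) \<in> parts_eval_field n"
      by (intro F(3) R st f)
    then have "vr (Gv e) \<in> parts_eval_field n" unfolding eq by (simp add: factor_neq_0)
    then show ?case using R(2) by (simp add: twice)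
qed (auto intro!: R F(2))

end

text \<open>Clearing denominators turns a representation of \<open>- 1\<close> into a sum of squares of real polynomials that
vanishes although one of the squared polynomials does not vanish at some real point.\<close>

lemma fixed_field_real: "- 1 \<notin> sos {w. conj n w = w}"
proof
  have "\<exists>q S. q \<noteq> 0 \<and> S \<in> sos UNIV \<and> w * (parts_eval n q * parts_eval n q) = parts_eval n S" if "w \<in> sos {w. conj n w = w}" for w
    using that
  proof induction
    case zero
    show ?case by (intro exI[of _ 1] exI[of _ 0]) (auto simp: parts_eval_ring intro: sos.zero)
  next
    case (step a b)
    have U: "sub_ring (UNIV :: rpoly set)" by (simp add: sub_ring_def)
    obtain q S where qS: "q \<noteq> 0" "S \<in> sos UNIV" "b * (parts_eval n q * parts_eval n q) = parts_eval n S" using step by blast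
    obtain e where "a = val n e" using step fixed_is_val by blast
    then have "a \<in> parts_eval_field n" using val_in_parts_eval_field(1) by simp
    then obtain p r where pr: "parts_eval n r \<noteq> 0" "a = parts_eval n p / parts_eval n r"
      by (auto simp: parts_eval_field_def fractions_def)
    then have ar: "a * parts_eval n r = parts_eval n p" by simp
    have "(a * a + b) * (parts_eval n (q * r) * parts_eval n (q * r))
        = (a * parts_eval n r) * (a * parts_eval n r) * (parts_eval n q * parts_eval n q) + (b * (parts_eval n q * parts_eval n q)) * (parts_eval n r * parts_eval n r)"
      by (simp add: parts_eval_ring algebra_simps)
    also have "\<dots> = parts_eval n ((p * q) * (p * q) + r * r * S)"
      unfolding ar qS(3) by (simp add: parts_eval_ring algebra_simps)
    finally have "(a * a + b) * (parts_eval n (q * r) * parts_eval n (q * r)) = parts_eval n ((p * q) * (p * q) + r * r * S)" .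
    moreover have "(p * q) * (p * q) + r * r * S \<in> sos UNIV"
      using qS by (intro sos_add sos_square sos_square_mult[OF U]) auto
    moreover have "q * r \<noteq> 0" using qS pr(1) parts_eval_ring(4)[of n] by auto
    ultimately show ?case by blast
  qed
  moreover assume "- 1 \<in> sos {w. conj n w = w}"
  ultimately obtain q S where qS: "q \<noteq> 0" "S \<in> sos UNIV" "- 1 * (parts_eval n q * parts_eval n q) = parts_eval n S" by blast
  then have "parts_eval n (q * q + S) = 0" by (simp add: parts_eval_ring flip: qS(3))
  then have 0: "q * q + S = 0" using parts_eval_injective by blast
  obtain z where z: "peval (\<lambda>c. c) z q \<noteq> 0" using nonvanishing_point[OF qS(1)] by blast
  have ev: "ring_map (peval (\<lambda>c::real. c) z)" by (rule ring_map_peval) (simp add: ring_map_def)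
  have "peval (\<lambda>c. c) z S \<ge> 0" using qS(2)
    by induction (auto simp: ring_mapD[OF ev])
  moreover have "peval (\<lambda>c. c) z q * peval (\<lambda>c. c) z q + peval (\<lambda>c. c) z S = 0"
    using arg_cong[OF 0, of "peval (\<lambda>c. c) z"] by (simp add: ring_mapD[OF ev])
  moreover have "peval (\<lambda>c. c) z q * peval (\<lambda>c. c) z q > 0" using z by (simp add: zero_less_mult_iff linorder_neq_iff disj_commute)
  ultimately show False by linarith
qed

section \<open>Rings represented inside a field\<close>

text \<open>An isomorphism \<open>\<phi>\<close> from the ring \<open>S\<close> onto the subring \<open>T\<close> of a field.  Transporting everything along such
maps avoids computations with equivalence classes and cosets.\<close>

definition represents :: "('b \<Rightarrow> 'a::field) \<Rightarrow> ('b, 'm) ring_scheme \<Rightarrow> 'a set \<Rightarrow> bool" where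
  "represents \<phi> S T \<longleftrightarrow> sub_ring T \<and> bij_betw \<phi> (carrier S) T \<and>
     \<one>\<^bsub>S\<^esub> \<in> carrier S \<and> \<zero>\<^bsub>S\<^esub> \<in> carrier S \<and> \<phi> \<one>\<^bsub>S\<^esub> = 1 \<and> \<phi> \<zero>\<^bsub>S\<^esub> = 0 \<and>
     (\<forall>a\<in>carrier S. \<forall>b\<in>carrier S. a \<otimes>\<^bsub>S\<^esub> b \<in> carrier S \<and> a \<oplus>\<^bsub>S\<^esub> b \<in> carrier S \<and>
        \<phi> (a \<otimes>\<^bsub>S\<^esub> b) = \<phi> a * \<phi> b \<and> \<phi> (a \<oplus>\<^bsub>S\<^esub> b) = \<phi> a + \<phi> b)"

lemma representsD:
  assumes "represents \<phi> S T"
  shows "sub_ring T" "\<one>\<^bsub>S\<^esub> \<in> carrier S" "\<zero>\<^bsub>S\<^esub> \<in> carrier S" "\<phi> \<one>\<^bsub>S\<^esub> = 1" "\<phi> \<zero>\<^bsub>S\<^esub> = 0"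
    "a \<in> carrier S \<Longrightarrow> b \<in> carrier S \<Longrightarrow> a \<otimes>\<^bsub>S\<^esub> b \<in> carrier S"
    "a \<in> carrier S \<Longrightarrow> b \<in> carrier S \<Longrightarrow> a \<oplus>\<^bsub>S\<^esub> b \<in> carrier S"
    "a \<in> carrier S \<Longrightarrow> b \<in> carrier S \<Longrightarrow> \<phi> (a \<otimes>\<^bsub>S\<^esub> b) = \<phi> a * \<phi> b"
    "a \<in> carrier S \<Longrightarrow> b \<in> carrier S \<Longrightarrow> \<phi> (a \<oplus>\<^bsub>S\<^esub> b) = \<phi> a + \<phi> b"
    "a \<in> carrier S \<Longrightarrow> \<phi> a \<in> T"
    "t \<in> T \<Longrightarrow> \<exists>a\<in>carrier S. \<phi> a = t"
    "a \<in> carrier S \<Longrightarrow> b \<in> carrier S \<Longrightarrow> \<phi> a = \<phi> b \<longleftrightarrow> a = b"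
  using assms by (auto simp: represents_def bij_betw_def inj_on_def image_iff)

lemma represents_cring:
  assumes r: "represents \<phi> S T"
  shows "cring S"
proof (rule cringI)
  note D = representsD[OF r]
  note cl = D(2,3,6,7)
  have eqI: "a = b" if "a \<in> carrier S" "b \<in> carrier S" "\<phi> a = \<phi> b" for a b
    using D(12) that by blast
  show "abelian_group S"
  proof (rule abelian_groupI)
    fix a assume a: "a \<in> carrier S"
    then obtain b where "b \<in> carrier S" "\<phi> b = - \<phi> a" using D(11) sub_ringD(3)[OF D(1)] D(10) by blast
    then show "\<exists>b\<in>carrier S. b \<oplus>\<^bsub>S\<^esub> a = \<zero>\<^bsub>S\<^esub>"
      using a by (intro bexI[of _ b] eqI) (auto simp: D(5,9) cl)
  qed (auto intro!: eqI simp: cl D(5,9))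
  show "comm_monoid S"
    by (rule comm_monoidI) (auto intro!: eqI simp: cl D(4,8))
qed (auto intro!: representsD(12)[OF r, THEN iffD1] simp: representsD(6-9)[OF r] distrib_right)

lemma represents_uminus:
  assumes r: "represents \<phi> S T" and a: "a \<in> carrier S"
  shows "\<phi> (\<ominus>\<^bsub>S\<^esub> a) = - \<phi> a"
proof -
  interpret cring S by (rule represents_cring[OF r])
  have "\<phi> (\<ominus>\<^bsub>S\<^esub> a) + \<phi> a = \<phi> (\<ominus>\<^bsub>S\<^esub> a \<oplus>\<^bsub>S\<^esub> a)" using a by (simp add: representsD(9)[OF r])
  also have "\<dots> = 0" using a by (simp add: l_neg representsD(5)[OF r])
  finally show ?thesis by (simp add: add_eq_0_iff2)
qed

lemma represents_domain:
  assumes r: "represents \<phi> S T"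
  shows "domain S"
proof -
  note D = representsD[OF r]
  interpret cring S by (rule represents_cring[OF r])
  show ?thesis
  proof
    show "\<one>\<^bsub>S\<^esub> \<noteq> \<zero>\<^bsub>S\<^esub>" using D(4,5) by auto
    fix a b assume "a \<otimes>\<^bsub>S\<^esub> b = \<zero>\<^bsub>S\<^esub>" "a \<in> carrier S" "b \<in> carrier S"
    then show "a = \<zero>\<^bsub>S\<^esub> \<or> b = \<zero>\<^bsub>S\<^esub>" using D(3,5,8,12) by (metis mult_eq_0_iff)
  qed
qed

lemma represents_field:
  assumes r: "represents \<phi> S T" and T: "sub_field T"
  shows "field S"
proof -
  note D = representsD[OF r]
  interpret cring S by (rule represents_cring[OF r])
  show ?thesis
  proof (rule cring_fieldI2)
    show "\<zero>\<^bsub>S\<^esub> \<noteq> \<one>\<^bsub>S\<^esub>" using D(4,5) by auto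
    fix a assume a: "a \<in> carrier S" "a \<noteq> \<zero>\<^bsub>S\<^esub>"
    then have nz: "\<phi> a \<noteq> 0" using D(3,5,12) by metis
    obtain b where b: "b \<in> carrier S" "\<phi> b = inverse (\<phi> a)"
      using D(11)[of "inverse (\<phi> a)"] sub_fieldD(2)[OF T] D(10) a(1) by auto
    then have "a \<otimes>\<^bsub>S\<^esub> b = \<one>\<^bsub>S\<^esub>" using D(12)[of "a \<otimes>\<^bsub>S\<^esub> b" "\<one>\<^bsub>S\<^esub>"] a nz by (simp add: D)
    then show "\<exists>b\<in>carrier S. a \<otimes>\<^bsub>S\<^esub> b = \<one>\<^bsub>S\<^esub>" using b by blast
  qed
qed

text \<open>A fraction is determined by the quotient of the images of numerator and denominator, so the classes of
pairs correspond to the elements of \<open>fractions T\<close>.\<close>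

lemma represents_frac_field:
  assumes r: "represents \<phi> D T"
  shows "\<exists>\<psi>. represents \<psi> (frac_field D) (fractions T) \<and> (\<forall>a\<in>carrier D. \<psi> (to_frac D a) = \<phi> a)"
proof -
  note R = representsD[OF r]
  define cls where "cls y = {(c, d) \<in> frac_pairs D. \<phi> c / \<phi> d = y}" for y
  have nz: "\<phi> d \<noteq> 0" if "(c, d) \<in> frac_pairs D" for c d
    using that R(12)[of d "\<zero>\<^bsub>D\<^esub>"] R(3,5) by (auto simp: frac_pairs_def)
  have frac: "fraction D a b = cls (\<phi> a / \<phi> b)" if ab: "(a, b) \<in> frac_pairs D" for a b
  proof -
    have "a \<otimes>\<^bsub>D\<^esub> d = c \<otimes>\<^bsub>D\<^esub> b \<longleftrightarrow> \<phi> c / \<phi> d = \<phi> a / \<phi> b" if cd: "(c, d) \<in> frac_pairs D" for c d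
    proof -
      have m: "a \<in> carrier D" "b \<in> carrier D" "c \<in> carrier D" "d \<in> carrier D"
        using ab cd by (auto simp: frac_pairs_def)
      have "a \<otimes>\<^bsub>D\<^esub> d = c \<otimes>\<^bsub>D\<^esub> b \<longleftrightarrow> \<phi> a * \<phi> d = \<phi> c * \<phi> b"
        using R(12)[of "a \<otimes>\<^bsub>D\<^esub> d" "c \<otimes>\<^bsub>D\<^esub> b"] m by (simp add: R(6,8))
      also have "\<dots> \<longleftrightarrow> \<phi> c / \<phi> d = \<phi> a / \<phi> b"
        using nz[OF ab] nz[OF cd] by (auto simp: frac_eq_eq)
      finally show ?thesis .
    qed
    then show ?thesis using ab by (auto simp: fraction_def frac_rel_def cls_def)
  qed
  have pair: "\<exists>c d. (c, d) \<in> cls y" if "y \<in> fractions T" for y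
  proof -
    obtain a b where *: "a \<in> T" "b \<in> T" "b \<noteq> 0" "y = a / b" using \<open>y \<in> fractions T\<close> by (auto simp: fractions_def)
    then obtain c d where "c \<in> carrier D" "d \<in> carrier D" "\<phi> c = a" "\<phi> d = b" using R(11) by metis
    moreover have "d \<noteq> \<zero>\<^bsub>D\<^esub>" using * \<open>\<phi> d = b\<close> R(5) by auto
    ultimately show ?thesis using * by (intro exI[of _ c] exI[of _ d]) (simp add: cls_def frac_pairs_def)
  qed
  have car: "carrier (frac_field D) = cls ` fractions T"
  proof
    show "carrier (frac_field D) \<subseteq> cls ` fractions T"
    proof
      fix U assume "U \<in> carrier (frac_field D)"
      then obtain a b where ab: "(a, b) \<in> frac_pairs D" "U = fraction D a b"
        by (auto simp: frac_field_def fraction_def elim!: quotientE)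
      then have "\<phi> a / \<phi> b \<in> fractions T"
        using nz[OF ab(1)] R(10) by (intro fractionsI) (auto simp: frac_pairs_def)
      then show "U \<in> cls ` fractions T" using ab frac by blast
    qed
    show "cls ` fractions T \<subseteq> carrier (frac_field D)"
    proof
      fix U assume "U \<in> cls ` fractions T"
      then obtain y where y: "y \<in> fractions T" "U = cls y" by blast
      obtain c d where cd: "(c, d) \<in> cls y" using pair[OF y(1)] by blast
      then have "(c, d) \<in> frac_pairs D" "U = fraction D c d" using frac[of c d] y(2) by (auto simp: cls_def)
      then show "U \<in> carrier (frac_field D)"
        by (auto simp: frac_field_def fraction_def intro: quotientI)
    qed
  qed
  define \<psi> where "\<psi> U = (THE y. y \<in> fractions T \<and> U = cls y)" for U
  have \<psi>: "\<psi> (cls y) = y" if y: "y \<in> fractions T" for y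
    unfolding \<psi>_def
  proof (rule the_equality)
    fix z assume "z \<in> fractions T \<and> cls y = cls z"
    moreover obtain c d where "(c, d) \<in> cls y" using pair[OF y] by blast
    ultimately show "z = y" by (auto simp: cls_def)
  qed (use y in simp)
  have ops: "cls y \<otimes>\<^bsub>frac_field D\<^esub> cls z = cls (y * z)" "cls y \<oplus>\<^bsub>frac_field D\<^esub> cls z = cls (y + z)"
    if yz: "y \<in> fractions T" "z \<in> fractions T" for y z
  proof -
    have *: "fraction D (a \<otimes>\<^bsub>D\<^esub> c) (b \<otimes>\<^bsub>D\<^esub> d) = cls (y * z)"
      "fraction D (a \<otimes>\<^bsub>D\<^esub> d \<oplus>\<^bsub>D\<^esub> c \<otimes>\<^bsub>D\<^esub> b) (b \<otimes>\<^bsub>D\<^esub> d) = cls (y + z)"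
      if ab: "(a, b) \<in> cls y" and cd: "(c, d) \<in> cls z" for a b c d
    proof -
      have p: "(a, b) \<in> frac_pairs D" "(c, d) \<in> frac_pairs D" and y: "y = \<phi> a / \<phi> b" and z: "z = \<phi> c / \<phi> d"
        using ab cd by (auto simp: cls_def)
      have m: "a \<in> carrier D" "b \<in> carrier D" "c \<in> carrier D" "d \<in> carrier D"
        using p by (auto simp: frac_pairs_def)
      have "\<phi> (b \<otimes>\<^bsub>D\<^esub> d) \<noteq> 0" using nz p m by (simp add: R(8))
      then have "b \<otimes>\<^bsub>D\<^esub> d \<noteq> \<zero>\<^bsub>D\<^esub>" using R(5) by metis
      then have q: "(a \<otimes>\<^bsub>D\<^esub> c, b \<otimes>\<^bsub>D\<^esub> d) \<in> frac_pairs D"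
        "(a \<otimes>\<^bsub>D\<^esub> d \<oplus>\<^bsub>D\<^esub> c \<otimes>\<^bsub>D\<^esub> b, b \<otimes>\<^bsub>D\<^esub> d) \<in> frac_pairs D"
        using m by (auto simp: frac_pairs_def R(6,7))
      show "fraction D (a \<otimes>\<^bsub>D\<^esub> c) (b \<otimes>\<^bsub>D\<^esub> d) = cls (y * z)"
        using m by (simp add: frac[OF q(1)] y z R(8))
      have "\<phi> (a \<otimes>\<^bsub>D\<^esub> d \<oplus>\<^bsub>D\<^esub> c \<otimes>\<^bsub>D\<^esub> b) / \<phi> (b \<otimes>\<^bsub>D\<^esub> d) = y + z"
        using m nz[OF p(1)] nz[OF p(2)] by (simp add: y z R(6-9) add_frac_eq)
      then show "fraction D (a \<otimes>\<^bsub>D\<^esub> d \<oplus>\<^bsub>D\<^esub> c \<otimes>\<^bsub>D\<^esub> b) (b \<otimes>\<^bsub>D\<^esub> d) = cls (y + z)"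
        by (simp only: frac[OF q(2)])
    qed
    obtain p where p: "p \<in> cls y" using pair[OF yz(1)] by blast
    obtain q where q: "q \<in> cls z" using pair[OF yz(2)] by blast
    have const: "(\<Union>(a, b)\<in>cls y. \<Union>(c, d)\<in>cls z. f a b c d) = W"
      if f: "\<And>a b c d. (a, b) \<in> cls y \<Longrightarrow> (c, d) \<in> cls z \<Longrightarrow> f a b c d = W" for f W
    proof -
      have "(\<Union>(a, b)\<in>cls y. \<Union>(c, d)\<in>cls z. f a b c d) = (\<Union>_\<in>cls y. \<Union>_\<in>cls z. W)"
        by (intro SUP_cong refl) (auto simp: f split: prod.splits)
      then show ?thesis using p q by auto
    qed
    show "cls y \<otimes>\<^bsub>frac_field D\<^esub> cls z = cls (y * z)"
      unfolding frac_field_def by simp (rule const[OF *(1)])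
    show "cls y \<oplus>\<^bsub>frac_field D\<^esub> cls z = cls (y + z)"
      unfolding frac_field_def by simp (rule const[OF *(2)])
  qed
  note F = sub_fieldD(1)[OF sub_field_fractions[OF R(1)]]
  note F' = sub_ringD[OF F]
  have "\<one>\<^bsub>D\<^esub> \<noteq> \<zero>\<^bsub>D\<^esub>" using R(4,5) by auto
  then have unit: "fraction D a \<one>\<^bsub>D\<^esub> = cls (\<phi> a)" "\<phi> a \<in> fractions T" if "a \<in> carrier D" for a
    using that frac[of a "\<one>\<^bsub>D\<^esub>"] R(2,4) R(10)[OF that] fractionsI[of "\<phi> a" T 1] sub_ringD(1)[OF R(1)]
    by (auto simp: frac_pairs_def)
  have one: "\<one>\<^bsub>frac_field D\<^esub> = cls 1" and zero: "\<zero>\<^bsub>frac_field D\<^esub> = cls 0"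
    using unit(1)[OF R(2)] unit(1)[OF R(3)] R(4,5) by (simp_all add: frac_field_def)
  have "bij_betw \<psi> (carrier (frac_field D)) (fractions T)"
    unfolding car by (rule bij_betw_byWitness[where f' = cls]) (auto simp: \<psi>)
  then have "represents \<psi> (frac_field D) (fractions T)"
    unfolding represents_def using F F' by (auto simp: car one zero ops \<psi>)
  moreover have "\<psi> (to_frac D a) = \<phi> a" if "a \<in> carrier D" for a
    using unit[OF that] by (simp add: to_frac_def \<psi>)
  ultimately show ?thesis by blast
qed

lemma represents_ordering:
  assumes r: "represents \<psi> S T" and P: "positive_cone T P"
  shows "field_ordering S {(a, b) \<in> carrier S \<times> carrier S. \<psi> b - \<psi> a \<in> P}"
proof -
  note R = representsD[OF r] and T = sub_ringD[OF representsD(1)[OF r]]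
  have P': "\<And>a b. a \<in> P \<Longrightarrow> b \<in> P \<Longrightarrow> a + b \<in> P" "\<And>a b. a \<in> P \<Longrightarrow> b \<in> P \<Longrightarrow> a * b \<in> P"
    "\<And>a. a \<in> T \<Longrightarrow> a \<in> P \<or> - a \<in> P" "\<And>a. a \<in> P \<Longrightarrow> - a \<in> P \<Longrightarrow> a = 0"
    using P unfolding positive_cone_def by blast+
  have 0: "0 \<in> P" using P'(3)[OF T(2)] by simp
  let ?r = "{(a, b) \<in> carrier S \<times> carrier S. \<psi> b - \<psi> a \<in> P}"
  have "trans ?r"
  proof (rule transI)
    fix a b c assume *: "(a, b) \<in> ?r" "(b, c) \<in> ?r"
    then have "(\<psi> b - \<psi> a) + (\<psi> c - \<psi> b) \<in> P" by (intro P'(1)) auto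
    then show "(a, c) \<in> ?r" using * by auto
  qed
  moreover have "antisym ?r"
  proof (rule antisymI)
    fix a b assume *: "(a, b) \<in> ?r" "(b, a) \<in> ?r"
    then have "\<psi> b - \<psi> a = 0" by (intro P'(4)) auto
    then show "a = b" using * R(12)[of a b] by auto
  qed
  moreover have "total_on (carrier S) ?r"
  proof (rule total_onI)
    fix a b assume *: "a \<in> carrier S" "b \<in> carrier S"
    then have "\<psi> b - \<psi> a \<in> P \<or> - (\<psi> b - \<psi> a) \<in> P" by (intro P'(3) T(6) R(10))
    then show "(a, b) \<in> ?r \<or> (b, a) \<in> ?r" using * by auto
  qed
  moreover have "refl_on (carrier S) ?r" by (auto simp: refl_on_def 0)
  ultimately have "linear_order_on (carrier S) ?r"
    by (auto simp: linear_order_on_def partial_order_on_def preorder_on_def)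
  moreover have "(a \<oplus>\<^bsub>S\<^esub> c, b \<oplus>\<^bsub>S\<^esub> c) \<in> ?r" if "a \<in> carrier S" "b \<in> carrier S" "c \<in> carrier S" "(a, b) \<in> ?r" for a b c
    using that by (auto simp: R)
  moreover have "(\<zero>\<^bsub>S\<^esub>, a \<otimes>\<^bsub>S\<^esub> b) \<in> ?r"
    if "a \<in> carrier S" "b \<in> carrier S" "(\<zero>\<^bsub>S\<^esub>, a) \<in> ?r" "(\<zero>\<^bsub>S\<^esub>, b) \<in> ?r" for a b
    using that P'(2) by (auto simp: R)
  ultimately show ?thesis unfolding field_ordering_def by blast
qed

lemma represents_quotient_zero:
  assumes r: "represents \<phi> S T"
  shows "represents (\<lambda>U. \<phi> (the_elem U)) (S Quot {\<zero>\<^bsub>S\<^esub>}) T"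
    "a \<in> carrier S \<Longrightarrow> {\<zero>\<^bsub>S\<^esub>} +>\<^bsub>S\<^esub> a = {a}"
proof -
  note R = representsD[OF r]
  interpret cring S by (rule represents_cring[OF r])
  show c: "{\<zero>\<^bsub>S\<^esub>} +>\<^bsub>S\<^esub> a = {a}" if "a \<in> carrier S" for a
    using that by (simp add: a_r_coset_def')
  have car: "carrier (S Quot {\<zero>\<^bsub>S\<^esub>}) = (\<lambda>a. {a}) ` carrier S"
    by (auto simp: FactRing_def A_RCOSETS_def' c image_iff simp flip: a_r_coset_def')
  have "bij_betw (\<lambda>U. \<phi> (the_elem U)) (carrier (S Quot {\<zero>\<^bsub>S\<^esub>})) T"
    using r unfolding car represents_def bij_betw_def by (auto simp: inj_on_def image_image)
  then show "represents (\<lambda>U. \<phi> (the_elem U)) (S Quot {\<zero>\<^bsub>S\<^esub>}) T"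
    unfolding represents_def car
    by (auto simp: R FactRing_def c rcoset_mult_def set_add_def' image_iff)
qed

section \<open>A copy with real numbers as elements\<close>

text \<open>The injection \<open>j\<close> is an arbitrary numbering of the elements of \<open>A\<close> by real numbers, along which the ring
structure is transported; \<open>\<iota>\<close> embeds the scalars.\<close>

locale real_copy =
  fixes A :: "'a::field set" and j :: "'a \<Rightarrow> real" and \<iota> :: "real \<Rightarrow> 'a"
  assumes A: "sub_ring A" and inj: "inj_on j A" and scalars: "ring_map \<iota>" "range \<iota> \<subseteq> A"
begin

abbreviation "i \<equiv> inv_into A j"

definition R :: "(real, real) module" where
  "R = \<lparr>carrier = j ` A, monoid.mult = (\<lambda>a b. j (i a * i b)), one = j 1, ring.zero = j 0,
     add = (\<lambda>a b. j (i a + i b)), module.smult = (\<lambda>r a. j (\<iota> r * i a))\<rparr>"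

lemma i_j: "a \<in> A \<Longrightarrow> i (j a) = a"
  by (rule inv_into_f_f[OF inj])

lemma i_in: "x \<in> carrier R \<Longrightarrow> i x \<in> A"
  by (auto simp: R_def i_j)

lemma j_i: "x \<in> carrier R \<Longrightarrow> j (i x) = x"
  by (auto simp: R_def i_j)

lemma j_in: "a \<in> A \<Longrightarrow> j a \<in> carrier R"
  by (simp add: R_def)

lemma represents_R: "represents i R A"
proof -
  have "bij_betw i (carrier R) A"
    by (rule bij_betw_byWitness[where f' = j]) (auto simp: i_j j_i i_in j_in)
  then show ?thesis
    unfolding represents_def using A sub_ringD[OF A]
    by (auto simp: R_def i_j)
qed

lemmas rep = representsD[OF represents_R]

lemma j_ops: "a \<in> A \<Longrightarrow> b \<in> A \<Longrightarrow> j a \<otimes>\<^bsub>R\<^esub> j b = j (a * b)"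
  "a \<in> A \<Longrightarrow> b \<in> A \<Longrightarrow> j a \<oplus>\<^bsub>R\<^esub> j b = j (a + b)" "\<one>\<^bsub>R\<^esub> = j 1" "\<zero>\<^bsub>R\<^esub> = j 0"
  by (simp_all add: R_def i_j)

lemma cring_R: "cring R"
  by (rule represents_cring[OF represents_R])

sublocale cring R
  by (rule cring_R)

lemma algebra_R: "algebra (ring_of_type_algebra :: real ring) R"
proof (rule algebraI[OF _ cring_R])
  show "cring (ring_of_type_algebra :: real ring)" by (rule cring_from_type_algebra)
  note S = sub_ringD[OF A] and h = ring_mapD[OF scalars(1)]
  have sm: "r \<odot>\<^bsub>R\<^esub> x = j (\<iota> r * i x)" for r x by (simp add: R_def)
  have c: "\<iota> r * i x \<in> A" if "x \<in> carrier R" for r x using that scalars(2) i_in S(5) by blast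
  fix r s x y
  assume [simp]: "x \<in> carrier R" and [simp]: "y \<in> carrier R"
  have x: "i x \<in> A" and y: "i y \<in> A" by (simp_all add: i_in)
  show "r \<odot>\<^bsub>R\<^esub> x \<in> carrier R" by (simp add: sm j_in c)
  show "(r \<oplus>\<^bsub>ring_of_type_algebra\<^esub> s) \<odot>\<^bsub>R\<^esub> x = r \<odot>\<^bsub>R\<^esub> x \<oplus>\<^bsub>R\<^esub> s \<odot>\<^bsub>R\<^esub> x"
    by (simp add: ring_of_type_algebra_def sm j_ops c h distrib_right)
  show "r \<odot>\<^bsub>R\<^esub> (x \<oplus>\<^bsub>R\<^esub> y) = r \<odot>\<^bsub>R\<^esub> x \<oplus>\<^bsub>R\<^esub> r \<odot>\<^bsub>R\<^esub> y"
    by (simp add: sm j_ops c rep(9) distrib_left)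
  show "(r \<otimes>\<^bsub>ring_of_type_algebra\<^esub> s) \<odot>\<^bsub>R\<^esub> x = r \<odot>\<^bsub>R\<^esub> (s \<odot>\<^bsub>R\<^esub> x)"
    by (simp add: ring_of_type_algebra_def sm i_j c h mult.assoc)
  show "\<one>\<^bsub>ring_of_type_algebra\<^esub> \<odot>\<^bsub>R\<^esub> x = x"
    by (simp add: ring_of_type_algebra_def sm h j_i)
  show "r \<odot>\<^bsub>R\<^esub> x \<otimes>\<^bsub>R\<^esub> y = r \<odot>\<^bsub>R\<^esub> (x \<otimes>\<^bsub>R\<^esub> y)"
    using j_ops(1)[OF c[of x r] y] by (simp add: sm rep(8) j_i mult.assoc)
qed

lemma ideal_copy:
  assumes "I \<subseteq> A" "0 \<in> I" "\<And>a b. a \<in> I \<Longrightarrow> b \<in> I \<Longrightarrow> a - b \<in> I" "\<And>a b. a \<in> A \<Longrightarrow> b \<in> I \<Longrightarrow> a * b \<in> I"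
  shows "ideal (j ` I) R"
proof (rule idealI)
  show "ring R" by (rule ring_axioms)
  have neg: "- a \<in> I" if "a \<in> I" for a using assms(3)[OF assms(2) that] by simp
  have plus: "a + b \<in> I" if "a \<in> I" "b \<in> I" for a b using assms(3)[OF that(1) neg[OF that(2)]] by simp
  show "subgroup (j ` I) (add_monoid R)"
  proof (rule add.subgroupI)
    show "j ` I \<subseteq> carrier R" using assms(1) j_in by auto
    show "j ` I \<noteq> {}" using assms(2) by auto
    show "\<ominus>\<^bsub>R\<^esub> x \<in> j ` I" if x: "x \<in> j ` I" for x
    proof -
      obtain a where a: "a \<in> I" "x = j a" using x by auto
      then have "i (\<ominus>\<^bsub>R\<^esub> x) = - a" using assms(1) represents_uminus[OF represents_R, of x] by (auto simp: i_j j_in)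
      then have "\<ominus>\<^bsub>R\<^esub> x = j (- a)" using a assms(1) j_i[of "\<ominus>\<^bsub>R\<^esub> x"] by (auto simp: j_in)
      then show ?thesis using neg[OF a(1)] by simp
    qed
    show "x \<oplus>\<^bsub>R\<^esub> y \<in> j ` I" if "x \<in> j ` I" "y \<in> j ` I" for x y
      using that plus assms(1) by (auto simp: j_ops subset_iff)
  qed
  show l: "y \<otimes>\<^bsub>R\<^esub> x \<in> j ` I" if xy: "x \<in> j ` I" "y \<in> carrier R" for x y
  proof -
    obtain a where a: "a \<in> I" "x = j a" using xy(1) by auto
    then have "y \<otimes>\<^bsub>R\<^esub> x = j (i y * a)" using assms(1) by (auto simp: R_def i_j)
    then show ?thesis using assms(4)[OF i_in[OF xy(2)] a(1)] by simp
  qed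
  show "x \<otimes>\<^bsub>R\<^esub> y \<in> j ` I" if "x \<in> j ` I" "y \<in> carrier R" for x y
    using l[OF that] m_comm[of x y] that assms(1) j_in by auto
qed

lemma ideal_image:
  assumes "ideal I R"
  shows "i ` I \<subseteq> A" "0 \<in> i ` I" "a \<in> i ` I \<Longrightarrow> b \<in> i ` I \<Longrightarrow> a - b \<in> i ` I"
    "c \<in> A \<Longrightarrow> a \<in> i ` I \<Longrightarrow> c * a \<in> i ` I" "I = j ` i ` I" "a \<in> i ` I \<longleftrightarrow> a \<in> A \<and> j a \<in> I"
proof -
  interpret ideal I R by fact
  have sub: "x \<in> carrier R" if "x \<in> I" for x using a_subset that by blast
  show iA: "i ` I \<subseteq> A" using sub i_in by blast
  show IJ: "I = j ` i ` I" using sub j_i by (force simp: image_image)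
  show mem: "a \<in> i ` I \<longleftrightarrow> a \<in> A \<and> j a \<in> I" for a
    using iA sub j_i i_j by (auto intro: image_eqI[of _ _ "j a"])
  show "0 \<in> i ` I" using zero_closed sub_ringD(2)[OF A] unfolding mem by (simp add: j_ops(4))
  show "a - b \<in> i ` I" if ab: "a \<in> i ` I" "b \<in> i ` I"
  proof -
    have m: "a \<in> A" "b \<in> A" "j a \<in> I" "j b \<in> I" using ab unfolding mem by auto
    have "j a \<oplus>\<^bsub>R\<^esub> \<ominus>\<^bsub>R\<^esub> j b \<in> I" using m by (intro a_closed a_inv_closed)
    moreover have "i (j a \<oplus>\<^bsub>R\<^esub> \<ominus>\<^bsub>R\<^esub> j b) = a - b"
      using m by (simp add: rep(9) represents_uminus[OF represents_R] i_j j_in)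
    ultimately show ?thesis by (metis image_eqI)
  qed
  show "c * a \<in> i ` I" if c: "c \<in> A" and a: "a \<in> i ` I"
  proof -
    have m: "a \<in> A" "j a \<in> I" using a unfolding mem by auto
    have "j c \<otimes>\<^bsub>R\<^esub> j a \<in> I" using m c by (intro I_l_closed j_in)
    then show ?thesis unfolding mem using m c by (simp add: j_ops sub_ringD(5)[OF A])
  qed
qed

lemma ideal_generated:
  assumes F: "F \<subseteq> A" and I: "ideal I R" "i ` I = ideal_span A F"
  shows "I = Idl\<^bsub>R\<^esub> (j ` F)"
proof
  have jF: "j ` F \<subseteq> carrier R" using F j_in by auto
  have "F \<subseteq> i ` I" unfolding I(2) using ideal_span_base[OF A] by blast
  then have "j ` F \<subseteq> I" using ideal_image(6)[OF I(1)] by auto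
  then show "Idl\<^bsub>R\<^esub> (j ` F) \<subseteq> I" by (rule genideal_minimal[OF I(1)])
  interpret J: ideal "Idl\<^bsub>R\<^esub> (j ` F)" R by (rule genideal_ideal[OF jF])
  have "w \<in> A \<and> j w \<in> Idl\<^bsub>R\<^esub> (j ` F)" if "w \<in> ideal_span A F" for w
    using that
  proof induction
    case zero
    then show ?case using J.zero_closed sub_ringD(2)[OF A] by (simp add: j_ops(4))
  next
    case (step a s b)
    have s: "s \<in> A" using step(2) F by auto
    have "j a \<otimes>\<^bsub>R\<^esub> j s \<oplus>\<^bsub>R\<^esub> j b \<in> Idl\<^bsub>R\<^esub> (j ` F)"
      using step genideal_self[OF jF] by (intro J.a_closed J.I_l_closed j_in) auto
    then show ?case using step s by (simp add: j_ops sub_ringD(4,5)[OF A])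
  qed
  then show "I \<subseteq> Idl\<^bsub>R\<^esub> (j ` F)"
    using ideal_image(5)[OF I(1)] unfolding I(2) by auto
qed

lemma noetherian_R:
  assumes "noeth A"
  shows "noetherian_ring R"
proof (rule noetherian_ringI)
  fix I assume I: "ideal I R"
  obtain F where F: "F \<subseteq> i ` I" "finite F" "i ` I \<subseteq> ideal_span A F"
    using assms ideal_image(1)[OF I] unfolding noeth_def by meson
  have FA: "F \<subseteq> A" using F(1) ideal_image(1)[OF I] by blast
  have "w \<in> i ` I" if "w \<in> ideal_span A F" for w
    using that
  proof induction
    case zero show ?case by (rule ideal_image(2)[OF I])
  next
    case (step a s b)
    have "a * s \<in> i ` I" using step F(1) by (intro ideal_image(4)[OF I]) auto
    moreover have "- b \<in> i ` I" using ideal_image(3)[OF I ideal_image(2)[OF I] step.IH] by simp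
    ultimately show ?case using ideal_image(3)[OF I, of "a * s" "- b"] by simp
  qed
  then have "i ` I = ideal_span A F" using F(3) by blast
  then have "I = Idl\<^bsub>R\<^esub> (j ` F)" by (rule ideal_generated[OF FA I])
  then show "\<exists>B\<subseteq>carrier R. finite B \<and> I = Idl\<^bsub>R\<^esub> B"
    using F(2) FA j_in by (intro exI[of _ "j ` F"]) auto
qed

lemma prime_copy:
  assumes "I \<subseteq> A" "0 \<in> I" "\<And>a b. a \<in> I \<Longrightarrow> b \<in> I \<Longrightarrow> a - b \<in> I" "\<And>a b. a \<in> A \<Longrightarrow> b \<in> I \<Longrightarrow> a * b \<in> I"
    and "1 \<notin> I" and prime: "\<And>a b. a \<in> A \<Longrightarrow> b \<in> A \<Longrightarrow> a * b \<in> I \<Longrightarrow> a \<in> I \<or> b \<in> I"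
  shows "primeideal (j ` I) R"
proof (rule primeidealI[OF ideal_copy[OF assms(1-4)] cring_R])
  have mem: "a \<in> I" if "a \<in> A" "j a \<in> j ` I" for a
    using that assms(1) inj by (auto simp: inj_on_def)
  show "carrier R \<noteq> j ` I"
    using mem[OF sub_ringD(1)[OF A]] assms(5) j_in[OF sub_ringD(1)[OF A]] by auto
  fix x y assume *: "x \<in> carrier R" "y \<in> carrier R" "x \<otimes>\<^bsub>R\<^esub> y \<in> j ` I"
  have "j (i x * i y) \<in> j ` I" using *(3) by (simp add: R_def)
  then have "i x * i y \<in> I" using *(1,2) i_in by (intro mem sub_ringD(5)[OF A])
  then have "i x \<in> I \<or> i y \<in> I" using *(1,2) i_in prime by blast
  then show "x \<in> j ` I \<or> y \<in> j ` I" using *(1,2) j_i by (metis image_eqI)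
qed

lemma prime_image:
  assumes "primeideal p R"
  shows "1 \<notin> i ` p" "a \<in> A \<Longrightarrow> b \<in> A \<Longrightarrow> a * b \<in> i ` p \<Longrightarrow> a \<in> i ` p \<or> b \<in> i ` p"
proof -
  interpret primeideal p R by fact
  note mem = ideal_image(6)[OF is_ideal]
  show "1 \<notin> i ` p"
    using one_imp_carrier I_notcarr unfolding mem by (auto simp: j_ops(3))
  show "a \<in> i ` p \<or> b \<in> i ` p" if "a \<in> A" "b \<in> A" "a * b \<in> i ` p"
    using that I_prime[of "j a" "j b"] unfolding mem by (simp add: j_ops j_in)
qed

lemma sum_of_squares_copy:
  assumes "w \<in> sos A"
  shows "w \<in> A \<and> sum_of_squares R (j w)"
  using assms
proof induction
  case zero
  show ?case using sub_ringD(2)[OF A] unfolding sum_of_squares_def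
    by (auto simp: j_ops(4) intro!: exI[of _ 0])
next
  case (step a b)
  obtain k :: nat and g where g: "g \<in> {..<k} \<rightarrow> carrier R" "j b = (\<Oplus>\<^bsub>R\<^esub>l\<in>{..<k}. g l \<otimes>\<^bsub>R\<^esub> g l)"
    using step.IH unfolding sum_of_squares_def by blast
  let ?g = "g(k := j a)"
  have ja: "j a \<in> carrier R" using step j_in by simp
  have "(\<Oplus>\<^bsub>R\<^esub>l\<in>{..<Suc k}. ?g l \<otimes>\<^bsub>R\<^esub> ?g l) = (j a \<otimes>\<^bsub>R\<^esub> j a) \<oplus>\<^bsub>R\<^esub> (\<Oplus>\<^bsub>R\<^esub>l\<in>{..<k}. ?g l \<otimes>\<^bsub>R\<^esub> ?g l)"
    unfolding lessThan_Suc using g(1) ja by (subst finsum_insert) (auto simp: Pi_iff)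
  also have "(\<Oplus>\<^bsub>R\<^esub>l\<in>{..<k}. ?g l \<otimes>\<^bsub>R\<^esub> ?g l) = j b"
    unfolding g(2) using g(1) by (intro finsum_cong') (auto simp: Pi_iff)
  also have "(j a \<otimes>\<^bsub>R\<^esub> j a) \<oplus>\<^bsub>R\<^esub> j b = j (a * a + b)"
    using step by (simp add: j_ops sub_ringD(5)[OF A])
  finally have "j (a * a + b) = (\<Oplus>\<^bsub>R\<^esub>l\<in>{..<Suc k}. ?g l \<otimes>\<^bsub>R\<^esub> ?g l)" by (rule sym)
  moreover have "?g \<in> {..<Suc k} \<rightarrow> carrier R" using g(1) ja by (auto simp: less_Suc_eq)
  ultimately show ?case
    using step sub_ringD(4,5)[OF A] unfolding sum_of_squares_def by blast
qed

lemma clear_denominators: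
  assumes "w \<in> sos (fractions A)"
  shows "\<exists>d\<in>A. d \<noteq> 0 \<and> d * d * w \<in> sos A"
  using assms
proof induction
  case zero
  show ?case using sub_ringD(1)[OF A] by (intro bexI[of _ 1]) (auto intro: sos.zero)
next
  case (step u w)
  obtain d where d: "d \<in> A" "d \<noteq> 0" "d * d * w \<in> sos A" using step.IH by blast
  obtain a b where ab: "a \<in> A" "b \<in> A" "b \<noteq> 0" "u = a / b" using step(1) by (auto simp: fractions_def)
  have "(d * b) * (d * b) * (u * u + w) = (d * a) * (d * a) + b * b * (d * d * w)"
    using ab by (simp add: algebra_simps)
  also have "\<dots> \<in> sos A"
    by (rule sos_add[OF sos_square[OF sub_ringD(5)[OF A d(1) ab(1)]] sos_square_mult[OF A ab(2) d(3)]])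
  finally show ?case
    using d ab by (intro bexI[of _ "d * b"]) (auto intro: sub_ringD[OF A])
qed

text \<open>The zero ideal is prime, and an ordering of the ambient fraction field becomes an ordering of the fraction
field of the quotient by it.\<close>

lemma psd_imp_sos_fractions:
  assumes two: "(2::'a) \<noteq> 0" and f: "positive_semidefinite R f"
  shows "i f \<in> sos (fractions A)"
proof (rule ccontr)
  assume neg: "i f \<notin> sos (fractions A)"
  have fR: "f \<in> carrier R" using f by (simp add: positive_semidefinite_def)
  note sf = sub_field_fractions[OF A]
  have "i f \<in> fractions A" using fractionsI[of "i f" A 1] sub_ringD(1)[OF A] i_in[OF fR] by simp
  then obtain P where P: "positive_cone (fractions A) P" "i f \<notin> P"
    using artin[OF sf two _ neg] by blast
  interpret D: domain R by (rule represents_domain[OF represents_R])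
  let ?D = "R Quot {\<zero>\<^bsub>R\<^esub>}"
  note q = represents_quotient_zero[OF represents_R]
  obtain \<psi> where \<psi>: "represents \<psi> (frac_field ?D) (fractions A)"
    "\<And>U. U \<in> carrier ?D \<Longrightarrow> \<psi> (to_frac ?D U) = i (the_elem U)"
    using represents_frac_field[OF q(1)] by blast
  have "{\<zero>\<^bsub>R\<^esub>} +>\<^bsub>R\<^esub> f \<in> carrier ?D"
    using fR by (auto simp: FactRing_def A_RCOSETS_def')
  then have \<psi>f: "\<psi> (to_frac ?D ({\<zero>\<^bsub>R\<^esub>} +>\<^bsub>R\<^esub> f)) = i f"
    using \<psi>(2) q(2)[OF fR] by simp
  have "(\<zero>\<^bsub>frac_field ?D\<^esub>, to_frac ?D ({\<zero>\<^bsub>R\<^esub>} +>\<^bsub>R\<^esub> f))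
      \<in> {(a, b) \<in> carrier (frac_field ?D) \<times> carrier (frac_field ?D). \<psi> b - \<psi> a \<in> P}"
    using f represents_ordering[OF \<psi>(1) P(1)] D.zeroprimeideal unfolding positive_semidefinite_def by blast
  then show False using P(2) \<psi>f representsD(5)[OF \<psi>(1)] by simp
qed

lemma formally_real_frac:
  assumes two: "(2::'a) \<noteq> 0" and "- 1 \<notin> sos (fractions A)"
  shows "formally_real (frac_field R)"
proof -
  note sf = sub_field_fractions[OF A]
  obtain \<psi> where \<psi>: "represents \<psi> (frac_field R) (fractions A)"
    using represents_frac_field[OF represents_R] by blast
  have "- 1 \<in> fractions A" by (intro sub_ringD(1,3)[OF sub_fieldD(1)[OF sf]])
  then obtain P where "positive_cone (fractions A) P" using artin[OF sf two _ assms(2)] by blast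
  then show ?thesis
    unfolding formally_real_def using represents_field[OF \<psi> sf] represents_ordering[OF \<psi>] by blast
qed

text \<open>An ideal not contained in \<open>m\<close> contains a unit, which settles maximality and uniqueness at once.\<close>

lemma maximal_copy:
  assumes m: "m \<subseteq> A" "0 \<in> m" "\<And>a b. a \<in> m \<Longrightarrow> b \<in> m \<Longrightarrow> a - b \<in> m" "\<And>a b. a \<in> A \<Longrightarrow> b \<in> m \<Longrightarrow> a * b \<in> m"
    and "1 \<notin> m" and unit: "\<And>a. a \<in> A \<Longrightarrow> a \<notin> m \<Longrightarrow> inverse a \<in> A"
  shows "maximalideal (j ` m) R" "maximalideal M R \<Longrightarrow> M = j ` m"
proof -
  have id: "ideal (j ` m) R" by (rule ideal_copy[OF m])
  have mem: "a \<in> m" if "a \<in> A" "j a \<in> j ` m" for a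
    using that m(1) inj by (auto simp: inj_on_def)
  have proper: "carrier R \<noteq> j ` m"
    using mem[OF sub_ringD(1)[OF A]] assms(5) j_in[OF sub_ringD(1)[OF A]] by auto
  have unitideal: "J = carrier R" if J: "ideal J R" "\<not> J \<subseteq> j ` m" for J
  proof -
    interpret J: ideal J R by fact
    obtain x where x: "x \<in> J" "x \<notin> j ` m" using J(2) by blast
    have xR: "x \<in> carrier R" using x(1) J.a_subset by blast
    have nm: "i x \<notin> m" using x(2) j_i[OF xR] by (metis image_eqI)
    then have u: "inverse (i x) \<in> A" "i x \<noteq> 0" using unit[OF i_in[OF xR]] m(2) by auto
    have "j (inverse (i x)) \<otimes>\<^bsub>R\<^esub> x \<in> J" using x(1) u by (intro J.I_l_closed j_in)
    moreover have "j (inverse (i x)) \<otimes>\<^bsub>R\<^esub> x = \<one>\<^bsub>R\<^esub>" using u by (simp add: R_def i_j)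
    ultimately show ?thesis using J.one_imp_carrier by simp
  qed
  show "maximalideal (j ` m) R"
    by (rule maximalidealI[OF id proper]) (use unitideal in blast)
  show "M = j ` m" if M: "maximalideal M R"
  proof -
    interpret M: maximalideal M R by fact
    have "M \<subseteq> j ` m" using unitideal[OF M.is_ideal] M.I_notcarr by blast
    moreover have "j ` m \<subseteq> carrier R" using m(1) j_in by auto
    ultimately show ?thesis using M.I_maximal[OF id] proper by blast
  qed
qed

lemma krull_dim_copy:
  assumes chain: "\<And>k. k \<le> n \<Longrightarrow> primeideal (j ` P k) R" "\<And>k. k \<le> n \<Longrightarrow> P k \<subseteq> A" "\<And>k. k < n \<Longrightarrow> P k \<subset> P (Suc k)"
    and bound: "\<And>p. (\<And>k. k \<le> Suc n \<Longrightarrow> primeideal (p k) R) \<Longrightarrow> (\<And>k. k < Suc n \<Longrightarrow> p k \<subset> p (Suc k)) \<Longrightarrow> False"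
  shows "krull_dim R = enat n"
  unfolding krull_dim_def
proof (rule antisym)
  let ?S = "{enat k | k. \<exists>p :: nat \<Rightarrow> real set. (\<forall>l\<le>k. primeideal (p l) R) \<and> (\<forall>l<k. p l \<subset> p (Suc l))}"
  show "Sup ?S \<le> enat n"
  proof (rule Sup_least)
    fix d assume "d \<in> ?S"
    then obtain k and p :: "nat \<Rightarrow> real set" where k: "d = enat k" "\<forall>l\<le>k. primeideal (p l) R" "\<forall>l<k. p l \<subset> p (Suc l)"
      by blast
    have "k \<le> n"
    proof (rule ccontr)
      assume "\<not> k \<le> n"
      then show False using bound[of p] k(2,3) by auto
    qed
    then show "d \<le> enat n" using k(1) by simp
  qed
  have "j ` P k \<subset> j ` P (Suc k)" if "k < n" for k
  proof -
    have "P k \<subseteq> A" "P (Suc k) \<subseteq> A" using chain(2) that by auto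
    then show ?thesis using chain(3)[OF that] inj by (metis inj_on_image_eq_iff image_mono psubset_eq)
  qed
  then have "enat n \<in> ?S" using chain(1) by (intro CollectI exI[of _ n] conjI exI[of _ "\<lambda>k. j ` P k"]) auto
  then show "enat n \<le> Sup ?S" by (rule Sup_upper)
qed

end

theorem theorem0p6:
  fixes n :: nat
  shows "\<exists>A :: (real, real) module.
    algebra (ring_of_type_algebra :: real ring) A \<and>
    regular_local_ring A \<and> krull_dim A = enat n \<and>
    (\<forall>f\<in>carrier A. positive_semidefinite A f \<longrightarrow> sum_of_squares A f) \<and>
    formally_real (frac_field A)"
proof -
  define A where "A = real_local n"
  note A = sub_ring_real_local[of n, folded A_def]
  have fixed: "conj n w = w" if "w \<in> A" for w using that by (simp add: A_def real_local_def)
  have "\<forall>w\<in>A. \<exists>e. w = val n e" using fixed fixed_is_val by blast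
  then obtain ex where ex: "\<And>w. w \<in> A \<Longrightarrow> w = val n (ex w)" by metis
  have inj: "inj_on (\<lambda>w. expr_code (ex w)) A"
  proof (rule inj_onI)
    fix u v assume "u \<in> A" "v \<in> A" "expr_code (ex u) = expr_code (ex v)"
    then show "u = v" using ex code_inject(1) by metis
  qed
  interpret real_copy A "\<lambda>w. expr_code (ex w)" "\<lambda>r. cst (complex_of_real r)"
  proof
    show "range (\<lambda>r. cst (complex_of_real r)) \<subseteq> A"
      by (auto simp: A_def real_local_def cst_of_real_fixed cst_in_local_at)
  qed (use A inj ring_map_cst_real in auto)
  let ?j = "\<lambda>w. expr_code (ex w)"
  let ?m = "vanishing n n \<inter> A" and ?x = "\<lambda>k. vr (Xv k)"
  have AO: "w \<in> local_at n" if "w \<in> A" for w using that by (simp add: A_def real_local_def)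
  have id: "vanishing n k \<inter> A \<subseteq> A" "0 \<in> vanishing n k \<inter> A"
    "\<And>a b. a \<in> vanishing n k \<inter> A \<Longrightarrow> b \<in> vanishing n k \<inter> A \<Longrightarrow> a - b \<in> vanishing n k \<inter> A"
    "\<And>a b. a \<in> A \<Longrightarrow> b \<in> vanishing n k \<inter> A \<Longrightarrow> a * b \<in> vanishing n k \<inter> A"
    "1 \<notin> vanishing n k \<inter> A" "\<And>a b. a \<in> A \<Longrightarrow> b \<in> A \<Longrightarrow> a * b \<in> vanishing n k \<inter> A \<Longrightarrow> a \<in> vanishing n k \<inter> A \<or> b \<in> vanishing n k \<inter> A"
    if k: "k \<le> n" for k
    using vanishing_ideal[OF k] vanishing_prime[OF k] AO sub_ringD[OF A] by auto
  have unit: "inverse a \<in> A" if "a \<in> A" "a \<notin> ?m" for a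
    using that local_at_unit[of a n] by (auto simp: A_def real_local_def conj_ring)
  note max = maximal_copy[OF id(1-5)[OF order_refl] unit]
  have local: "local_ring R"
    unfolding local_ring_def using cring_R max by blast
  have dim: "krull_dim R = enat n"
  proof (rule krull_dim_copy[where P = "\<lambda>k. vanishing n k \<inter> A"])
    show "primeideal (?j ` (vanishing n k \<inter> A)) R" if "k \<le> n" for k
      by (rule prime_copy[OF id[OF that]])
    show "vanishing n k \<inter> A \<subset> vanishing n (Suc k) \<inter> A" if "k < n" for k
      using vanishing_chain[OF that] by (simp add: A_def)
  next
    fix p assume p: "\<And>k. k \<le> Suc n \<Longrightarrow> primeideal (p k) R" and ch: "\<And>k. k < Suc n \<Longrightarrow> p k \<subset> p (Suc k)"
    have pi: "ideal (p k) R" if "k \<le> Suc n" for k using p[OF that] by (simp add: primeideal_def)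
    show False
    proof (rule no_long_prime_chain[of n "\<lambda>k. i ` p k", folded A_def])
      show "i ` p k \<subset> i ` p (Suc k)" if k: "k < Suc n" for k
        using ch[OF k] ideal_image(5)[OF pi[of k]] ideal_image(5)[OF pi[of "Suc k"]] k
        by (metis image_mono less_or_eq_imp_le psubset_eq Suc_leI)
    qed (use ideal_image[OF pi] prime_image[OF p] in auto)
  qed auto
  have gens: "?j ` ?m = Idl\<^bsub>R\<^esub> (?j ` ?x ` {..<n})"
  proof (rule ideal_generated)
    show xA: "?x ` {..<n} \<subseteq> A" using vr_X_in_real_local by (auto simp: A_def)
    show I: "ideal (?j ` ?m) R" by (rule ideal_copy[OF id(1-4)[OF order_refl]])
    have "i ` ?j ` ?m = ?m" using i_j by (force simp: image_image)
    then show "i ` ?j ` ?m = ideal_span A (?x ` {..<n})"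
      using maximal_ideal_span[of n] by (simp add: A_def)
  qed
  have "card (?j ` ?x ` {..<n}) = n"
  proof -
    have "inj_on ?x {..<n}" by (rule inj_onI) (use inj_vr in blast)
    moreover have "inj_on ?j (?x ` {..<n})"
      by (rule inj_on_subset[OF inj]) (use vr_X_in_real_local in \<open>auto simp: A_def\<close>)
    ultimately show ?thesis by (simp add: card_image)
  qed
  moreover have "?j ` ?x ` {..<n} \<subseteq> ?j ` ?m"
    using vr_X_in_vanishing vr_X_in_real_local by (auto simp: A_def)
  ultimately have reg: "regular_local_ring R"
    unfolding regular_local_ring_def
    using local noetherian_R[OF noeth_real_local[of n, folded A_def]] max(1) gens dim
    by (intro conjI exI[of _ "?j ` ?m"] exI[of _ "?j ` ?x ` {..<n}"]) auto
  have half: "inverse 2 \<in> A"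
  proof -
    have eq: "inverse 2 = cst (1 / 2)"
      by (rule inverse_unique) (use cst_half[of 1] in \<open>simp add: mult.commute\<close>)
    show ?thesis unfolding eq A_def real_local_def by (simp add: conj_simps cst_in_local_at)
  qed
  have sos: "sum_of_squares R f" if f: "f \<in> carrier R" "positive_semidefinite R f" for f
  proof -
    obtain d where d: "d \<in> A" "d \<noteq> 0" "d * d * i f \<in> sos A"
      using clear_denominators[OF psd_imp_sos_fractions[OF two_neq_0 f(2)]] by blast
    have "i f \<in> sos A"
      by (rule psd_sos_local[OF A half two_neq_0, where m = ?m and d = d])
        (use id[OF order_refl] unit divides_one_plus_sos[of _ n, folded A_def] d i_in[OF f(1)] in auto)
    then show ?thesis using sum_of_squares_copy[of "i f"] j_i[OF f(1)] by simp
  qed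
  have "fractions A \<subseteq> {w. conj n w = w}"
    using fixed by (auto simp: fractions_def conj_ring)
  then have "- 1 \<notin> sos (fractions A)"
    using fixed_field_real[of n] sos_mono by blast
  then have "formally_real (frac_field R)" by (rule formally_real_frac[OF two_neq_0])
  then show ?thesis using algebra_R reg dim sos by blast
qed

end
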